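(* Let $E,A\in\mathbb{R}^{m\times n}$, $C\in\mathbb{R}^{p\times n}$, $L\in\mathbb{R}^{r\times n}$, and consider the descriptor system $$E\dot x(t)=Ax(t),\qquad y(t)=Cx(t),\qquad z(t)=Lx(t).$$ With partial impulse observability, the matrices $\bar E,\bar A,\mathcal{F}_l,\mathcal{F}_{l,L}$ and the subspace $\mathcal{W}^*_{[\bar E,\bar A]}$ as defined in the context, the following statements are equivalent: (a) $(E,A,C)$ is partially impulse observable with respect to $L$. (b) For all integers $l\ge n+1$: $\operatorname{rank}\mathcal{F}_l=\operatorname{rank}\mathcal{F}_{l,L}$. (c) $\operatorname{rank}\mathcal{F}_{n+1}=\operatorname{rank}\mathcal{F}_{n+1,L}$. (d) $\mathcal{W}^*_{[\bar E,\bar A]}\cap \bar A^{-1}(\operatorname{im}\bar E)\subseteq\ker L$.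
   Context: **Piecewise-smooth distributions.** A function $f:\mathbb{R}\to\mathbb{R}$ is piecewise smooth if $f=\sum_{i\in\mathbb{Z}}\mathbf{1}_{[t_i,t_{i+1})}f_i$ for a locally finite, strictly increasing family $(t_i)_{i\in\mathbb{Z}}$, unbounded in both directions, and functions $f_i\in C^\infty(\mathbb{R})$. The space $\mathscr{D}'_{pw\mathscr{C}^\infty}$ of piecewise-smooth distributions consists of all distributions on $\mathbb{R}$ of the form $D=f_{\mathbb{D}}+\sum_{t\in T}D_t$, where $f_{\mathbb{D}}$ is the regular distribution induced by a piecewise-smooth $f$, $T\subseteq\mathbb{R}$ is locally finite, and each $D_t$ is a finite linear combination of the Dirac distribution $\delta_t$ at $t$ and its distributional derivatives $\delta_t^{(i)}$. This space is closed under distributional differentiation. The impulsive part of $D$ at $t$ is $D[t]:=D_t$ if $t\in T$ and $D[t]:=0$ otherwise. The restriction of $D$ to an interval $M$ is $D_M:=(\mathbf{1}_M f)_{\mathbb{D}}+\sum_{t\in T\cap M}D_t$. All of this is applied componentwise to vectors. **Behavior.** $\mathscr{B}$ is the set of all $(x,y,z)\in(\mathscr{D}'_{pw\mathscr{C}^\infty})^{n+p+r}$ that satisfy the system on $[0,\infty)$, i.e. $(E\dot x)_{[0,\infty)}=(Ax)_{[0,\infty)}$, $y_{[0,\infty)}=(Cx)_{[0,\infty)}$, $z_{[0,\infty)}=(Lx)_{[0,\infty)}$, where $\dot x$ is the distributional derivative on $\mathbb{R}$. The trajectories are free on $(-\infty,0)$ (so inconsistent initial values are allowed and may cause impulses at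 $t=0$). **Partial impulse observability.** $(E,A,C)$ is partially impulse observable with respect to $L$ if for all $(x,y,z)\in\mathscr{B}$: $\big(\forall t\ge 0:\ y[t]=0\big)\implies\big(\forall t\ge 0:\ z[t]=0\big)$. **Matrices.** $\bar E=\begin{bmatrix}E\\0\end{bmatrix}$, $\bar A=\begin{bmatrix}A\\C\end{bmatrix}\in\mathbb{R}^{(m+p)\times n}$, and $\bar E_1=\begin{bmatrix}\bar E\\0\end{bmatrix}$, $\bar A_1=\begin{bmatrix}\bar A\\L\end{bmatrix}\in\mathbb{R}^{(m+p+r)\times n}$. For $l\ge1$, $\mathcal{F}_l$ is the block upper bidiagonal matrix with $l$ block rows and $l$ block columns having $\bar E$ in every diagonal block, $\bar A$ in every block immediately to the right of the diagonal (block positions $(i,i+1)$, $i=1,\dots,l-1$), and zeros elsewhere: $$\mathcal{F}_l=\begin{bmatrix}\bar E&\bar A&&\\&\bar E&\ddots&\\&&\ddots&\bar A\\&&&\bar E\end{bmatrix}.$$ $\mathcal{F}_{l,L}$ is the matrix of the same form, again with $l$ block rows and $l$ block columns, with $\bar E,\bar A$ replaced by $\bar E_1,\bar A_1$. **Wong sequence.** For matrices $M,N$ of equal size $k\times n$, set $\mathcal{W}^0_{[M,N]}:=\{0\}$, $\mathcal{W}^{i+1}_{[M,N]}:=M^{-1}(N\,\mathcal{W}^i_{[M,N]})$ for $i\in\mathbb{N}$ (with $0\in\mathbb{N}$), and $\mathcal{W}^*_{[M,N]}:=\bigcup_{i\in\mathbb{N}}\mathcal{W}^i_{[M,N]}$.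 Here $NS=\{Nx: x\in S\}$ is the image of a subspace $S\subseteq\mathbb{R}^n$ and $M^{-1}S=\{x\in\mathbb{R}^n: Mx\in S\}$ is the preimage of a subspace $S\subseteq\mathbb{R}^k$ (no invertibility is assumed). *)

theory Defs
  imports
    "HOL-Analysis.Analysis"
    "Jordan_Normal_Form.Matrix_Kernel"
    "Jordan_Normal_Form.DL_Rank"
begin

unbundle no vec_syntax

definition smooth :: "(real \<Rightarrow> real) \<Rightarrow> bool" where
  "smooth f \<longleftrightarrow> (\<forall>k. (deriv ^^ k) f differentiable_on UNIV)"

definition fun_support :: "(real \<Rightarrow> real) \<Rightarrow> real set" where
  "fun_support f = closure {x. f x \<noteq> 0}"

lemma smooth_deriv:
  assumes "smooth f"
  shows "smooth (deriv f)"
  unfolding smooth_def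
proof
  fix k
  have "(deriv ^^ Suc k) f differentiable_on UNIV"
    using assms unfolding smooth_def by blast
  then show "(deriv ^^ k) (deriv f) differentiable_on UNIV"
    by (simp only: funpow_Suc_right o_apply)
qed

lemma smooth_zero: "smooth (\<lambda>_. 0)"
proof -
  have "(deriv ^^ k) (\<lambda>_::real. 0::real) = (\<lambda>_. 0)" for k
    by (induction k) auto
  then show ?thesis by (simp add: smooth_def)
qed

lemma smooth_has_deriv:
  assumes "smooth f"
  shows "((deriv ^^ k) f has_field_derivative (deriv ^^ Suc k) f x) (at x)"
proof -
  have "(deriv ^^ k) f differentiable (at x)"
    using assms by (auto simp: smooth_def differentiable_on_def)
  then have "(deriv ^^ k) f field_differentiable (at x)"
    by (auto simp: field_differentiable_def real_differentiable_def)
  then show ?thesis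
    by (simp add: DERIV_deriv_iff_field_differentiable)
qed

lemma higher_deriv_lincomb:
  assumes "smooth f" "smooth g"
  shows "(deriv ^^ k) (\<lambda>x. a * f x + b * g x)
           = (\<lambda>x. a * (deriv ^^ k) f x + b * (deriv ^^ k) g x)"
proof (induction k)
  case (Suc k)
  have "deriv (\<lambda>x. a * (deriv ^^ k) f x + b * (deriv ^^ k) g x) x
          = a * (deriv ^^ Suc k) f x + b * (deriv ^^ Suc k) g x" for x
    by (rule DERIV_imp_deriv)
      (intro DERIV_add DERIV_cmult smooth_has_deriv assms)
  then show ?case using Suc by auto
qed simp

lemma smooth_lincomb:
  assumes "smooth f" "smooth g"
  shows "smooth (\<lambda>x. a * f x + b * g x)"
  unfolding smooth_def higher_deriv_lincomb[OF assms]
  using assms by (simp add: smooth_def differentiable_on_add differentiable_on_mult)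

lemma compact_fun_support_subset:
  assumes "compact K" "\<And>x. x \<notin> K \<Longrightarrow> f x = 0"
  shows "compact (fun_support f)"
proof -
  have "fun_support f \<subseteq> K"
    unfolding fun_support_def
    by (rule closure_minimal) (use assms in \<open>auto intro: compact_imp_closed\<close>)
  moreover have "{x. f x \<noteq> 0} \<subseteq> fun_support f"
    unfolding fun_support_def by (rule closure_subset)
  ultimately have "{x. f x \<noteq> 0} \<subseteq> K" by (rule subset_trans[rotated])
  then have "bounded {x. f x \<noteq> 0}"
    by (rule bounded_subset[OF compact_imp_bounded[OF assms(1)]])
  then show ?thesis
    by (simp add: fun_support_def compact_closure)
qed

lemma outside_fun_support: "x \<notin> fun_support f \<Longrightarrow> f x = 0"
  using closure_subset[of "{x. f x \<noteq> 0}"] by (auto simp: fun_support_def)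

lemma deriv_outside_fun_support:
  assumes "x \<notin> fun_support f"
  shows "deriv f x = 0"
proof -
  have "open (- fun_support f)"
    unfolding fun_support_def by (rule open_Compl) (rule closed_closure)
  moreover have "x \<in> - fun_support f"
    using assms by simp
  moreover have "0 = f y" if "y \<in> - fun_support f" for y
    using outside_fun_support[of y f] that by simp
  ultimately have "(f has_field_derivative 0) (at x)"
    by (rule has_field_derivative_transform_within_open[OF DERIV_const])
  then show ?thesis by (rule DERIV_imp_deriv)
qed

lemma compact_fun_support_lincomb:
  assumes "compact (fun_support f)" "compact (fun_support g)"
  shows "compact (fun_support (\<lambda>x. a * f x + b * g x))"
proof (rule compact_fun_support_subset)
  show "compact (fun_support f \<union> fun_support g)"
    using assms by (rule compact_Un)
  show "a * f x + b * g x = 0" if "x \<notin> fun_support f \<union> fun_support g" for x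
    using outside_fun_support[of x f] outside_fun_support[of x g] that by simp
qed

typedef test_fun = "{\<phi>. smooth \<phi> \<and> compact (fun_support \<phi>)}"
  morphisms tf_apply Abs_test_fun
  by (rule exI[of _ "\<lambda>_. 0"]) (simp add: smooth_zero fun_support_def)

setup_lifting type_definition_test_fun

instantiation test_fun :: real_vector
begin

lift_definition zero_test_fun :: test_fun is "\<lambda>_. 0"
  by (simp add: smooth_zero fun_support_def)

lift_definition plus_test_fun :: "test_fun \<Rightarrow> test_fun \<Rightarrow> test_fun" is
  "\<lambda>f g x. f x + g x"
  subgoal for f g
    using smooth_lincomb[of f g 1 1] compact_fun_support_lincomb[of f g 1 1] by simp
  done

lift_definition minus_test_fun :: "test_fun \<Rightarrow> test_fun \<Rightarrow> test_fun" is
  "\<lambda>f g x. f x - g x"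
  subgoal for f g
    using smooth_lincomb[of f g 1 "-1"] compact_fun_support_lincomb[of f g 1 "-1"] by simp
  done

lift_definition uminus_test_fun :: "test_fun \<Rightarrow> test_fun" is "\<lambda>f x. - f x"
  subgoal for f
    using smooth_lincomb[of f f "-1" 0] compact_fun_support_lincomb[of f f "-1" 0] by simp
  done

lift_definition scaleR_test_fun :: "real \<Rightarrow> test_fun \<Rightarrow> test_fun" is "\<lambda>a f x. a * f x"
  subgoal for a f
    using smooth_lincomb[of f f a 0] compact_fun_support_lincomb[of f f a 0] by simp
  done

instance
  by standard (transfer; simp add: algebra_simps fun_eq_iff)+

end

lift_definition tf_deriv :: "test_fun \<Rightarrow> test_fun" is deriv
  subgoal for f
    using smooth_deriv[of f] compact_fun_support_subset[of "fun_support f" "deriv f"]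
      deriv_outside_fun_support[of _ f] by blast
  done

abbreviation tf_support :: "test_fun \<Rightarrow> real set" where
  "tf_support \<phi> \<equiv> fun_support (tf_apply \<phi>)"

definition tf_null_sequence :: "(nat \<Rightarrow> test_fun) \<Rightarrow> bool" where
  "tf_null_sequence \<phi> \<longleftrightarrow>
     (\<exists>K. compact K \<and> (\<forall>j. tf_support (\<phi> j) \<subseteq> K)) \<and>
     (\<forall>k. uniform_limit UNIV (\<lambda>j. (deriv ^^ k) (tf_apply (\<phi> j))) (\<lambda>_. 0) sequentially)"

type_synonym functional = "test_fun \<Rightarrow> real"

text \<open>For linear functionals, continuity with respect to the inductive limit topology on the
  test functions is the same as sequential continuity at zero.\<close>

definition distributions :: "functional set" where
  "distributions =
     {D. linear D \<and> (\<forall>\<phi>. tf_null_sequence \<phi> \<longrightarrow> (\<lambda>j. D (\<phi> j)) \<longlonglongrightarrow> 0)}"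

definition dist_deriv :: "functional \<Rightarrow> functional" where
  "dist_deriv D = (\<lambda>\<phi>. - D (tf_deriv \<phi>))"

definition dirac :: "real \<Rightarrow> functional" where
  "dirac t = (\<lambda>\<phi>. tf_apply \<phi> t)"

definition regular_dist :: "(real \<Rightarrow> real) \<Rightarrow> functional" where
  "regular_dist f = (\<lambda>\<phi>. LINT x|lborel. f x * tf_apply \<phi> x)"

definition locally_finite :: "real set \<Rightarrow> bool" where
  "locally_finite T \<longleftrightarrow> (\<forall>a b. finite (T \<inter> {a..b}))"

text \<open>As the intervals \<open>[t i, t (i+1))\<close> partition the real line, the defining sum has
  exactly one active summand at each point.\<close>

definition piecewise_smooth :: "(real \<Rightarrow> real) \<Rightarrow> bool" where
  "piecewise_smooth f \<longleftrightarrow>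
     (\<exists>(t :: int \<Rightarrow> real) (g :: int \<Rightarrow> real \<Rightarrow> real).
        strict_mono t \<and> locally_finite (range t) \<and>
        \<not> bdd_above (range t) \<and> \<not> bdd_below (range t) \<and>
        (\<forall>i. smooth (g i)) \<and>
        (\<forall>i. \<forall>x\<in>{t i..<t (i + 1)}. f x = g i x))"

definition point_impulses :: "real \<Rightarrow> functional set" where
  "point_impulses t =
     {D. \<exists>N (c :: nat \<Rightarrow> real). D = (\<lambda>\<phi>. \<Sum>i\<le>N. c i * (dist_deriv ^^ i) (dirac t) \<phi>)}"

text \<open>Since \<open>\<Delta> t\<close> vanishes on test functions whose support omits \<open>t\<close>, the sum over \<open>T\<close> may be
  taken over \<open>T \<inter> supp \<phi>\<close>, which is finite for locally finite \<open>T\<close>.\<close>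

definition pw_dist :: "(real \<Rightarrow> real) \<Rightarrow> real set \<Rightarrow> (real \<Rightarrow> functional) \<Rightarrow> functional" where
  "pw_dist f T \<Delta> = (\<lambda>\<phi>. regular_dist f \<phi> + (\<Sum>t\<in>T \<inter> tf_support \<phi>. \<Delta> t \<phi>))"

definition pw_data :: "(real \<Rightarrow> real) \<Rightarrow> real set \<Rightarrow> (real \<Rightarrow> functional) \<Rightarrow> bool" where
  "pw_data f T \<Delta> \<longleftrightarrow>
     piecewise_smooth f \<and> locally_finite T \<and> (\<forall>t\<in>T. \<Delta> t \<in> point_impulses t)"

definition pw_distributions :: "functional set" where
  "pw_distributions = {D \<in> distributions. \<exists>f T \<Delta>. pw_data f T \<Delta> \<and> D = pw_dist f T \<Delta>}"

text \<open>The function \<open>f\<close> and the nonzero \<open>\<Delta> t\<close> are determined by the distribution, so the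
  impulsive part and the restriction do not depend on the chosen representation.
  Both are only meaningful on \<open>pw_distributions\<close>.\<close>

definition impulsive_part :: "functional \<Rightarrow> real \<Rightarrow> functional" where
  "impulsive_part D t =
     (THE I. \<exists>f T \<Delta>. pw_data f T \<Delta> \<and> D = pw_dist f T \<Delta> \<and>
                      I = (if t \<in> T then \<Delta> t else (\<lambda>_. 0)))"

definition dist_restrict :: "real set \<Rightarrow> functional \<Rightarrow> functional" where
  "dist_restrict M D =
     (THE R. \<exists>f T \<Delta>. pw_data f T \<Delta> \<and> D = pw_dist f T \<Delta> \<and>
                      R = pw_dist (\<lambda>x. indicator M x * f x) (T \<inter> M) \<Delta>)"

definition pw_dist_vecs :: "nat \<Rightarrow> functional Matrix.vec set" where
  "pw_dist_vecs k = {x \<in> carrier_vec k. \<forall>i<k. x $ i \<in> pw_distributions}"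

definition mat_mult_dist :: "real mat \<Rightarrow> functional Matrix.vec \<Rightarrow> functional Matrix.vec" where
  "mat_mult_dist M x =
     Matrix.vec (dim_row M) (\<lambda>i \<phi>. \<Sum>j<dim_col M. M $$ (i, j) * (x $ j) \<phi>)"

definition behavior ::
  "real mat \<Rightarrow> real mat \<Rightarrow> real mat \<Rightarrow> real mat \<Rightarrow>
     (functional Matrix.vec \<times> functional Matrix.vec \<times> functional Matrix.vec) set" where
  "behavior E A C L =
     {(x, y, z).
        x \<in> pw_dist_vecs (dim_col E) \<and> y \<in> pw_dist_vecs (dim_row C) \<and> z \<in> pw_dist_vecs (dim_row L) \<and>
        map_vec (dist_restrict {0..}) (mat_mult_dist E (map_vec dist_deriv x))
          = map_vec (dist_restrict {0..}) (mat_mult_dist A x) \<and>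
        map_vec (dist_restrict {0..}) y = map_vec (dist_restrict {0..}) (mat_mult_dist C x) \<and>
        map_vec (dist_restrict {0..}) z = map_vec (dist_restrict {0..}) (mat_mult_dist L x)}"

definition impulse_free_at :: "functional Matrix.vec \<Rightarrow> real \<Rightarrow> bool" where
  "impulse_free_at v t \<longleftrightarrow> (\<forall>i<dim_vec v. impulsive_part (v $ i) t = (\<lambda>_. 0))"

definition partially_impulse_observable ::
  "real mat \<Rightarrow> real mat \<Rightarrow> real mat \<Rightarrow> real mat \<Rightarrow> bool" where
  "partially_impulse_observable E A C L \<longleftrightarrow>
     (\<forall>(x, y, z) \<in> behavior E A C L.
        (\<forall>t\<ge>0. impulse_free_at y t) \<longrightarrow> (\<forall>t\<ge>0. impulse_free_at z t))"

abbreviation mat_rank :: "real mat \<Rightarrow> nat" where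
  "mat_rank M \<equiv> vec_space.rank (dim_row M) M"

definition E_bar :: "real mat \<Rightarrow> real mat \<Rightarrow> real mat" where
  "E_bar E C = E @\<^sub>r 0\<^sub>m (dim_row C) (dim_col E)"

definition A_bar :: "real mat \<Rightarrow> real mat \<Rightarrow> real mat" where
  "A_bar A C = A @\<^sub>r C"

definition E_bar1 :: "real mat \<Rightarrow> real mat \<Rightarrow> real mat \<Rightarrow> real mat" where
  "E_bar1 E C L = E_bar E C @\<^sub>r 0\<^sub>m (dim_row L) (dim_col E)"

definition A_bar1 :: "real mat \<Rightarrow> real mat \<Rightarrow> real mat \<Rightarrow> real mat" where
  "A_bar1 A C L = A_bar A C @\<^sub>r L"

text \<open>\<open>l \<times> l\<close> blocks, with \<open>M\<close> on the diagonal and \<open>N\<close> (of the same size) on the superdiagonal.\<close>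

definition block_bidiagonal :: "nat \<Rightarrow> real mat \<Rightarrow> real mat \<Rightarrow> real mat" where
  "block_bidiagonal l M N =
     (let k = dim_row M; n = dim_col M in
      mat (l * k) (l * n) (\<lambda>(i, j).
        if j div n = i div k then M $$ (i mod k, j mod n)
        else if j div n = Suc (i div k) then N $$ (i mod k, j mod n)
        else 0))"

definition F_mat :: "nat \<Rightarrow> real mat \<Rightarrow> real mat \<Rightarrow> real mat \<Rightarrow> real mat" where
  "F_mat l E A C = block_bidiagonal l (E_bar E C) (A_bar A C)"

definition F_mat_L :: "nat \<Rightarrow> real mat \<Rightarrow> real mat \<Rightarrow> real mat \<Rightarrow> real mat \<Rightarrow> real mat" where
  "F_mat_L l E A C L = block_bidiagonal l (E_bar1 E C L) (A_bar1 A C L)"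

definition mat_image :: "real mat \<Rightarrow> real Matrix.vec set \<Rightarrow> real Matrix.vec set" where
  "mat_image M S = (\<lambda>x. M *\<^sub>v x) ` S"

definition mat_preimage :: "real mat \<Rightarrow> real Matrix.vec set \<Rightarrow> real Matrix.vec set" where
  "mat_preimage M S = {x \<in> carrier_vec (dim_col M). M *\<^sub>v x \<in> S}"

primrec wong :: "real mat \<Rightarrow> real mat \<Rightarrow> nat \<Rightarrow> real Matrix.vec set" where
  "wong M N 0 = {0\<^sub>v (dim_col M)}"
| "wong M N (Suc i) = mat_preimage M (mat_image N (wong M N i))"

definition wong_limit :: "real mat \<Rightarrow> real mat \<Rightarrow> real Matrix.vec set" where
  "wong_limit M N = (\<Union>i. wong M N i)"

end

theory Submission
  imports Defs
begin

text \<open>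
  All four statements say the same thing about finite chains of vectors. Write
  \<open>M\<close> and \<open>N\<close> for the matrices \<open>E_bar E C\<close> and \<open>A_bar A C\<close>. A \<^emph>\<open>descent sequence\<close>
  (\<open>descent\<close>) is a sequence \<open>u 0, u 1, \<dots>\<close> that is eventually zero and satisfies
  \<open>M *\<^sub>v u i = N *\<^sub>v u (i + 1)\<close>, that is, \<open>E *\<^sub>v u i = A *\<^sub>v u (i + 1)\<close> and
  \<open>C *\<^sub>v u (i + 1) = 0\<close>. Each statement is equivalent to: \<open>L\<close> annihilates \<open>u 1, u 2, \<dots>\<close> for
  every descent sequence \<open>u\<close> (of a length that depends on the statement).

  \<^item> \<^emph>\<open>Observability\<close> (\<open>observable_iff_descents_vanish\<close>). At a time \<open>t \<ge> 0\<close> let the impulsive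
    part of \<open>x\<close> be the combination of the \<open>i\<close>-th derivatives of the Dirac distribution at \<open>t\<close> with
    coefficient vectors \<open>u (i + 1)\<close>, and let \<open>u 0\<close> be the jump of \<open>x\<close> at \<open>t\<close>. The impulsive part of
    the derivative of \<open>x\<close> then has the coefficients \<open>u i\<close>. Since derivatives of the Dirac
    distribution are linearly independent, comparing coefficients in the system equation together
    with the absence of impulses in \<open>y\<close> says exactly that \<open>u\<close> is a descent sequence, and \<open>z\<close> is
    free of impulses exactly if \<open>L\<close> annihilates \<open>u 1, u 2, \<dots>\<close>. Conversely every descent sequence
    arises at time \<open>0\<close> from the trajectory that is constantly \<open>- u 0\<close> on the negative half-line,
    vanishes on the positive one, and has the prescribed impulses at \<open>0\<close>.

  \<^item> \<^emph>\<open>Rank conditions\<close> (\<open>rank_block_bidiagonal_eq_iff\<close>). Splitting a kernel vector of \<open>F_mat l\<close>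
    into blocks and alternating their signs gives a descent sequence of length \<open>l\<close>. The matrix
    \<open>F_mat_L l\<close> has the same columns and merely the additional rows \<open>L *\<^sub>v u (i + 1) = 0\<close>; by the
    rank-nullity theorem the ranks agree iff the kernels do.

  \<^item> \<^emph>\<open>Wong sequence\<close> (\<open>descent_kills_iff_wong\<close>, \<open>wong_stabilizes\<close>). The first members of the
    descent sequences of length \<open>l\<close> form the \<open>l\<close>-th Wong space, so that the possible \<open>u 1\<close> are
    the members of a Wong space that lie in the preimage under \<open>N\<close> of the image of \<open>M\<close>. The
    increasing Wong spaces are constant from index \<open>n\<close> on for dimension reasons, which is why
    \<open>l = n + 1\<close> is as good as all larger \<open>l\<close>.

  For the first item the impulsive part and the restriction, which are defined by description
  operators, must be computed. This rests on three analytic facts: a distribution determines its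
  regular and its impulsive part (\<open>pw_dist_unique\<close>, tested with bump functions), the two parts
  depend linearly on it (\<open>regular_part_sum\<close>), and differentiation acts on them by adding the jump
  of the regular part to the differentiated impulsive part (\<open>regular_part_dist_deriv\<close>, integration
  by parts).
\<close>

section \<open>Dimension of subspaces and rank\<close>

text \<open>Linear independence and spans do not depend on whether they are taken in a subspace or in the
ambient space; hence a maximal independent subset of a subspace \<open>U\<close> exists and is a basis of \<open>U\<close>.\<close>

lemma (in vectorspace) subspace_basis_ex:
  assumes fd: "fin_dim" and U: "subspace K U V"
  obtains B where "finite B" "B \<subseteq> U" "lin_indpt B" "span B = U"
    "vectorspace.basis K (vs U) B" "card B = vectorspace.dim K (vs U)"
proof -
  interpret U: vectorspace K "vs U" using U by (rule subspace_is_vs)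
  have UV: "U \<subseteq> carrier V" and sub: "submodule K U V"
    using U by (auto simp: subspace_def submodule_def)
  have small: "finite A \<and> card A \<le> dim" if "A \<subseteq> U" "U.lin_indpt A" for A
  proof -
    have "lin_indpt A" using span_li_not_depend(2)[OF that(1) sub] that(2) by simp
    moreover have "A \<subseteq> carrier V" using that(1) UV by blast
    ultimately show ?thesis using li_le_dim[OF fd] by blast
  qed
  have "\<exists>A. finite A \<and> maximal A (\<lambda>S. S \<subseteq> carrier (vs U) \<and> U.lin_indpt S)"
    by (rule maximal_exists[where N = dim and B = "{}"]) (use small UV in \<open>auto simp: U.lin_dep_def intro: finite_subset\<close>)
  then obtain B where B: "finite B" "maximal B (\<lambda>S. S \<subseteq> carrier (vs U) \<and> U.lin_indpt S)" by blast
  then have BU: "B \<subseteq> U" and li: "U.lin_indpt B" by (auto simp: maximal_def)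
  have bas: "U.basis B" using B by (intro U.max_li_is_basis) auto
  show ?thesis
  proof
    show "lin_indpt B" using span_li_not_depend(2)[OF BU sub] li by simp
    show "span B = U"
      using span_li_not_depend(1)[OF BU sub] bas by (auto simp: U.basis_def)
    show "card B = U.dim" using U.dim_basis[OF B(1) bas] by simp
  qed (use B BU bas in auto)
qed

lemma (in vectorspace) dim_subspace_le:
  assumes fd: "fin_dim" and U: "subspace K U V"
  shows "vectorspace.dim K (vs U) \<le> dim"
proof -
  obtain B where B: "finite B" "B \<subseteq> U" "lin_indpt B" "card B = vectorspace.dim K (vs U)"
    using subspace_basis_ex[OF assms] by metis
  moreover have "U \<subseteq> carrier V" using U by (auto simp: subspace_def submodule_def)
  ultimately have "B \<subseteq> carrier V" by blast
  from li_le_dim(2)[OF fd this B(3)] B(4) show ?thesis by simp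
qed

lemma (in vectorspace) subspace_eq_if_dim_le:
  assumes fd: "fin_dim" and U: "subspace K U V" and W: "subspace K W V" and "U \<subseteq> W"
    and le: "vectorspace.dim K (vs W) \<le> vectorspace.dim K (vs U)"
  shows "U = W"
proof -
  interpret W: vectorspace K "vs W" using W by (rule subspace_is_vs)
  obtain B where B: "finite B" "B \<subseteq> U" "lin_indpt B" "span B = U" "card B = vectorspace.dim K (vs U)"
    using subspace_basis_ex[OF fd U] by metis
  obtain D where D: "finite D" "W.basis D"
    using subspace_basis_ex[OF fd W] by metis
  have sub: "submodule K W V" using W by (auto simp: subspace_def)
  have BW: "B \<subseteq> W" using B \<open>U \<subseteq> W\<close> by auto
  have "W.fin_dim" using D unfolding W.fin_dim_def W.basis_def by auto
  then have "W.basis B"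
    using B BW le span_li_not_depend(2)[OF BW sub] by (intro W.dim_li_is_basis) auto
  then have "span B = W"
    using span_li_not_depend(1)[OF BW sub] by (auto simp: W.basis_def)
  then show ?thesis using B by simp
qed

lemma subspace_vec_iff:
  "subspace class_ring U (module_vec TYPE(real) n) \<longleftrightarrow>
    U \<subseteq> carrier_vec n \<and> 0\<^sub>v n \<in> U \<and> (\<forall>v\<in>U. \<forall>w\<in>U. v + w \<in> U) \<and> (\<forall>c. \<forall>v\<in>U. c \<cdot>\<^sub>v v \<in> U)"
proof -
  interpret vec_space "TYPE(real)" n .
  show ?thesis
    unfolding subspace_def submodule_def
    using vectorspace_axioms module_axioms by (auto simp: class_ring_simps module_vec_simps)
qed

lemma mult_mat_vec_module_hom:
  fixes M :: "real mat"
  assumes M: "M \<in> carrier_mat k n"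
  shows "(\<lambda>v. M *\<^sub>v v) \<in> module_hom class_ring (module_vec TYPE(real) n) (module_vec TYPE(real) k)"
  unfolding module_hom_def
  using mult_add_distrib_mat_vec[OF M] mult_mat_vec[OF M] M
  by (simp add: module_vec_def)

lemma mat_image_eq_span_cols:
  fixes M :: "real mat"
  assumes M: "M \<in> carrier_mat k n"
  shows "(\<lambda>v. M *\<^sub>v v) ` carrier_vec n =
    LinearCombinations.module.span class_ring (module_vec TYPE(real) k) (set (cols M))"
proof -
  interpret W: vec_space "TYPE(real)" k .
  note col_space_eq = W.col_space_eq[OF M]
  show ?thesis using col_space_eq M unfolding W.col_space_def by auto
qed

text \<open>The image of \<open>M\<close> is the span of its columns, so that the abstract rank-nullity theorem applies to
the linear map \<open>v \<mapsto> M *\<^sub>v v\<close>.\<close>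

lemma rank_plus_nullity:
  fixes M :: "real mat"
  assumes M: "M \<in> carrier_mat k n"
  shows "vec_space.rank k M + kernel_dim M = n"
proof -
  interpret V: vec_space "TYPE(real)" n .
  interpret W: vec_space "TYPE(real)" k .
  interpret T: linear_map class_ring V.V W.V "\<lambda>v. M *\<^sub>v v"
    by (intro linear_map.intro V.vectorspace_axioms W.vectorspace_axioms
        mod_hom.intro V.module_axioms W.module_axioms mod_hom_axioms.intro
        mult_mat_vec_module_hom[OF M])
  have im: "T.im = W.span (set (cols M))"
    unfolding T.im_def module_vec_simps by (rule mat_image_eq_span_cols[OF M])
  have dims: "dim_col M = n" "dim_row M = k"
    using M by simp_all
  have ker: "T.ker = mat_kernel M"
    unfolding T.ker_def mat_kernel_def module_vec_simps dims ..
  have "vectorspace.dim class_ring (W.vs T.im) + vectorspace.dim class_ring (V.vs T.ker) = n"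
    using T.rank_nullity_main(1)[OF V.fin_dim] unfolding V.dim_is_n .
  then show ?thesis
    unfolding im ker W.rank_def kernel_dim_def dims .
qed

lemma mat_kernel_subspace:
  fixes M :: "real mat"
  assumes M: "M \<in> carrier_mat k n"
  shows "subspace class_ring (mat_kernel M) (module_vec TYPE(real) n)"
  unfolding subspace_vec_iff
  using M by (auto simp: mat_kernel_def mult_add_distrib_mat_vec mult_mat_vec)

text \<open>Both matrices have \<open>n\<close> columns, so by rank-nullity equal ranks mean equal nullities, and nested
kernels of equal dimension coincide.\<close>

lemma rank_eq_iff_kernel_subset:
  fixes M N :: "real mat"
  assumes M: "M \<in> carrier_mat k n" and N: "N \<in> carrier_mat k' n"
    and sub: "mat_kernel N \<subseteq> mat_kernel M"
  shows "mat_rank M = mat_rank N \<longleftrightarrow> mat_kernel M \<subseteq> mat_kernel N"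
proof
  interpret V: vec_space "TYPE(real)" n .
  have kd: "kernel_dim M = vectorspace.dim class_ring (V.vs (mat_kernel M))"
    "kernel_dim N = vectorspace.dim class_ring (V.vs (mat_kernel N))"
    using M N by (simp_all only: kernel_dim_def carrier_matD)
  have rows: "dim_row M = k" "dim_row N = k'" using M N by simp_all
  note rn = rank_plus_nullity[OF M] rank_plus_nullity[OF N]
  show "mat_kernel M \<subseteq> mat_kernel N" if "mat_rank M = mat_rank N"
  proof -
    have "kernel_dim M = kernel_dim N"
      using rn that unfolding rows by linarith
    then have "mat_kernel N = mat_kernel M"
      using V.subspace_eq_if_dim_le[OF V.fin_dim mat_kernel_subspace[OF N] mat_kernel_subspace[OF M] sub]
      unfolding kd by simp
    then show ?thesis by simp
  qed
  show "mat_rank M = mat_rank N" if "mat_kernel M \<subseteq> mat_kernel N"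
  proof -
    have "mat_kernel M = mat_kernel N" using that sub by blast
    then have "kernel_dim M = kernel_dim N" unfolding kd by simp
    then show ?thesis using rn unfolding rows by linarith
  qed
qed

section \<open>Wong sequences and descent sequences\<close>

text \<open>Finite chains are represented by infinite sequences that vanish from index \<open>l\<close> on. The chain
equation then also covers the last step \<open>M *\<^sub>v u (l - 1) = 0\<close>, and chains can be shifted and
prolonged without case distinctions.\<close>

definition descent :: "real mat \<Rightarrow> real mat \<Rightarrow> nat \<Rightarrow> (nat \<Rightarrow> real Matrix.vec) \<Rightarrow> bool" where
  "descent M N l u \<longleftrightarrow> (\<forall>i. u i \<in> carrier_vec (dim_col M)) \<and>
     (\<forall>i. M *\<^sub>v u i = N *\<^sub>v u (Suc i)) \<and> (\<forall>i\<ge>l. u i = 0\<^sub>v (dim_col M))"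

lemma mat_mult_zero_vec:
  fixes M :: "real mat"
  shows "M *\<^sub>v 0\<^sub>v (dim_col M) = 0\<^sub>v (dim_row M)"
  by (rule eq_vecI) auto

text \<open>Unfolding the recursion of the Wong sequence step by step yields the chain of witnesses.\<close>

lemma wong_iff_descent:
  assumes M: "M \<in> carrier_mat k n" and N: "N \<in> carrier_mat k n"
  shows "v \<in> wong M N j \<longleftrightarrow> (\<exists>u. descent M N j u \<and> u 0 = v)"
proof (induction j arbitrary: v)
  case 0
  have "M *\<^sub>v 0\<^sub>v n = N *\<^sub>v 0\<^sub>v n"
    using M N mat_mult_zero_vec[of M] mat_mult_zero_vec[of N] by simp
  then have "descent M N 0 (\<lambda>_. 0\<^sub>v n)"
    using M unfolding descent_def by simp
  moreover have "u 0 = 0\<^sub>v n" if "descent M N 0 u" for u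
    using that M unfolding descent_def by (metis carrier_matD(2) le0)
  moreover have "wong M N 0 = {0\<^sub>v n}" using M by simp
  ultimately show ?case by (metis singleton_iff)
next
  case (Suc j)
  show ?case
  proof
    assume "v \<in> wong M N (Suc j)"
    then obtain w where v: "v \<in> carrier_vec n" and w: "w \<in> wong M N j" "M *\<^sub>v v = N *\<^sub>v w"
      using M by (auto simp: mat_preimage_def mat_image_def)
    obtain u where u: "descent M N j u" "u 0 = w" using Suc.IH w by blast
    define u' where "u' i = (case i of 0 \<Rightarrow> v | Suc i \<Rightarrow> u i)" for i
    have u'_simps: "u' 0 = v" "\<And>i. u' (Suc i) = u i" by (simp_all add: u'_def)
    have "descent M N (Suc j) u'"
      unfolding descent_def
    proof (intro conjI allI impI)
      show "u' i \<in> carrier_vec (dim_col M)" for i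
        using u v M by (cases i) (auto simp: u'_simps descent_def)
      show "M *\<^sub>v u' i = N *\<^sub>v u' (Suc i)" for i
        using u w by (cases i) (auto simp: u'_simps descent_def)
      show "u' i = 0\<^sub>v (dim_col M)" if "i \<ge> Suc j" for i
        using u that by (cases i) (auto simp: u'_simps descent_def)
    qed
    then show "\<exists>u. descent M N (Suc j) u \<and> u 0 = v" using u'_simps(1) by blast
  next
    assume "\<exists>u. descent M N (Suc j) u \<and> u 0 = v"
    then obtain u where u: "descent M N (Suc j) u" "u 0 = v" by blast
    then have "descent M N j (\<lambda>i. u (Suc i))" by (auto simp: descent_def)
    then have "u 1 \<in> wong M N j" using Suc.IH by auto
    moreover have "v \<in> carrier_vec n" "M *\<^sub>v v = N *\<^sub>v u 1"
      using u M by (auto simp: descent_def)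
    ultimately show "v \<in> wong M N (Suc j)"
      using M by (auto simp: mat_preimage_def mat_image_def)
  qed
qed

lemma wong_mono:
  assumes M: "M \<in> carrier_mat k n" and N: "N \<in> carrier_mat k n" and "i \<le> j"
  shows "wong M N i \<subseteq> wong M N j"
proof
  fix v assume "v \<in> wong M N i"
  then obtain u where "descent M N i u" "u 0 = v" using wong_iff_descent[OF M N] by blast
  then have "descent M N j u" "u 0 = v" using \<open>i \<le> j\<close> by (auto simp: descent_def)
  then show "v \<in> wong M N j" using wong_iff_descent[OF M N] by blast
qed

lemma wong_subspace:
  assumes M: "M \<in> carrier_mat k n" and N: "N \<in> carrier_mat k n"
  shows "subspace class_ring (wong M N i) (module_vec TYPE(real) n)"
proof (induction i)
  case 0
  then show ?case using M unfolding subspace_vec_iff by auto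
next
  case (Suc i)
  let ?W = "wong M N i"
  have W: "?W \<subseteq> carrier_vec n" "0\<^sub>v n \<in> ?W"
    "\<And>v w. v \<in> ?W \<Longrightarrow> w \<in> ?W \<Longrightarrow> v + w \<in> ?W" "\<And>c v. v \<in> ?W \<Longrightarrow> c \<cdot>\<^sub>v v \<in> ?W"
    using Suc unfolding subspace_vec_iff by blast+
  have eq: "wong M N (Suc i) = {x \<in> carrier_vec n. \<exists>w\<in>?W. M *\<^sub>v x = N *\<^sub>v w}"
    using M by (auto simp: mat_preimage_def mat_image_def)
  show ?case
    unfolding subspace_vec_iff
  proof (intro conjI ballI allI)
    show "wong M N (Suc i) \<subseteq> carrier_vec n" unfolding eq by auto
    show "0\<^sub>v n \<in> wong M N (Suc i)"
    proof -
      have "M *\<^sub>v 0\<^sub>v n = N *\<^sub>v 0\<^sub>v n"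
        using M N mat_mult_zero_vec[of M] mat_mult_zero_vec[of N] by simp
      then show ?thesis unfolding eq using W(2) zero_carrier_vec[of n] by blast
    qed
    show "v + w \<in> wong M N (Suc i)" if vw: "v \<in> wong M N (Suc i)" "w \<in> wong M N (Suc i)" for v w
    proof -
      from vw obtain v' w' where *: "v \<in> carrier_vec n" "w \<in> carrier_vec n" "v' \<in> ?W" "w' \<in> ?W"
        "M *\<^sub>v v = N *\<^sub>v v'" "M *\<^sub>v w = N *\<^sub>v w'" unfolding eq by auto
      then have "v' \<in> carrier_vec n" "w' \<in> carrier_vec n" using W(1) by auto
      then have "M *\<^sub>v (v + w) = N *\<^sub>v (v' + w')"
        using * M N by (simp add: mult_add_distrib_mat_vec)
      then show ?thesis unfolding eq using * W(3)[of v' w'] add_carrier_vec[of v n w] by blast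
    qed
    show "c \<cdot>\<^sub>v v \<in> wong M N (Suc i)" if v: "v \<in> wong M N (Suc i)" for c v
    proof -
      from v obtain v' where *: "v \<in> carrier_vec n" "v' \<in> ?W" "M *\<^sub>v v = N *\<^sub>v v'"
        unfolding eq by auto
      then have "v' \<in> carrier_vec n" using W(1) by auto
      then have "M *\<^sub>v (c \<cdot>\<^sub>v v) = N *\<^sub>v (c \<cdot>\<^sub>v v')"
        using * M N by (simp add: mult_mat_vec)
      then show ?thesis unfolding eq using * W(4)[of v' c] smult_carrier_vec[of c v n] by blast
    qed
  qed
qed

text \<open>If the spaces grew strictly at each of the indices \<open>0, \<dots>, n\<close>, the space with index \<open>n + 1\<close> would
have dimension greater than \<open>n\<close>. Once two consecutive spaces agree, all later ones do.\<close>

lemma wong_stabilizes: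
  assumes M: "M \<in> carrier_mat k n" and N: "N \<in> carrier_mat k n"
  shows "wong_limit M N = wong M N n"
proof -
  interpret V: vec_space "TYPE(real)" n .
  define d where "d i = vectorspace.dim class_ring (V.vs (wong M N i))" for i
  have "\<exists>i\<le>n. wong M N i = wong M N (Suc i)"
  proof (rule ccontr)
    assume neg: "\<not> ?thesis"
    have "d i < d (Suc i)" if "i \<le> n" for i
    proof (rule ccontr)
      assume "\<not> d i < d (Suc i)"
      then have le: "d (Suc i) \<le> d i" by simp
      have "wong M N i = wong M N (Suc i)"
        by (rule V.subspace_eq_if_dim_le[OF V.fin_dim wong_subspace[OF M N] wong_subspace[OF M N] _
              le[unfolded d_def]])
          (rule wong_mono[OF M N], simp)
      with that have "\<exists>i\<le>n. wong M N i = wong M N (Suc i)" by (intro exI conjI)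
      with neg show False by (rule notE)
    qed
    then have "i \<le> Suc n \<Longrightarrow> i \<le> d i" for i
    proof (induction i)
      case (Suc i)
      then have "i \<le> d i" "d i < d (Suc i)" by simp_all
      then show ?case by linarith
    qed simp
    moreover have "d (Suc n) \<le> n"
      using V.dim_subspace_le[OF V.fin_dim wong_subspace[OF M N]] unfolding V.dim_is_n d_def .
    ultimately show False by (metis Suc_n_not_le_n order_refl order_trans)
  qed
  then obtain i where i: "i \<le> n" "wong M N i = wong M N (Suc i)" by (elim exE conjE)
  have "wong M N (i + j) = wong M N i" for j
  proof (induction j)
    case (Suc j)
    have "wong M N (i + Suc j) = mat_preimage M (mat_image N (wong M N (i + j)))" by simp
    also have "\<dots> = wong M N (Suc i)" unfolding Suc wong.simps(2) ..
    finally show ?case unfolding i(2)[symmetric] .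
  qed simp
  then have const: "wong M N j = wong M N i" if "j \<ge> i" for j
    using that le_Suc_ex by blast
  have "wong M N j \<subseteq> wong M N n" for j
  proof (cases "j \<le> n")
    case True
    then show ?thesis by (rule wong_mono[OF M N])
  next
    case False
    then show ?thesis using const[of j] const[of n] i(1) by simp
  qed
  then show ?thesis unfolding wong_limit_def by blast
qed

section \<open>Kernels of block bidiagonal matrices\<close>

lemma append_rows_mult_vec:
  fixes M P :: "real mat"
  assumes M: "M \<in> carrier_mat k n" and P: "P \<in> carrier_mat r n" and v: "v \<in> carrier_vec n"
  shows "(M @\<^sub>r P) *\<^sub>v v = (M *\<^sub>v v) @\<^sub>v (P *\<^sub>v v)"
proof (rule eq_vecI)
  have "M @\<^sub>r P \<in> carrier_mat (k + r) n" using M P by (rule carrier_append_rows)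
  then have MP: "dim_row (M @\<^sub>r P) = k + r" "dim_col (M @\<^sub>r P) = n" by simp_all
  show "dim_vec ((M @\<^sub>r P) *\<^sub>v v) = dim_vec ((M *\<^sub>v v) @\<^sub>v (P *\<^sub>v v))"
    using MP M P by simp
  fix i assume "i < dim_vec ((M *\<^sub>v v) @\<^sub>v (P *\<^sub>v v))"
  then have i: "i < k + r" using M P by simp
  have "Matrix.row (M @\<^sub>r P) i = (if i < k then Matrix.row M i else Matrix.row P (i - k))"
    using M P i MP by (intro eq_vecI) (auto simp: append_rows_def)
  then show "((M @\<^sub>r P) *\<^sub>v v) $ i = ((M *\<^sub>v v) @\<^sub>v (P *\<^sub>v v)) $ i"
    using MP M P i by simp
qed

lemma zero_mat_mult_vec: "v \<in> carrier_vec n \<Longrightarrow> (0\<^sub>m r n :: real mat) *\<^sub>v v = 0\<^sub>v r"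
  by (rule eq_vecI) (auto simp: scalar_prod_def)

text \<open>Adjoining zero rows to \<open>M\<close> and the rows of \<open>P\<close> to \<open>N\<close> adds exactly the constraint that \<open>P\<close>
annihilates all members but the first. This is used with \<open>P = C\<close> and with \<open>P = L\<close>.\<close>

lemma descent_append_rows:
  assumes M: "M \<in> carrier_mat k n" and N: "N \<in> carrier_mat k n" and P: "P \<in> carrier_mat r n"
  shows "descent (M @\<^sub>r 0\<^sub>m r n) (N @\<^sub>r P) l u \<longleftrightarrow>
    descent M N l u \<and> (\<forall>i. P *\<^sub>v u (Suc i) = 0\<^sub>v r)"
proof -
  have Z: "(0\<^sub>m r n :: real mat) \<in> carrier_mat r n" by simp
  have cols: "dim_col (M @\<^sub>r 0\<^sub>m r n) = n" "dim_col M = n"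
    using carrier_matD(2)[OF carrier_append_rows[OF M Z]] M by simp_all
  have "(M @\<^sub>r 0\<^sub>m r n) *\<^sub>v v = (N @\<^sub>r P) *\<^sub>v w \<longleftrightarrow> M *\<^sub>v v = N *\<^sub>v w \<and> P *\<^sub>v w = 0\<^sub>v r"
    if "v \<in> carrier_vec n" "w \<in> carrier_vec n" for v w
  proof -
    have "M *\<^sub>v v \<in> carrier_vec k" "N *\<^sub>v w \<in> carrier_vec k" using M N that by simp_all
    then show ?thesis
      unfolding append_rows_mult_vec[OF M Z that(1)] append_rows_mult_vec[OF N P that(2)]
        zero_mat_mult_vec[OF that(1)]
      by (subst append_vec_eq) auto
  qed
  then show ?thesis unfolding descent_def cols by metis
qed

lemma sum_blocks:
  fixes g :: "nat \<Rightarrow> real"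
  shows "(\<Sum>c<l * n. g c) = (\<Sum>b<l. \<Sum>j<n. g (b * n + j))"
proof -
  have shift: "sum g {b * n..<b * n + n} = (\<Sum>j<n. g (b * n + j))" for b
    using sum.shift_bounds_nat_ivl[of g 0 "b * n" n] by (simp add: add.commute lessThan_atLeast0)
  have "(\<Sum>c<l * n. g c) = (\<Sum>b<l. sum g {b * n..<b * n + n})"
    by (rule sum.nat_group[symmetric])
  then show ?thesis unfolding shift .
qed

text \<open>The blocks of a kernel vector satisfy \<open>M *\<^sub>v x i + N *\<^sub>v x (i + 1) = 0\<close>; the alternating sign turns
this into the equation of a descent sequence.\<close>

definition signed_block :: "nat \<Rightarrow> nat \<Rightarrow> real Matrix.vec \<Rightarrow> nat \<Rightarrow> real Matrix.vec" where
  "signed_block l n x i =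
    (if i < l then Matrix.vec n (\<lambda>j. (-1) ^ i * x $ (i * n + j)) else 0\<^sub>v n)"

lemma block_index_less: "i < l \<Longrightarrow> a < k \<Longrightarrow> i * k + a < l * (k::nat)"
proof -
  assume "i < l" "a < k"
  then have "i * k + a < i * k + k" by simp
  also have "\<dots> = Suc i * k" by simp
  also have "\<dots> \<le> l * k" using \<open>i < l\<close> by (intro mult_le_mono1) simp
  finally show ?thesis .
qed

lemma block_bidiagonal_mult_index:
  assumes M: "M \<in> carrier_mat k n" and N: "N \<in> carrier_mat k n"
    and x: "x \<in> carrier_vec (l * n)" and i: "i < l" and a: "a < k"
  shows "(block_bidiagonal l M N *\<^sub>v x) $ (i * k + a) =
    (-1) ^ i * ((M *\<^sub>v signed_block l n x i) $ a - (N *\<^sub>v signed_block l n x (Suc i)) $ a)"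
proof -
  have lt: "i * k + a < l * k" using i a by (rule block_index_less)
  have ltn: "b < l \<Longrightarrow> j < n \<Longrightarrow> b * n + j < l * n" for b j by (rule block_index_less)
  have "(block_bidiagonal l M N *\<^sub>v x) $ (i * k + a) =
     (\<Sum>c<l * n. block_bidiagonal l M N $$ (i * k + a, c) * x $ c)"
    using lt x M by (simp add: scalar_prod_def block_bidiagonal_def Let_def lessThan_atLeast0)
  also have "\<dots> = (\<Sum>b<l. \<Sum>j<n. block_bidiagonal l M N $$ (i * k + a, b * n + j) * x $ (b * n + j))"
    by (rule sum_blocks)
  also have "\<dots> = (\<Sum>b<l. \<Sum>j<n. (if b = i then M $$ (a, j) else if b = Suc i then N $$ (a, j) else 0)
      * x $ (b * n + j))"
  proof (intro sum.cong refl)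
    fix b j assume "b \<in> {..<l}" "j \<in> {..<n}"
    then have bj: "b < l" "j < n" by simp_all
    have dm: "(b * n + j) div n = b" "(b * n + j) mod n = j"
      "(i * k + a) div k = i" "(i * k + a) mod k = a"
      using bj a by simp_all
    show "block_bidiagonal l M N $$ (i * k + a, b * n + j) * x $ (b * n + j) =
        (if b = i then M $$ (a, j) else if b = Suc i then N $$ (a, j) else 0) * x $ (b * n + j)"
      using lt ltn[OF bj] carrier_matD[OF M]
      unfolding block_bidiagonal_def Let_def by (simp only: index_mat split_conv dm)
  qed
  also have "\<dots> = (\<Sum>b<l. (if b = i then \<Sum>j<n. M $$ (a, j) * x $ (i * n + j) else 0) +
      (if b = Suc i then \<Sum>j<n. N $$ (a, j) * x $ (Suc i * n + j) else 0))"
    by (intro sum.cong refl) auto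
  also have "\<dots> = (\<Sum>j<n. M $$ (a, j) * x $ (i * n + j)) +
      (if Suc i < l then \<Sum>j<n. N $$ (a, j) * x $ (Suc i * n + j) else 0)"
    using i by (simp add: sum.distrib)
  also have "(\<Sum>j<n. M $$ (a, j) * x $ (i * n + j)) = (-1) ^ i * (M *\<^sub>v signed_block l n x i) $ a"
    using a i M
    by (auto simp: scalar_prod_def signed_block_def sum_distrib_left lessThan_atLeast0
        simp flip: power_mult_distrib mult.assoc power_add mult_2 intro!: sum.cong)
  also have "(if Suc i < l then \<Sum>j<n. N $$ (a, j) * x $ (Suc i * n + j) else 0) =
      - ((-1) ^ i * (N *\<^sub>v signed_block l n x (Suc i)) $ a)"
    using a N
    by (auto simp: scalar_prod_def signed_block_def sum_distrib_left lessThan_atLeast0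
        simp flip: power_mult_distrib mult.assoc power_add mult_2 sum_negf intro!: sum.cong)
  finally show ?thesis by (simp add: algebra_simps)
qed

lemma block_bidiagonal_carrier:
  assumes "M \<in> carrier_mat k n"
  shows "block_bidiagonal l M N \<in> carrier_mat (l * k) (l * n)"
  using assms unfolding block_bidiagonal_def Let_def by auto

lemma mat_kernel_block_bidiagonal:
  assumes M: "M \<in> carrier_mat k n" and N: "N \<in> carrier_mat k n"
    and x: "x \<in> carrier_vec (l * n)"
  shows "x \<in> mat_kernel (block_bidiagonal l M N) \<longleftrightarrow> descent M N l (signed_block l n x)"
proof -
  let ?B = "block_bidiagonal l M N" and ?u = "signed_block l n x"
  note B = block_bidiagonal_carrier[OF M, of l N]
  have Bx: "?B *\<^sub>v x \<in> carrier_vec (l * k)" using B x by simp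
  have u: "?u i \<in> carrier_vec n" for i by (simp add: signed_block_def)
  have "x \<in> mat_kernel ?B \<longleftrightarrow> ?B *\<^sub>v x = 0\<^sub>v (l * k)"
    using mat_kernel[OF B] x by auto
  also have "\<dots> \<longleftrightarrow> (\<forall>c<l * k. (?B *\<^sub>v x) $ c = 0)"
    using carrier_vecD[OF Bx] unfolding vec_eq_iff by simp
  also have "\<dots> \<longleftrightarrow> (\<forall>i<l. \<forall>a<k. (?B *\<^sub>v x) $ (i * k + a) = 0)"
  proof (intro iffI allI impI)
    fix c assume all: "\<forall>i<l. \<forall>a<k. (?B *\<^sub>v x) $ (i * k + a) = 0" and c: "c < l * k"
    then have "c div k < l" "c mod k < k"
      by (auto simp: less_mult_imp_div_less intro!: mod_less_divisor gr0I)
    then have "(?B *\<^sub>v x) $ (c div k * k + c mod k) = 0" using all by blast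
    then show "(?B *\<^sub>v x) $ c = 0" by simp
  qed (use block_index_less in auto)
  also have "\<dots> \<longleftrightarrow> (\<forall>i<l. \<forall>a<k. (M *\<^sub>v ?u i) $ a = (N *\<^sub>v ?u (Suc i)) $ a)"
    by (intro all_cong) (simp add: block_bidiagonal_mult_index[OF M N x])
  also have "\<dots> \<longleftrightarrow> (\<forall>i<l. M *\<^sub>v ?u i = N *\<^sub>v ?u (Suc i))"
    using M N by (auto simp: vec_eq_iff)
  also have "\<dots> \<longleftrightarrow> (\<forall>i. M *\<^sub>v ?u i = N *\<^sub>v ?u (Suc i))"
  proof (intro iffI allI impI)
    fix i assume *: "\<forall>i<l. M *\<^sub>v ?u i = N *\<^sub>v ?u (Suc i)"
    show "M *\<^sub>v ?u i = N *\<^sub>v ?u (Suc i)"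
    proof (cases "i < l")
      case False
      then have "?u i = 0\<^sub>v n" "?u (Suc i) = 0\<^sub>v n" by (simp_all add: signed_block_def)
      then show ?thesis
        using mat_mult_zero_vec[of M] mat_mult_zero_vec[of N] carrier_matD[OF M] carrier_matD[OF N]
        by simp
    qed (use * in blast)
  qed blast
  also have "\<dots> \<longleftrightarrow> descent M N l ?u"
    using u M by (simp add: descent_def signed_block_def)
  finally show ?thesis .
qed

text \<open>Every descent sequence of length \<open>l\<close> comes from a vector, so that a condition on the kernel of the
block matrix is the same as a condition on all descent sequences.\<close>

lemma signed_block_surj:
  assumes "\<And>i. u i \<in> carrier_vec n" "\<And>i. i \<ge> l \<Longrightarrow> u i = 0\<^sub>v n"
  obtains x where "x \<in> carrier_vec (l * n)" "signed_block l n x = u"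
proof
  let ?x = "Matrix.vec (l * n) (\<lambda>c. (-1) ^ (c div n) * u (c div n) $ (c mod n))"
  show "?x \<in> carrier_vec (l * n)" by simp
  have "signed_block l n ?x i = u i" for i
  proof (cases "i < l")
    case True
    have "signed_block l n ?x i $ j = u i $ j" if "j < n" for j
    proof -
      have "(i * n + j) div n = i" "(i * n + j) mod n = j" using that by simp_all
      then show ?thesis
        using True that block_index_less[OF True that]
        by (simp add: signed_block_def flip: mult.assoc power_add mult_2)
    qed
    then show ?thesis using assms(1)[of i] True by (intro eq_vecI) (auto simp: signed_block_def)
  qed (use assms(2) in \<open>simp add: signed_block_def\<close>)
  then show "signed_block l n ?x = u" by blast
qed

lemma rank_block_bidiagonal_eq_iff:
  fixes M N P :: "real mat"
  assumes M: "M \<in> carrier_mat k n" and N: "N \<in> carrier_mat k n" and P: "P \<in> carrier_mat r n"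
  shows "mat_rank (block_bidiagonal l M N) = mat_rank (block_bidiagonal l (M @\<^sub>r 0\<^sub>m r n) (N @\<^sub>r P))
    \<longleftrightarrow> (\<forall>u. descent M N l u \<longrightarrow> (\<forall>i. P *\<^sub>v u (Suc i) = 0\<^sub>v r))"
    (is "mat_rank ?B = mat_rank ?B' \<longleftrightarrow> ?R")
proof -
  have M': "M @\<^sub>r 0\<^sub>m r n \<in> carrier_mat (k + r) n" by (rule carrier_append_rows[OF M]) simp
  have N': "N @\<^sub>r P \<in> carrier_mat (k + r) n" by (rule carrier_append_rows[OF N P])
  note B = block_bidiagonal_carrier[OF M, of l N] and B' = block_bidiagonal_carrier[OF M', of l "N @\<^sub>r P"]
  have ker: "x \<in> mat_kernel ?B \<longleftrightarrow> x \<in> carrier_vec (l * n) \<and> descent M N l (signed_block l n x)" for x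
    using mat_kernel_block_bidiagonal[OF M N] mat_kernelD(1)[OF B] by blast
  have ker': "x \<in> mat_kernel ?B' \<longleftrightarrow> x \<in> carrier_vec (l * n) \<and> descent M N l (signed_block l n x)
      \<and> (\<forall>i. P *\<^sub>v signed_block l n x (Suc i) = 0\<^sub>v r)" for x
    using mat_kernel_block_bidiagonal[OF M' N'] mat_kernelD(1)[OF B'] descent_append_rows[OF M N P]
    by blast
  have "mat_rank ?B = mat_rank ?B' \<longleftrightarrow> mat_kernel ?B \<subseteq> mat_kernel ?B'"
    by (rule rank_eq_iff_kernel_subset[OF B B']) (use ker ker' in blast)
  also have "\<dots> \<longleftrightarrow> ?R"
  proof
    assume sub: "mat_kernel ?B \<subseteq> mat_kernel ?B'"
    show ?R
    proof (intro allI impI)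
      fix u i assume u: "descent M N l u"
      then obtain x where "x \<in> carrier_vec (l * n)" "signed_block l n x = u"
        using M by (auto simp: descent_def intro: signed_block_surj[of u n l])
      then show "P *\<^sub>v u (Suc i) = 0\<^sub>v r" using sub u ker[of x] ker'[of x] by blast
    qed
  qed (use ker ker' in blast)
  finally show ?thesis .
qed

text \<open>Shifting a descent sequence makes any later member the second one, so only \<open>u 1\<close> matters. The
shifted tail makes \<open>u 1\<close> an element of a Wong space, and the first step \<open>M *\<^sub>v u 0 = N *\<^sub>v u 1\<close>
puts \<open>u 1\<close> into the preimage of the image of \<open>M\<close>.\<close>

lemma descent_kills_iff_wong:
  assumes M: "M \<in> carrier_mat k n" and N: "N \<in> carrier_mat k n" and P: "P \<in> carrier_mat r n"
  shows "(\<forall>u. descent M N (Suc l) u \<longrightarrow> (\<forall>i. P *\<^sub>v u (Suc i) = 0\<^sub>v r)) \<longleftrightarrow>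
    wong M N l \<inter> mat_preimage N (mat_image M (carrier_vec n)) \<subseteq> mat_kernel P"
proof
  assume L: "\<forall>u. descent M N (Suc l) u \<longrightarrow> (\<forall>i. P *\<^sub>v u (Suc i) = 0\<^sub>v r)"
  show "wong M N l \<inter> mat_preimage N (mat_image M (carrier_vec n)) \<subseteq> mat_kernel P"
  proof
    fix v assume "v \<in> wong M N l \<inter> mat_preimage N (mat_image M (carrier_vec n))"
    then obtain w where v: "v \<in> wong M N l" "v \<in> carrier_vec n" and w: "w \<in> carrier_vec n" "M *\<^sub>v w = N *\<^sub>v v"
      using N by (auto simp: mat_preimage_def mat_image_def)
    obtain u where u: "descent M N l u" "u 0 = v" using wong_iff_descent[OF M N] v(1) by blast
    have "descent M N (Suc l) (case_nat w u)"
      unfolding descent_def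
    proof (intro conjI allI impI)
      show "case_nat w u i \<in> carrier_vec (dim_col M)" for i
        using u(1) w(1) M by (cases i) (auto simp: descent_def)
      show "M *\<^sub>v case_nat w u i = N *\<^sub>v case_nat w u (Suc i)" for i
        using u w by (cases i) (auto simp: descent_def)
      show "case_nat w u i = 0\<^sub>v (dim_col M)" if "i \<ge> Suc l" for i
        using u that by (cases i) (auto simp: descent_def)
    qed
    then have "P *\<^sub>v case_nat w u (Suc 0) = 0\<^sub>v r" using L by blast
    then show "v \<in> mat_kernel P" using u(2) v(2) P by (intro mat_kernelI[OF P]) simp_all
  qed
next
  assume R: "wong M N l \<inter> mat_preimage N (mat_image M (carrier_vec n)) \<subseteq> mat_kernel P"
  show "\<forall>u. descent M N (Suc l) u \<longrightarrow> (\<forall>i. P *\<^sub>v u (Suc i) = 0\<^sub>v r)"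
  proof (intro allI impI)
    fix u i assume u: "descent M N (Suc l) u"
    have uc: "u j \<in> carrier_vec n" for j using u M by (auto simp: descent_def)
    have Mu: "M *\<^sub>v u i = N *\<^sub>v u (Suc i)" using u by (auto simp: descent_def)
    have "descent M N l (\<lambda>j. u (Suc i + j))" using u by (auto simp: descent_def)
    then have "u (Suc i) \<in> wong M N l"
      using wong_iff_descent[OF M N, of "u (Suc i)" l] by (metis add.right_neutral)
    moreover have "u (Suc i) \<in> mat_preimage N (mat_image M (carrier_vec n))"
      unfolding mat_preimage_def mat_image_def using N uc Mu[symmetric] by auto
    ultimately have "u (Suc i) \<in> mat_kernel P" using R by blast
    then show "P *\<^sub>v u (Suc i) = 0\<^sub>v r" using mat_kernelD(2)[OF P] by blast
  qed
qed

section \<open>Smooth functions and bump functions\<close>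

text \<open>Differentiability of finite order, as a recursion in which the derivative is a witness. This makes
closure under products an easy induction, since the product rule involves the derivatives of the
factors to the next lower order only.\<close>

primrec times_diff :: "nat \<Rightarrow> (real \<Rightarrow> real) \<Rightarrow> bool" where
  "times_diff 0 f \<longleftrightarrow> True"
| "times_diff (Suc k) f \<longleftrightarrow> (\<exists>f'. (\<forall>x. (f has_field_derivative f' x) (at x)) \<and> times_diff k f')"

lemma times_diff_mono: "times_diff (Suc k) f \<Longrightarrow> times_diff k f"
proof (induction k arbitrary: f)
  case (Suc k)
  from Suc.prems obtain f' where "\<forall>x. (f has_field_derivative f' x) (at x)" "times_diff (Suc k) f'"
    by (subst (asm) times_diff.simps(2)) blast
  then show ?case using Suc.IH by (subst times_diff.simps(2)) blast
qed simp

lemma times_diff_add: "times_diff k f \<Longrightarrow> times_diff k g \<Longrightarrow> times_diff k (\<lambda>x. f x + g x)"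
proof (induction k arbitrary: f g)
  case (Suc k)
  from Suc.prems obtain f' g' where *: "\<forall>x. (f has_field_derivative f' x) (at x)" "times_diff k f'"
    "\<forall>x. (g has_field_derivative g' x) (at x)" "times_diff k g'" by auto
  have "\<forall>x. ((\<lambda>x. f x + g x) has_field_derivative f' x + g' x) (at x)"
    using * by (auto intro: DERIV_add)
  then show ?case using Suc.IH[OF *(2,4)] by auto
qed simp

lemma times_diff_mult: "times_diff k f \<Longrightarrow> times_diff k g \<Longrightarrow> times_diff k (\<lambda>x. f x * g x)"
proof (induction k arbitrary: f g)
  case (Suc k)
  from Suc.prems obtain f' g' where *: "\<forall>x. (f has_field_derivative f' x) (at x)" "times_diff k f'"
    "\<forall>x. (g has_field_derivative g' x) (at x)" "times_diff k g'" by auto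
  have "\<forall>x. ((\<lambda>x. f x * g x) has_field_derivative f' x * g x + g' x * f x) (at x)"
    using * by (auto intro: DERIV_mult)
  moreover have "times_diff k (\<lambda>x. f' x * g x + g' x * f x)"
    using Suc.IH[OF *(2)] Suc.IH[OF *(4)] times_diff_mono[OF Suc.prems(1)] times_diff_mono[OF Suc.prems(2)]
    by (intro times_diff_add) auto
  ultimately show ?case by auto
qed simp

lemma times_diff_const: "times_diff k (\<lambda>_. c)"
proof (induction k arbitrary: c)
  case (Suc k)
  have "\<forall>x. ((\<lambda>_. c) has_field_derivative 0) (at x)" by simp
  then show ?case using Suc[of 0] by (auto intro!: exI[of _ "\<lambda>_. 0"])
qed simp

lemma times_diff_affine:
  assumes "times_diff k f"
  shows "times_diff k (\<lambda>x. f (c * x + d))"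
  using assms
proof (induction k arbitrary: f)
  case (Suc k)
  from Suc.prems obtain f' where *: "\<forall>x. (f has_field_derivative f' x) (at x)" "times_diff k f'" by auto
  have "((\<lambda>x. f (c * x + d)) has_field_derivative f' (c * x + d) * c) (at x)" for x
    using *(1) by (auto intro!: DERIV_chain2[where f = f] derivative_eq_intros)
  moreover have "times_diff k (\<lambda>x. f' (c * x + d) * c)"
    by (rule times_diff_mult[OF Suc.IH[OF *(2)] times_diff_const])
  ultimately show ?case by (auto intro!: exI[of _ "\<lambda>x. f' (c * x + d) * c"])
qed simp

lemma smooth_iff_times_diff: "smooth f \<longleftrightarrow> (\<forall>k. times_diff k f)"
proof
  assume f: "smooth f"
  have "times_diff k ((deriv ^^ i) f)" for k i
  proof (induction k arbitrary: i)
    case (Suc k)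
    have "\<forall>x. ((deriv ^^ i) f has_field_derivative (deriv ^^ Suc i) f x) (at x)"
      using smooth_has_deriv[OF f] by blast
    with Suc[of "Suc i"] show ?case by (subst times_diff.simps(2)) blast
  qed simp
  from this[of _ 0] show "\<forall>k. times_diff k f" by simp
next
  assume f: "\<forall>k. times_diff k f"
  have "times_diff (Suc k) f \<Longrightarrow> (deriv ^^ k) f differentiable_on UNIV" for k f
  proof (induction k arbitrary: f)
    case 0
    then show ?case
      by (auto simp: differentiable_on_def real_differentiable_def)
  next
    case (Suc k)
    from Suc.prems obtain f' where *: "\<forall>x. (f has_field_derivative f' x) (at x)" "times_diff (Suc k) f'"
      by (subst (asm) times_diff.simps(2)) blast
    have "deriv f = f'" using *(1) DERIV_imp_deriv by blast
    then show ?case using Suc.IH[OF *(2)] by (simp only: funpow_Suc_right o_apply)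
  qed
  then show "smooth f" using f unfolding smooth_def by blast
qed

lemma smooth_mult: "smooth f \<Longrightarrow> smooth g \<Longrightarrow> smooth (\<lambda>x. f x * g x)"
  using times_diff_mult by (simp add: smooth_iff_times_diff)

lemma smooth_const: "smooth (\<lambda>_. c)"
  using times_diff_const by (simp add: smooth_iff_times_diff)

lemma smooth_affine: "smooth f \<Longrightarrow> smooth (\<lambda>x. f (c * x + d))"
  using times_diff_affine by (simp add: smooth_iff_times_diff)

lemma smooth_ident: "smooth (\<lambda>x. x)"
proof -
  have "times_diff k (\<lambda>x. x)" for k
    by (cases k) (auto intro!: exI[of _ "\<lambda>_. 1"] times_diff_const)
  then show ?thesis by (simp add: smooth_iff_times_diff)
qed

lemma smooth_DERIV: "smooth f \<Longrightarrow> (f has_field_derivative deriv f x) (at x)"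
  using smooth_has_deriv[of f 0 x] by simp

lemma smooth_continuous: "smooth f \<Longrightarrow> isCont f x"
  using smooth_DERIV DERIV_isCont by blast

text \<open>The functions \<open>p (1 / x) * exp (- 1 / x)\<close>, extended by \<open>0\<close> to the left of the origin. They form a
family closed under differentiation, hence all of them are smooth.\<close>

definition flat_poly :: "real poly \<Rightarrow> real \<Rightarrow> real" where
  "flat_poly p x = (if 0 < x then poly p (1 / x) * exp (- (1 / x)) else 0)"

text \<open>The additional power of \<open>s\<close> makes the induction on \<open>p\<close> go through, as \<open>pCons\<close> multiplies by \<open>s\<close>.\<close>

lemma poly_times_exp_tendsto_0: "((\<lambda>s. s ^ k * poly p s * exp (- s)) \<longlongrightarrow> (0::real)) at_top"
proof (induction p arbitrary: k)
  case (pCons a p)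
  have "((\<lambda>s::real. a * (s ^ k / exp s) + s ^ Suc k * poly p s * exp (- s)) \<longlongrightarrow> a * 0 + 0) at_top"
    by (intro tendsto_intros tendsto_power_div_exp_0 pCons)
  then show ?case by (simp add: exp_minus field_simps)
qed simp

lemma flat_poly_has_derivative:
  "(flat_poly p has_field_derivative flat_poly ([:0, 0, 1:] * (p - pderiv p)) x) (at x)"
proof -
  consider "x > 0" | "x < 0" | "x = 0" by linarith
  then show ?thesis
  proof cases
    case 1
    have "((\<lambda>x. poly p (1 / x) * exp (- (1 / x))) has_field_derivative
        flat_poly ([:0, 0, 1:] * (p - pderiv p)) x) (at x)"
      using 1 by (auto intro!: derivative_eq_intros DERIV_chain2[OF poly_DERIV]
          simp: flat_poly_def field_simps power2_eq_square)
    moreover have "eventually (\<lambda>y. flat_poly p y = poly p (1 / y) * exp (- (1 / y))) (nhds x)"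
      using eventually_nhds_in_open[of "{0<..}" x] 1 by (auto elim!: eventually_mono simp: flat_poly_def)
    ultimately show ?thesis by (subst DERIV_cong_ev[OF refl _ refl]) auto
  next
    case 2
    have "eventually (\<lambda>y. flat_poly p y = 0) (nhds x)"
      using eventually_nhds_in_open[of "{..<0}" x] 2 by (auto elim!: eventually_mono simp: flat_poly_def)
    then show ?thesis using 2 by (subst DERIV_cong_ev[OF refl _ refl]) (auto simp: flat_poly_def)
  next
    case 3
    have "((\<lambda>h. flat_poly p h / h) \<longlongrightarrow> 0) (at_right 0)"
    proof (rule Lim_transform_eventually)
      show "((\<lambda>h. (1 / h) ^ 1 * poly p (1 / h) * exp (- (1 / h))) \<longlongrightarrow> 0) (at_right (0::real))"
        by (rule filterlim_compose[OF poly_times_exp_tendsto_0[of 1]])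
          (simp add: filterlim_inverse_at_top_right flip: inverse_eq_divide)
      show "\<forall>\<^sub>F h in at_right 0. (1 / h) ^ 1 * poly p (1 / h) * exp (- (1 / h)) = flat_poly p h / h"
        by (rule eventually_mono[OF eventually_at_right_less[of 0]]) (simp add: flat_poly_def)
    qed
    moreover have "((\<lambda>h. flat_poly p h / h) \<longlongrightarrow> 0) (at_left 0)"
    proof (rule Lim_transform_eventually[OF tendsto_const])
      show "\<forall>\<^sub>F h in at_left 0. 0 = flat_poly p h / h"
        by (rule eventually_at_leftI[of "-1"]) (auto simp: flat_poly_def)
    qed
    ultimately have "((\<lambda>h. flat_poly p h / h) \<longlongrightarrow> 0) (at 0)"
      by (simp add: filterlim_split_at)
    then show ?thesis using 3 by (simp add: DERIV_def flat_poly_def)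
  qed
qed

lemma smooth_flat_poly: "smooth (flat_poly p)"
proof -
  have "times_diff k (flat_poly p)" for k
  proof (induction k arbitrary: p)
    case (Suc k)
    then show ?case using flat_poly_has_derivative by (subst times_diff.simps(2)) blast
  qed simp
  then show ?thesis by (simp add: smooth_iff_times_diff)
qed

definition bump :: "real \<Rightarrow> real \<Rightarrow> real \<Rightarrow> real" where
  "bump a b x = flat_poly 1 (x - a) * flat_poly 1 (b - x)"

lemma smooth_bump: "smooth (bump a b)"
  using smooth_mult[OF smooth_affine[of _ 1 "-a"] smooth_affine[of _ "-1" b], OF smooth_flat_poly smooth_flat_poly]
  by (simp add: bump_def[abs_def])

lemma bump_pos: "a < x \<Longrightarrow> x < b \<Longrightarrow> bump a b x > 0"
  by (simp add: bump_def flat_poly_def)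

lemma bump_zero: "x \<notin> {a<..<b} \<Longrightarrow> bump a b x = 0"
  by (auto simp: bump_def flat_poly_def)

text \<open>The factor \<open>q\<close> allows for test functions with a prescribed jet at a point.\<close>

lemma test_fun_bump_ex:
  assumes "smooth q"
  obtains \<phi> where "\<And>x. tf_apply \<phi> x = q x * bump a b x" "tf_support \<phi> \<subseteq> {a..b}"
proof -
  let ?f = "\<lambda>x. q x * bump a b x"
  have out: "?f x = 0" if "x \<notin> {a..b}" for x
    using that by (subst bump_zero) auto
  then have "{x. ?f x \<noteq> 0} \<subseteq> {a..b}" by blast
  then have sub: "fun_support ?f \<subseteq> {a..b}"
    unfolding fun_support_def by (rule closure_minimal) simp
  have "smooth ?f" using assms smooth_bump by (rule smooth_mult)
  moreover have "compact (fun_support ?f)"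
    by (rule compact_fun_support_subset[OF compact_Icc out])
  ultimately have "tf_apply (Abs_test_fun ?f) = ?f" by (intro Abs_test_fun_inverse) simp
  then show ?thesis using that[of "Abs_test_fun ?f"] sub by simp
qed

section \<open>Linear independence of the derivatives of the Dirac distribution\<close>

text \<open>The jet up to order \<open>k\<close> at \<open>t\<close> of a function vanishing there to order \<open>k\<close>: only the top derivative
survives.\<close>

lemma higher_deriv_monomial_mult:
  assumes "smooth g"
  shows "i \<le> k \<Longrightarrow> (deriv ^^ i) (\<lambda>x. (x - t) ^ k * g x) t = (if i = k then fact k * g t else 0)"
  using assms
proof (induction k arbitrary: g i)
  case (Suc k)
  show ?case
  proof (cases i)
    case (Suc i')
    let ?g = "\<lambda>x. real (Suc k) * g x + 1 * ((x - t) * deriv g x)"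
    have sg: "smooth ?g"
      using smooth_mult[OF smooth_affine[of "\<lambda>x. x" 1 "-t", OF smooth_ident] smooth_deriv[OF Suc.prems(2)]]
      by (intro smooth_lincomb Suc.prems) simp
    have "deriv (\<lambda>x. (x - t) ^ Suc k * g x) x = (x - t) ^ k * ?g x" for x
    proof (rule DERIV_imp_deriv)
      have "((\<lambda>x. (x - t) ^ Suc k) has_field_derivative (1 + real k) * (1 * (x - t) ^ k)) (at x)"
        by (rule DERIV_power_Suc) (auto intro!: derivative_eq_intros)
      from DERIV_mult[OF this smooth_DERIV[OF Suc.prems(2)]]
      show "((\<lambda>x. (x - t) ^ Suc k * g x) has_field_derivative (x - t) ^ k * ?g x) (at x)"
        by (rule DERIV_cong) (simp add: algebra_simps)
    qed
    then have "(deriv ^^ i) (\<lambda>x. (x - t) ^ Suc k * g x) = (deriv ^^ i') (\<lambda>x. (x - t) ^ k * ?g x)"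
      unfolding \<open>i = Suc i'\<close> funpow_Suc_right o_apply by presburger
    then show ?thesis
      using Suc.IH[OF _ sg, of i'] Suc.prems(1) \<open>i = Suc i'\<close> by (simp add: algebra_simps)
  qed simp
qed simp

lemma dirac_higher_deriv:
  "(dist_deriv ^^ i) (dirac t) \<phi> = (-1) ^ i * (deriv ^^ i) (tf_apply \<phi>) t"
proof (induction i arbitrary: \<phi>)
  case (Suc i)
  have "(dist_deriv ^^ Suc i) (dirac t) \<phi> = - ((-1) ^ i * (deriv ^^ i) (deriv (tf_apply \<phi>)) t)"
    by (simp add: dist_deriv_def Suc tf_deriv.rep_eq)
  also have "(deriv ^^ i) (deriv (tf_apply \<phi>)) = (deriv ^^ Suc i) (tf_apply \<phi>)"
    by (simp only: funpow_Suc_right o_apply)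
  finally show ?case by simp
qed (simp add: dirac_def)

text \<open>Let \<open>m\<close> be the largest index with a nonzero coefficient. A test function vanishing to order \<open>m\<close> at
\<open>t\<close> is not seen by the lower derivatives and singles out the coefficient \<open>c m\<close>. Test functions
supported near \<open>t\<close> suffice, which is needed to separate the impulses at different points.\<close>

lemma dirac_derivs_independent:
  assumes "e > 0"
    and zero: "\<And>\<phi>. tf_support \<phi> \<subseteq> {t - e..t + e} \<Longrightarrow> (\<Sum>i\<le>N. c i * (dist_deriv ^^ i) (dirac t) \<phi>) = 0"
    and "k \<le> N"
  shows "c k = 0"
proof (rule ccontr)
  assume "c k \<noteq> 0"
  define m where "m = Max {i. i \<le> N \<and> c i \<noteq> 0}"
  have fin: "finite {i. i \<le> N \<and> c i \<noteq> 0}" and ne: "{i. i \<le> N \<and> c i \<noteq> 0} \<noteq> {}"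
    using \<open>c k \<noteq> 0\<close> \<open>k \<le> N\<close> by auto
  have m: "m \<le> N" "c m \<noteq> 0" using Max_in[OF fin ne] by (auto simp: m_def)
  have above: "c i = 0" if "i \<le> N" "i > m" for i
    using Max_ge[OF fin, of i] that unfolding m_def by fastforce
  have "smooth (\<lambda>x. (x - t) ^ j)" for j
  proof (induction j)
    case (Suc j)
    then show ?case
      using smooth_mult[OF smooth_affine[of "\<lambda>x. x" 1 "-t", OF smooth_ident] Suc] by simp
  qed (simp add: smooth_const)
  from test_fun_bump_ex[OF this[of m], of "t - e" "t + e"]
  obtain \<phi> where \<phi>: "\<And>x. tf_apply \<phi> x = (x - t) ^ m * bump (t - e) (t + e) x"
    "tf_support \<phi> \<subseteq> {t - e..t + e}" by blast
  have jet: "(deriv ^^ i) (tf_apply \<phi>) t = (if i = m then fact m * bump (t - e) (t + e) t else 0)"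
    if "i \<le> m" for i
  proof -
    have "tf_apply \<phi> = (\<lambda>x. (x - t) ^ m * bump (t - e) (t + e) x)" using \<phi>(1) by blast
    then show ?thesis using higher_deriv_monomial_mult[OF smooth_bump that] by simp
  qed
  have "0 = (\<Sum>i\<le>N. c i * (dist_deriv ^^ i) (dirac t) \<phi>)" using zero[OF \<phi>(2)] by simp
  also have "\<dots> = (\<Sum>i\<le>N. if i = m then c m * ((-1) ^ m * (fact m * bump (t - e) (t + e) t)) else 0)"
  proof (intro sum.cong refl)
    fix i assume "i \<in> {..N}"
    then show "c i * (dist_deriv ^^ i) (dirac t) \<phi> =
        (if i = m then c m * ((-1) ^ m * (fact m * bump (t - e) (t + e) t)) else 0)"
      using jet[of i] above[of i] by (cases "i \<le> m") (auto simp: dirac_higher_deriv)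
  qed
  also have "\<dots> = c m * ((-1) ^ m * (fact m * bump (t - e) (t + e) t))" using m by simp
  finally show False using m bump_pos[of "t - e" t "t + e"] \<open>e > 0\<close> by simp
qed

section \<open>Locally finite sets and piecewise smooth functions\<close>

lemma locally_finite_Un: "locally_finite S \<Longrightarrow> locally_finite T \<Longrightarrow> locally_finite (S \<union> T)"
  by (simp add: locally_finite_def Int_Un_distrib2)

lemma locally_finite_subset: "locally_finite S \<Longrightarrow> T \<subseteq> S \<Longrightarrow> locally_finite T"
  unfolding locally_finite_def by (meson Int_mono finite_subset order_refl)

lemma finite_imp_locally_finite: "finite S \<Longrightarrow> locally_finite S"
  by (simp add: locally_finite_def)

lemma locally_finite_Ints: "locally_finite \<int>"
proof -
  have "\<int> \<inter> {a..b} = {x \<in> \<int>. a \<le> x \<and> x \<le> b}" for a b :: real by auto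
  then show ?thesis by (simp add: locally_finite_def finite_int_segment)
qed

lemma locally_finite_isolated:
  assumes "locally_finite S"
  obtains e where "e > 0" "S \<inter> {x - e..x + e} \<subseteq> {x}"
proof -
  have "finite (S \<inter> {x - 1..x + 1} - {x})" using assms by (auto simp: locally_finite_def)
  from finite_set_avoid[OF this, of x]
  obtain d where d: "d > 0" "\<forall>y\<in>S \<inter> {x - 1..x + 1} - {x}. y \<noteq> x \<longrightarrow> d \<le> dist x y" by blast
  show ?thesis
  proof
    show "min (d / 2) 1 > 0" using d by simp
    show "S \<inter> {x - min (d / 2) 1..x + min (d / 2) 1} \<subseteq> {x}"
    proof (rule subsetI, rule ccontr)
      fix y assume y: "y \<in> S \<inter> {x - min (d / 2) 1..x + min (d / 2) 1}" "y \<notin> {x}"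
      then have "y \<in> S \<inter> {x - 1..x + 1} - {x}" by auto
      then have "d \<le> dist x y" using d y by auto
      moreover have "y \<le> x + d / 2" "x - d / 2 \<le> y"
        using y(1) min.cobounded1[of "d / 2" 1] by auto
      then have "dist x y \<le> d / 2" unfolding dist_real_def by linarith
      ultimately show False using d(1) by linarith
    qed
  qed
qed

lemma locally_finite_next:
  assumes S: "locally_finite S" and u: "\<not> bdd_above S"
  shows "\<exists>y\<in>S. x < y \<and> {x<..<y} \<inter> S = {}"
proof -
  obtain z where z: "z \<in> S" "x < z" using u by (auto simp: bdd_above_def not_le)
  have fin: "finite (S \<inter> {x<..z})"
    by (rule finite_subset[of _ "S \<inter> {x..z}"]) (use S in \<open>auto simp: locally_finite_def\<close>)
  have ne: "S \<inter> {x<..z} \<noteq> {}" using z by auto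
  let ?y = "Min (S \<inter> {x<..z})"
  have y: "?y \<in> S \<inter> {x<..z}" using Min_in[OF fin ne] .
  moreover have "{x<..<?y} \<inter> S = {}"
  proof (rule ccontr)
    assume "{x<..<?y} \<inter> S \<noteq> {}"
    then obtain w where w: "x < w" "w < ?y" "w \<in> S" by auto
    then have "w \<in> S \<inter> {x<..z}" using y by auto
    then show False using Min_le[OF fin, of w] w by linarith
  qed
  ultimately show ?thesis by auto
qed

lemma locally_finite_uminus:
  assumes "locally_finite S"
  shows "locally_finite (uminus ` S)"
  unfolding locally_finite_def
proof (intro allI)
  fix a b :: real
  have "uminus ` S \<inter> {a..b} = uminus ` (S \<inter> {-b..-a})" by force
  then show "finite (uminus ` S \<inter> {a..b})" using assms by (simp add: locally_finite_def)
qed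

lemma locally_finite_prev:
  assumes S: "locally_finite S" and u: "\<not> bdd_below S"
  shows "\<exists>y\<in>S. y < x \<and> {y<..<x} \<inter> S = {}"
proof -
  have "\<not> bdd_above (uminus ` S)" using u by simp
  from locally_finite_next[OF locally_finite_uminus[OF S] this, of "-x"]
  obtain y where y: "y \<in> S" "-x < -y" "{-x<..<-y} \<inter> uminus ` S = {}" by auto
  have "{y<..<x} \<inter> S = {}"
  proof (rule ccontr)
    assume "{y<..<x} \<inter> S \<noteq> {}"
    then obtain w where "y < w" "w < x" "w \<in> S" by auto
    then have "- w \<in> {-x<..<-y} \<inter> uminus ` S" by auto
    then show False using y by blast
  qed
  then show ?thesis using y by auto
qed

lemma strict_mono_int_step:
  fixes t :: "int \<Rightarrow> real"
  assumes "\<And>i. t i < t (i + 1)"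
  shows "strict_mono t"
proof
  fix i j :: int assume "i < j"
  then show "t i < t j"
    by (induction j rule: int_gr_induct) (use assms less_trans in blast)+
qed

text \<open>A locally finite set has a next and a previous element for every real number. Iterating the two
in both directions from some element enumerates the set by the integers in increasing order; the
enumeration is unbounded since a bounded part of the set is finite.\<close>

lemma locally_finite_enumerate:
  assumes S: "locally_finite S" and above: "\<not> bdd_above S" and below: "\<not> bdd_below S"
  obtains t :: "int \<Rightarrow> real" where "strict_mono t" "range t \<subseteq> S" "\<And>i. {t i<..<t (i + 1)} \<inter> S = {}"
    "\<not> bdd_above (range t)" "\<not> bdd_below (range t)"
proof -
  obtain nx where nx: "\<And>x. nx x \<in> S" "\<And>x. x < nx x" "\<And>x. {x<..<nx x} \<inter> S = {}"
    using locally_finite_next[OF S above] by metis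
  obtain pv where pv: "\<And>x. pv x \<in> S" "\<And>x. pv x < x" "\<And>x. {pv x<..<x} \<inter> S = {}"
    using locally_finite_prev[OF S below] by metis
  define t where "t i = (if i \<ge> 0 then (nx ^^ nat i) (nx 0) else (pv ^^ nat (- i)) (nx 0))" for i :: int
  have step: "t (i + 1) = nx (t i) \<or> t i = pv (t (i + 1))" for i
  proof (cases "i \<ge> 0")
    case True
    then have "nat (i + 1) = Suc (nat i)" by simp
    then show ?thesis using True by (simp add: t_def)
  next
    case False
    then have "nat (- i) = Suc (nat (- (i + 1)))" by simp
    then show ?thesis using False by (auto simp: t_def)
  qed
  have lt: "t i < t (i + 1)" for i using step[of i] nx(2) pv(2) by metis
  have gap: "{t i<..<t (i + 1)} \<inter> S = {}" for i using step[of i] nx(3) pv(3) by metis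
  have mono: "strict_mono t" using lt by (rule strict_mono_int_step)
  have inS: "t i \<in> S" for i
  proof -
    have "(f ^^ k) (nx 0) \<in> S" if "\<And>x. f x \<in> S" for f :: "real \<Rightarrow> real" and k
      using that nx(1) by (cases k) auto
    then show ?thesis using nx(1) pv(1) by (simp add: t_def)
  qed
  have inj: "inj t" using mono by (rule strict_mono_imp_inj_on)
  show thesis
  proof
    show "\<not> bdd_above (range t)"
    proof
      assume "bdd_above (range t)"
      then obtain u where u: "\<And>i. t i \<le> u" by (auto simp: bdd_above_def)
      have "range (\<lambda>k. t (int k)) \<subseteq> S \<inter> {t 0..u}"
        using inS u strict_mono_less_eq[OF mono] by auto
      moreover have "finite (S \<inter> {t 0..u})" using S unfolding locally_finite_def by blast
      ultimately have "finite (range (\<lambda>k. t (int k)))" by (rule finite_subset)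
      moreover have "inj (\<lambda>k. t (int k))" using injD[OF inj] by (intro injI) fastforce
      ultimately show False using range_inj_infinite by (metis (no_types))
    qed
    show "\<not> bdd_below (range t)"
    proof
      assume "bdd_below (range t)"
      then obtain u where u: "\<And>i. u \<le> t i" by (auto simp: bdd_below_def)
      have "range (\<lambda>k. t (- int k)) \<subseteq> S \<inter> {u..t 0}"
        using inS u strict_mono_less_eq[OF mono] by auto
      moreover have "finite (S \<inter> {u..t 0})" using S unfolding locally_finite_def by blast
      ultimately have "finite (range (\<lambda>k. t (- int k)))" by (rule finite_subset)
      moreover have "inj (\<lambda>k. t (- int k))" using injD[OF inj] by (intro injI) fastforce
      ultimately show False using range_inj_infinite by (metis (no_types))
    qed
  qed (use mono inS gap in auto)
qed

text \<open>The grids of breakpoints that are admissible in \<open>piecewise_smooth\<close>.\<close>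

locale breakpoints =
  fixes t :: "int \<Rightarrow> real"
  assumes mono: "strict_mono t" and lf: "locally_finite (range t)"
    and unbdd_above: "\<not> bdd_above (range t)" and unbdd_below: "\<not> bdd_below (range t)"
begin

lemma above: "\<exists>i. x < t i"
  using unbdd_above by (auto simp: bdd_above_def not_le)

lemma below: "\<exists>i. t i < x"
  using unbdd_below by (auto simp: bdd_below_def not_le)

lemma ex_piece: "\<exists>i. x \<in> {t i..<t (i + 1)}"
proof -
  obtain i j where ij: "t i < x" "x < t j" using above below by blast
  have fin: "finite {k \<in> {i..j}. t k \<le> x}" by (rule finite_subset[of _ "{i..j}"]) auto
  have "i < j" using ij strict_mono_less[OF mono, of i j] by linarith
  then have "i \<in> {k \<in> {i..j}. t k \<le> x}" using ij by simp
  then have ne: "{k \<in> {i..j}. t k \<le> x} \<noteq> {}" by blast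
  let ?k = "Max {k \<in> {i..j}. t k \<le> x}"
  have k: "i \<le> ?k" "?k \<le> j" "t ?k \<le> x" using Max_in[OF fin ne] by auto
  have "?k \<noteq> j" using k(3) ij(2) by force
  then have "?k + 1 \<le> j" using k(2) by linarith
  have "x < t (?k + 1)"
  proof (rule ccontr)
    assume "\<not> x < t (?k + 1)"
    then have "?k + 1 \<in> {k \<in> {i..j}. t k \<le> x}" using k \<open>?k + 1 \<le> j\<close> by simp
    then show False using Max_ge[OF fin, of "?k + 1"] by linarith
  qed
  then show ?thesis using k(3) by auto
qed

lemma piece_unique:
  assumes "x \<in> {t i..<t (i + 1)}" "x \<in> {t j..<t (j + 1)}"
  shows "i = j"
proof -
  have "t i < t (j + 1)" "t j < t (i + 1)" using assms by auto
  then show ?thesis using strict_mono_less[OF mono] by (metis add1_zle_eq antisym zle_add1_eq_le)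
qed

definition piece :: "real \<Rightarrow> int" where "piece x = (THE i. x \<in> {t i..<t (i + 1)})"

lemma piece_eq: "x \<in> {t i..<t (i + 1)} \<Longrightarrow> piece x = i"
  unfolding piece_def using piece_unique by (intro the_equality)

lemma in_piece: "x \<in> {t (piece x)..<t (piece x + 1)}"
  using ex_piece[of x] piece_eq by auto

lemma piece_breakpoint: "piece (t i) = i"
  using strict_mono_less[OF mono, of i "i + 1"] by (intro piece_eq) simp

lemma cover_interval:
  assumes "a \<le> b"
  obtains i n where "t i < a" "b < t (i + int n)"
proof -
  obtain i j where ij: "t i < a" "b < t j" using above below by blast
  then have "i < j" using assms strict_mono_less[OF mono, of i j] by linarith
  then have "i + int (nat (j - i)) = j" by simp
  then show thesis using that[of i "nat (j - i)"] ij by simp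
qed

end

lemma piecewise_smooth_iff_breakpoints:
  "piecewise_smooth f \<longleftrightarrow>
    (\<exists>t g. breakpoints t \<and> (\<forall>i. smooth (g i)) \<and> (\<forall>i. \<forall>x\<in>{t i..<t (i + 1)}. f x = g i x))"
  unfolding piecewise_smooth_def breakpoints_def conj_assoc ..

text \<open>A description of piecewise smoothness by a mere set of exceptional points. In contrast to an
enumerated grid it can be refined by enlarging the set, so that common refinements are unions. The
intervals include their left endpoint because pieces are continued from the right.\<close>

definition smooth_between :: "real set \<Rightarrow> (real \<Rightarrow> real) \<Rightarrow> bool" where
  "smooth_between S f \<longleftrightarrow>
    (\<forall>a b. a < b \<longrightarrow> {a<..<b} \<inter> S = {} \<longrightarrow> (\<exists>g. smooth g \<and> (\<forall>x\<in>{a..<b}. f x = g x)))"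

lemma smooth_between_mono: "smooth_between S f \<Longrightarrow> S \<subseteq> S' \<Longrightarrow> smooth_between S' f"
  unfolding smooth_between_def by (metis Int_mono order_refl subset_empty)

text \<open>Given a set of exceptional points, the integers are added to make it unbounded in both
directions; then it can be enumerated as a grid of breakpoints.\<close>

lemma piecewise_smooth_iff_between:
  "piecewise_smooth f \<longleftrightarrow> (\<exists>S. locally_finite S \<and> smooth_between S f)"
proof
  assume "piecewise_smooth f"
  then obtain t g where t: "breakpoints t" and g: "\<And>i. smooth (g i)"
    "\<And>i x. x \<in> {t i..<t (i + 1)} \<Longrightarrow> f x = g i x"
    unfolding piecewise_smooth_iff_breakpoints by blast
  interpret breakpoints t by (rule t)
  have "smooth_between (range t) f"
    unfolding smooth_between_def
  proof (intro allI impI)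
    fix a b :: real assume ab: "a < b" "{a<..<b} \<inter> range t = {}"
    have "t (piece a + 1) \<notin> {a<..<b}" using ab(2) by blast
    then have "b \<le> t (piece a + 1)" using in_piece[of a] by auto
    then have "\<forall>x\<in>{a..<b}. f x = g (piece a) x"
      using in_piece[of a] by (intro ballI g(2)) auto
    then show "\<exists>g. smooth g \<and> (\<forall>x\<in>{a..<b}. f x = g x)" using g(1) by blast
  qed
  then show "\<exists>S. locally_finite S \<and> smooth_between S f" using lf by blast
next
  assume "\<exists>S. locally_finite S \<and> smooth_between S f"
  then obtain S where S: "locally_finite S" "smooth_between S f" by blast
  \<comment> \<open>\<open>S\<close> may be bounded or empty.\<close>
  let ?S = "S \<union> \<int>"
  have lf: "locally_finite ?S" using S(1) locally_finite_Ints by (rule locally_finite_Un)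
  have "\<not> bdd_above ?S" "\<not> bdd_below ?S"
  proof -
    show "\<not> bdd_above ?S"
    proof
      assume "bdd_above ?S"
      then obtain u where "\<And>x. x \<in> ?S \<Longrightarrow> x \<le> u" by (auto simp: bdd_above_def)
      from this[of "of_int (\<lceil>u\<rceil> + 1)"] show False by simp linarith
    qed
    show "\<not> bdd_below ?S"
    proof
      assume "bdd_below ?S"
      then obtain u where "\<And>x. x \<in> ?S \<Longrightarrow> u \<le> x" by (auto simp: bdd_below_def)
      from this[of "of_int (\<lfloor>u\<rfloor> - 1)"] show False by simp linarith
    qed
  qed
  from locally_finite_enumerate[OF lf this] obtain t :: "int \<Rightarrow> real"
    where t: "strict_mono t" "range t \<subseteq> ?S" "\<And>i. {t i<..<t (i + 1)} \<inter> ?S = {}"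
      "\<not> bdd_above (range t)" "\<not> bdd_below (range t)" by blast
  have "breakpoints t"
    using t locally_finite_subset[OF lf t(2)] by unfold_locales auto
  moreover have "\<exists>g. smooth g \<and> (\<forall>x\<in>{t i..<t (i + 1)}. f x = g x)" for i
  proof -
    have "smooth_between ?S f" using S(2) by (rule smooth_between_mono) simp
    moreover have "t i < t (i + 1)" using t(1) by (simp add: strict_mono_def)
    ultimately show ?thesis using t(3) unfolding smooth_between_def by blast
  qed
  then obtain g where "\<And>i. smooth (g i) \<and> (\<forall>x\<in>{t i..<t (i + 1)}. f x = g i x)" by metis
  ultimately show "piecewise_smooth f"
    unfolding piecewise_smooth_iff_breakpoints by blast
qed

lemma piecewise_smooth_lincomb:
  assumes "piecewise_smooth f" "piecewise_smooth g"
  shows "piecewise_smooth (\<lambda>x. a * f x + b * g x)"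
proof -
  obtain S T where S: "locally_finite S" "smooth_between S f" and T: "locally_finite T" "smooth_between T g"
    using assms by (auto simp: piecewise_smooth_iff_between)
  have "smooth_between (S \<union> T) (\<lambda>x. a * f x + b * g x)"
    unfolding smooth_between_def
  proof (intro allI impI)
    fix c d :: real assume cd: "c < d" "{c<..<d} \<inter> (S \<union> T) = {}"
    then have "{c<..<d} \<inter> S = {}" "{c<..<d} \<inter> T = {}" by auto
    with cd(1) S(2) T(2) obtain f' g' where "smooth f'" "\<forall>x\<in>{c..<d}. f x = f' x"
      "smooth g'" "\<forall>x\<in>{c..<d}. g x = g' x" unfolding smooth_between_def by meson
    then show "\<exists>h. smooth h \<and> (\<forall>x\<in>{c..<d}. a * f x + b * g x = h x)"
      by (intro exI[of _ "\<lambda>x. a * f' x + b * g' x"] conjI smooth_lincomb) auto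
  qed
  then show ?thesis
    using locally_finite_Un[OF S(1) T(1)] by (auto simp: piecewise_smooth_iff_between)
qed

lemma smooth_imp_piecewise_smooth: "smooth f \<Longrightarrow> piecewise_smooth f"
  unfolding piecewise_smooth_iff_between
  by (intro exI[of _ "{}"]) (auto simp: smooth_between_def finite_imp_locally_finite)

lemma piecewise_smooth_restrict:
  assumes "piecewise_smooth f"
  shows "piecewise_smooth (\<lambda>x. indicator {c..} x * f x)"
proof -
  obtain S where S: "locally_finite S" "smooth_between S f"
    using assms by (auto simp: piecewise_smooth_iff_between)
  have "smooth_between (insert c S) (\<lambda>x. indicator {c..} x * f x)"
    unfolding smooth_between_def
  proof (intro allI impI)
    fix a b :: real assume ab: "a < b" "{a<..<b} \<inter> insert c S = {}"
    show "\<exists>g. smooth g \<and> (\<forall>x\<in>{a..<b}. indicator {c..} x * f x = g x)"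
    proof (cases "c \<le> a")
      case True
      have "{a<..<b} \<inter> S = {}" using ab(2) by blast
      then obtain g where "smooth g" "\<forall>x\<in>{a..<b}. f x = g x"
        using S(2) ab(1) unfolding smooth_between_def by meson
      then show ?thesis using True by (intro exI[of _ g]) auto
    next
      case False
      then have "b \<le> c" using ab by auto
      then show ?thesis using smooth_zero by (intro exI[of _ "\<lambda>_. 0"]) auto
    qed
  qed
  moreover have "locally_finite (insert c S)"
    using locally_finite_Un[OF finite_imp_locally_finite[of "{c}"] S(1)] by simp
  ultimately show ?thesis by (auto simp: piecewise_smooth_iff_between)
qed

section \<open>Integrals of piecewise smooth functions\<close>

lemma tf_smooth: "smooth (tf_apply \<phi>)" and tf_compact: "compact (tf_support \<phi>)"
  using tf_apply[of \<phi>] by auto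

lemma tf_isCont: "isCont (tf_apply \<phi>) x"
  using tf_smooth by (rule smooth_continuous)

lemma tf_support_bounds:
  obtains a b where "a \<le> b" "tf_support \<phi> \<subseteq> {a..b}"
proof -
  obtain c where c: "tf_support \<phi> \<subseteq> cbox (- c) c"
    using bounded_subset_cbox_symmetric[OF compact_imp_bounded[OF tf_compact]] by blast
  show thesis by (rule that[of "- \<bar>c\<bar>" "\<bar>c\<bar>"]) (use c in auto)
qed

lemma tf_deriv_support: "tf_support (tf_deriv \<phi>) \<subseteq> tf_support \<phi>"
proof -
  have "{x. tf_apply (tf_deriv \<phi>) x \<noteq> 0} \<subseteq> tf_support \<phi>"
    using deriv_outside_fun_support by (auto simp: tf_deriv.rep_eq)
  then show ?thesis
    unfolding fun_support_def[of "tf_apply (tf_deriv \<phi>)"]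
    by (rule closure_minimal) (simp add: fun_support_def)
qed

text \<open>On a half-open piece the function agrees with a smooth one; the missing endpoint is a null set.\<close>

lemma has_integral_piece:
  fixes f g h :: "real \<Rightarrow> real"
  assumes fg: "\<And>x. x \<in> {a..<b} \<Longrightarrow> f x = g x" and g: "\<And>x. isCont g x" and h: "\<And>x. isCont h x"
  shows "has_bochner_integral lborel (\<lambda>x. indicator {a..<b} x * (f x * h x))
    (LINT x|lborel. (g x * h x) * indicator {a..b} x)"
proof -
  have [measurable]: "g \<in> borel_measurable borel" "h \<in> borel_measurable borel"
    using g h by (auto intro!: borel_measurable_continuous_onI continuous_at_imp_continuous_on)
  have "integrable lborel (\<lambda>x. (g x * h x) * indicator {a..b} x)"
    using g h by (intro borel_integrable_atLeastAtMost continuous_intros)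
  then have "has_bochner_integral lborel (\<lambda>x. (g x * h x) * indicator {a..b} x)
    (LINT x|lborel. (g x * h x) * indicator {a..b} x)" by (rule has_bochner_integral_integrable)
  moreover have "AE x in lborel. (g x * h x) * indicator {a..b} x = indicator {a..<b} x * (g x * h x)"
    using AE_lborel_singleton[of b] by eventually_elim (auto simp: indicator_def)
  ultimately have "has_bochner_integral lborel (\<lambda>x. indicator {a..<b} x * (g x * h x))
    (LINT x|lborel. (g x * h x) * indicator {a..b} x)"
    by (subst has_bochner_integral_cong_AE[symmetric]) auto
  moreover have "indicator {a..<b} x * (g x * h x) = indicator {a..<b} x * (f x * h x)" for x
    using fg by (auto simp: indicator_def)
  ultimately show ?thesis by simp
qed

context breakpoints begin

lemma has_integral_pieces:
  assumes g: "\<And>i. smooth (g i)" and fg: "\<And>i x. x \<in> {t i..<t (i + 1)} \<Longrightarrow> f x = g i x"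
    and h: "\<And>x. isCont h x"
  shows "has_bochner_integral lborel (\<lambda>x. indicator {t i..<t (i + int n)} x * (f x * h x))
    (\<Sum>k<n. LINT x|lborel. (g (i + int k) x * h x) * indicator {t (i + int k)..t (i + int k + 1)} x)"
proof (induction n)
  case (Suc n)
  let ?j = "i + int n"
  have "has_bochner_integral lborel (\<lambda>x. indicator {t i..<t ?j} x * (f x * h x) +
      indicator {t ?j..<t (?j + 1)} x * (f x * h x))
    ((\<Sum>k<n. LINT x|lborel. (g (i + int k) x * h x) * indicator {t (i + int k)..t (i + int k + 1)} x) +
      (LINT x|lborel. (g ?j x * h x) * indicator {t ?j..t (?j + 1)} x))"
    using Suc.IH has_integral_piece[OF fg smooth_continuous[OF g] h]
    by (rule has_bochner_integral_add)
  moreover have "indicator {t i..<t ?j} x * (f x * h x) + indicator {t ?j..<t (?j + 1)} x * (f x * h x) =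
      indicator {t i..<t (i + int (Suc n))} x * (f x * h x)" for x
  proof -
    have "t i \<le> t ?j" "t ?j \<le> t (?j + 1)" using strict_mono_less_eq[OF mono] by simp_all
    moreover have eq: "i + int (Suc n) = ?j + 1" by simp
    ultimately show ?thesis unfolding eq by (auto simp: indicator_def)
  qed
  ultimately show ?case by simp
qed (simp add: has_bochner_integral_zero)

end

text \<open>A compact interval meets only finitely many pieces.\<close>

lemma piecewise_smooth_integrable:
  assumes f: "piecewise_smooth f" and h: "\<And>x. isCont h x" and supp: "\<And>x. x \<notin> {a..b} \<Longrightarrow> h x = 0"
  shows "integrable lborel (\<lambda>x. f x * h x)"
proof (cases "a \<le> b")
  case True
  obtain t g where t: "breakpoints t" and g: "\<And>i. smooth (g i)"
    "\<And>i x. x \<in> {t i..<t (i + 1)} \<Longrightarrow> f x = g i x"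
    using f unfolding piecewise_smooth_iff_breakpoints by blast
  interpret breakpoints t by (rule t)
  obtain i n where "t i < a" "b < t (i + int n)" using cover_interval[OF True] .
  then have "indicator {t i..<t (i + int n)} x * (f x * h x) = f x * h x" for x
    using supp[of x] by (cases "x \<in> {a..b}") (auto simp: indicator_def)
  then have eq: "(\<lambda>x. indicator {t i..<t (i + int n)} x * (f x * h x)) = (\<lambda>x. f x * h x)" by blast
  show ?thesis
    using has_integral_pieces[where g = g and f = f and h = h and i = i and n = n, OF g h]
    unfolding eq has_bochner_integral_iff by blast
next
  case False
  then have "h x = 0" for x using supp[of x] by auto
  then show ?thesis by simp
qed

lemma piecewise_smooth_local_integrable:
  assumes f: "piecewise_smooth f"
  shows "integrable lborel (\<lambda>x. f x * indicator {a..b} x)"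
proof (cases "a \<le> b")
  case True
  obtain t g where t: "breakpoints t" and g: "\<And>i. smooth (g i)"
    "\<And>i x. x \<in> {t i..<t (i + 1)} \<Longrightarrow> f x = g i x"
    using f unfolding piecewise_smooth_iff_breakpoints by blast
  interpret breakpoints t by (rule t)
  obtain i n where in': "t i < a" "b < t (i + int n)" using cover_interval[OF True] .
  have "integrable lborel (\<lambda>x. indicator {t i..<t (i + int n)} x * (f x * 1))"
    using has_integral_pieces[where g = g and f = f and h = "\<lambda>_. 1" and i = i and n = n, OF g]
    by (auto simp: has_bochner_integral_iff)
  then have "integrable lborel (\<lambda>x. indicator {t i..<t (i + int n)} x * (f x * 1) * indicator {a..b} x)"
    by (intro integrable_real_mult_indicator) simp
  moreover have "(\<lambda>x. indicator {t i..<t (i + int n)} x * (f x * 1) * indicator {a..b} x) =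
      (\<lambda>x. f x * indicator {a..b} x)"
    using in' by (auto simp: indicator_def fun_eq_iff)
  ultimately show ?thesis by (simp only:)
qed simp

lemma regular_dist_integrable: "piecewise_smooth f \<Longrightarrow> integrable lborel (\<lambda>x. f x * tf_apply \<phi> x)"
proof -
  assume f: "piecewise_smooth f"
  obtain a b where "tf_support \<phi> \<subseteq> {a..b}" by (rule tf_support_bounds)
  then show ?thesis
    using outside_fun_support[of _ "tf_apply \<phi>"]
    by (intro piecewise_smooth_integrable[OF f tf_isCont, of a b]) blast
qed

lemma regular_dist_lincomb:
  assumes "piecewise_smooth f" "piecewise_smooth g"
  shows "regular_dist (\<lambda>x. a * f x + b * g x) \<phi> = a * regular_dist f \<phi> + b * regular_dist g \<phi>"
  unfolding regular_dist_def
  using regular_dist_integrable[OF assms(1), of \<phi>] regular_dist_integrable[OF assms(2), of \<phi>]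
  by (simp add: distrib_right mult.assoc)

text \<open>The coefficients are extended by zero, so that several impulses can be written with one common
upper summation bound.\<close>

lemma point_impulsesE:
  assumes "D \<in> point_impulses t"
  obtains N c where "\<And>i. i > N \<Longrightarrow> c i = 0"
    "\<And>M. M \<ge> N \<Longrightarrow> D = (\<lambda>\<phi>. \<Sum>i\<le>M. c i * (dist_deriv ^^ i) (dirac t) \<phi>)"
proof -
  from assms obtain N c where D: "D = (\<lambda>\<phi>. \<Sum>i\<le>N. c i * (dist_deriv ^^ i) (dirac t) \<phi>)"
    by (auto simp: point_impulses_def)
  define c' where "c' i = (if i \<le> N then c i else 0)" for i
  have "(\<Sum>i\<le>M. c' i * (dist_deriv ^^ i) (dirac t) \<phi>) = D \<phi>" if "M \<ge> N" for M \<phi>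
    unfolding D by (rule sum.mono_neutral_cong_right) (use that in \<open>auto simp: c'_def\<close>)
  then show thesis by (intro that[of N c']) (auto simp: c'_def)
qed

lemma point_impulsesI: "D = (\<lambda>\<phi>. \<Sum>i\<le>N. c i * (dist_deriv ^^ i) (dirac t) \<phi>) \<Longrightarrow> D \<in> point_impulses t"
  by (auto simp: point_impulses_def)

lemma point_impulses_zero: "(\<lambda>_. 0) \<in> point_impulses t"
  by (rule point_impulsesI[where c = "\<lambda>_. 0" and N = 0]) simp

lemma point_impulses_lincomb:
  assumes "D \<in> point_impulses t" "D' \<in> point_impulses t"
  shows "(\<lambda>\<phi>. a * D \<phi> + b * D' \<phi>) \<in> point_impulses t"
proof -
  obtain N c where c: "\<And>M. M \<ge> N \<Longrightarrow> D = (\<lambda>\<phi>. \<Sum>i\<le>M. c i * (dist_deriv ^^ i) (dirac t) \<phi>)"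
    using assms(1) by (rule point_impulsesE) blast
  obtain N' c' where c': "\<And>M. M \<ge> N' \<Longrightarrow> D' = (\<lambda>\<phi>. \<Sum>i\<le>M. c' i * (dist_deriv ^^ i) (dirac t) \<phi>)"
    using assms(2) by (rule point_impulsesE) blast
  show ?thesis
    by (rule point_impulsesI[where c = "\<lambda>i. a * c i + b * c' i" and N = "max N N'"])
      (subst c[of "max N N'"], simp, subst c'[of "max N N'"], simp,
        simp add: sum_distrib_left sum.distrib algebra_simps)
qed

lemma dirac_in_point_impulses: "dirac t \<in> point_impulses t"
  by (rule point_impulsesI[where c = "\<lambda>_. 1" and N = 0]) simp

lemma dist_deriv_sum:
  "dist_deriv (\<lambda>\<phi>. \<Sum>i\<le>N. c i * (dist_deriv ^^ i) (dirac t) \<phi>) =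
    (\<lambda>\<phi>. \<Sum>i\<le>N. c i * (dist_deriv ^^ Suc i) (dirac t) \<phi>)"
  by (simp add: fun_eq_iff dist_deriv_def[of "\<lambda>\<phi>. \<Sum>i\<le>N. _ i \<phi>"] dist_deriv_def[of "(dist_deriv ^^ _) _"]
      sum_negf[symmetric])

lemma point_impulses_dist_deriv:
  assumes "D \<in> point_impulses t"
  shows "dist_deriv D \<in> point_impulses t"
proof -
  obtain N c where "D = (\<lambda>\<phi>. \<Sum>i\<le>N. c i * (dist_deriv ^^ i) (dirac t) \<phi>)"
    using assms by (auto simp: point_impulses_def)
  then have "dist_deriv D = (\<lambda>\<phi>. \<Sum>i\<le>N. c i * (dist_deriv ^^ Suc i) (dirac t) \<phi>)"
    by (simp only: dist_deriv_sum)
  also have "\<dots> = (\<lambda>\<phi>. \<Sum>i\<le>Suc N. case_nat 0 c i * (dist_deriv ^^ i) (dirac t) \<phi>)"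
    by (subst sum.atMost_Suc_shift) simp
  finally show ?thesis by (rule point_impulsesI)
qed

text \<open>Impulses are supported at a point. This makes the sums in \<open>pw_dist\<close> independent of the chosen
finite index set, as long as that contains all relevant points.\<close>

lemma point_impulse_outside_support:
  assumes "D \<in> point_impulses t" "t \<notin> tf_support \<phi>"
  shows "D \<phi> = 0"
proof -
  have "t \<notin> tf_support ((tf_deriv ^^ i) \<phi>)" for i
    by (induction i) (use assms(2) tf_deriv_support in auto)
  moreover have "(deriv ^^ i) (tf_apply \<phi>) = tf_apply ((tf_deriv ^^ i) \<phi>)" for i
    by (induction i) (simp_all add: tf_deriv.rep_eq)
  ultimately have "(deriv ^^ i) (tf_apply \<phi>) t = 0" for i
    using outside_fun_support by metis
  then show ?thesis using assms(1) by (auto simp: point_impulses_def dirac_higher_deriv)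
qed

lemma point_impulse_eq_zeroI:
  assumes D: "D \<in> point_impulses t" and "e > 0"
    and zero: "\<And>\<phi>. tf_support \<phi> \<subseteq> {t - e..t + e} \<Longrightarrow> D \<phi> = 0"
  shows "D = (\<lambda>_. 0)"
proof -
  obtain N c where c: "D = (\<lambda>\<phi>. \<Sum>i\<le>N. c i * (dist_deriv ^^ i) (dirac t) \<phi>)"
    using D by (auto simp: point_impulses_def)
  have "c k = 0" if "k \<le> N" for k
    by (rule dirac_derivs_independent[OF \<open>e > 0\<close> _ that]) (use zero in \<open>simp add: c\<close>)
  then show ?thesis by (simp add: c)
qed

section \<open>Uniqueness of the regular and the impulsive part\<close>

text \<open>The family \<open>\<Delta>\<close> is meaningless outside \<open>T\<close>. This normalized family is the one that the
distribution determines.\<close>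

definition impulse_at :: "real set \<Rightarrow> (real \<Rightarrow> functional) \<Rightarrow> real \<Rightarrow> functional" where
  "impulse_at T \<Delta> t = (if t \<in> T then \<Delta> t else (\<lambda>_. 0))"

lemma impulse_at_point_impulse: "pw_data f T \<Delta> \<Longrightarrow> impulse_at T \<Delta> t \<in> point_impulses t"
  by (simp add: impulse_at_def pw_data_def point_impulses_zero)

lemma finite_Int_support: "locally_finite T \<Longrightarrow> finite (T \<inter> tf_support \<phi>)"
proof -
  assume T: "locally_finite T"
  obtain a b where "tf_support \<phi> \<subseteq> {a..b}" by (rule tf_support_bounds)
  then have "T \<inter> tf_support \<phi> \<subseteq> T \<inter> {a..b}" by blast
  then show ?thesis using T finite_subset unfolding locally_finite_def by blast
qed

lemma pw_dist_enlarge: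
  assumes "locally_finite U" "T \<subseteq> U"
  shows "pw_dist f T \<Delta> \<phi> = regular_dist f \<phi> + (\<Sum>t\<in>U \<inter> tf_support \<phi>. impulse_at T \<Delta> t \<phi>)"
proof -
  have "(\<Sum>t\<in>T \<inter> tf_support \<phi>. \<Delta> t \<phi>) = (\<Sum>t\<in>U \<inter> tf_support \<phi>. impulse_at T \<Delta> t \<phi>)"
    by (rule sum.mono_neutral_cong_left[OF finite_Int_support[OF assms(1)]])
      (use assms(2) in \<open>auto simp: impulse_at_def\<close>)
  then show ?thesis by (simp add: pw_dist_def)
qed

lemma pw_lincomb:
  fixes a b :: real
  assumes f: "pw_data f T \<Delta>" and g: "pw_data g U \<Gamma>"
  defines "\<Theta> \<equiv> \<lambda>t \<phi>. a * impulse_at T \<Delta> t \<phi> + b * impulse_at U \<Gamma> t \<phi>"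
  shows "pw_data (\<lambda>x. a * f x + b * g x) (T \<union> U) \<Theta>"
    and "pw_dist (\<lambda>x. a * f x + b * g x) (T \<union> U) \<Theta> = (\<lambda>\<phi>. a * pw_dist f T \<Delta> \<phi> + b * pw_dist g U \<Gamma> \<phi>)"
proof -
  have lf: "locally_finite (T \<union> U)" using f g by (auto simp: pw_data_def locally_finite_Un)
  show "pw_data (\<lambda>x. a * f x + b * g x) (T \<union> U) \<Theta>"
    using lf f g unfolding pw_data_def \<Theta>_def
    by (auto intro: piecewise_smooth_lincomb point_impulses_lincomb
        impulse_at_point_impulse[OF f] impulse_at_point_impulse[OF g])
  show "pw_dist (\<lambda>x. a * f x + b * g x) (T \<union> U) \<Theta> = (\<lambda>\<phi>. a * pw_dist f T \<Delta> \<phi> + b * pw_dist g U \<Gamma> \<phi>)"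
  proof
    fix \<phi>
    have *: "pw_dist f T \<Delta> \<phi> = regular_dist f \<phi> + (\<Sum>t\<in>(T \<union> U) \<inter> tf_support \<phi>. impulse_at T \<Delta> t \<phi>)"
      "pw_dist g U \<Gamma> \<phi> = regular_dist g \<phi> + (\<Sum>t\<in>(T \<union> U) \<inter> tf_support \<phi>. impulse_at U \<Gamma> t \<phi>)"
      by (rule pw_dist_enlarge[OF lf], blast)+
    have **: "regular_dist (\<lambda>x. a * f x + b * g x) \<phi> = a * regular_dist f \<phi> + b * regular_dist g \<phi>"
      using f g by (auto simp: pw_data_def intro: regular_dist_lincomb)
    show "pw_dist (\<lambda>x. a * f x + b * g x) (T \<union> U) \<Theta> \<phi> = a * pw_dist f T \<Delta> \<phi> + b * pw_dist g U \<Gamma> \<phi>"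
      unfolding * pw_dist_def[of "\<lambda>x. a * f x + b * g x"] ** \<Theta>_def
      by (simp add: sum.distrib sum_distrib_left distrib_left)
  qed
qed

text \<open>If \<open>f x\<close> were nonzero, then \<open>f\<close> would have constant sign on a short interval to the right of \<open>x\<close>
that contains no impulse, and a bump function supported there would give a nonzero value. So \<open>f\<close>
vanishes, and testing near a single point \<open>t\<close> isolates \<open>\<Delta> t\<close>.\<close>

lemma pw_dist_eq_zeroD:
  assumes data: "pw_data f T \<Delta>" and zero: "\<And>\<phi>. pw_dist f T \<Delta> \<phi> = 0"
  shows "f x = 0" and "impulse_at T \<Delta> t = (\<lambda>_. 0)"
proof -
  have f: "piecewise_smooth f" and T: "locally_finite T" using data by (auto simp: pw_data_def)
  obtain S where S: "locally_finite S" "smooth_between S f"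
    using f by (auto simp: piecewise_smooth_iff_between)
  have f0: "f x = 0" for x
  proof (rule ccontr)
    assume nz: "f x \<noteq> 0"
    obtain e where e: "e > 0" "(S \<union> T) \<inter> {x - e..x + e} \<subseteq> {x}"
      using locally_finite_isolated[OF locally_finite_Un[OF S(1) T]] .
    have "x < x + e" "{x<..<x + e} \<inter> S = {}" using e by auto
    then obtain g where g: "smooth g" "\<forall>y\<in>{x..<x + e}. f y = g y"
      using S(2) unfolding smooth_between_def by meson
    define \<sigma> where "\<sigma> = sgn (g x)"
    have "g x \<noteq> 0" using g(2) nz e(1) by force
    then have "\<sigma> * g x > 0" by (simp add: \<sigma>_def sgn_mult_self_eq flip: abs_sgn_eq) (simp add: sgn_if)
    moreover have "isCont (\<lambda>y. \<sigma> * g y) x" using smooth_continuous[OF g(1)] by simp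
    ultimately have "\<forall>\<^sub>F y in at x. 0 < \<sigma> * g y"
      by (intro order_tendstoD(1)) (auto simp: isCont_def)
    then obtain d where d: "d > 0" "\<And>y. y \<noteq> x \<Longrightarrow> dist y x < d \<Longrightarrow> 0 < \<sigma> * g y"
      by (auto simp: eventually_at)
    define r where "r = min d e"
    have r: "r > 0" "r \<le> d" "r \<le> e" using d(1) e(1) by (auto simp: r_def)
    \<comment> \<open>The middle third keeps the support away from \<open>x\<close>, which may carry an impulse.\<close>
    define p q where "p = x + r / 3" and "q = x + 2 * r / 3"
    have pq: "x < p" "p < q" "q < x + r" using r by (auto simp: p_def q_def)
    obtain \<phi> where \<phi>: "\<And>y. tf_apply \<phi> y = 1 * bump p q y" "tf_support \<phi> \<subseteq> {p..q}"
      using test_fun_bump_ex[OF smooth_const[of 1], of p q] by blast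
    have "T \<inter> tf_support \<phi> = {}"
    proof (rule ccontr)
      assume "T \<inter> tf_support \<phi> \<noteq> {}"
      then obtain y where "y \<in> T \<inter> tf_support \<phi>" by (metis ex_in_conv)
      then have y: "y \<in> T" "y \<in> {p..q}" using subsetD[OF \<phi>(2)] by simp_all
      then have "y \<in> {x - e..x + e}" using pq r by auto
      then have "y = x" using y(1) e(2) by blast
      then show False using y(2) pq by simp
    qed
    then have int0: "(LINT y|lborel. f y * tf_apply \<phi> y) = 0"
      using zero[of \<phi>] by (simp add: pw_dist_def regular_dist_def)
    let ?F = "\<lambda>y. \<sigma> * (f y * tf_apply \<phi> y)"
    have pos: "\<sigma> * f y > 0" if "y \<in> {p..q}" for y
    proof -
      have "f y = g y" "dist y x < d" "y \<noteq> x" using that pq r g(2) by (auto simp: dist_real_def)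
      then show ?thesis using d(2) by simp
    qed
    have Fpos: "?F y > 0" if "y \<in> {p<..<q}" for y
      using pos[of y] bump_pos[of p y q] that by (simp add: \<phi>(1) flip: mult.assoc)
    have Fzero: "?F y = 0" if "y \<notin> {p<..<q}" for y
      using bump_zero[OF that] by (simp add: \<phi>(1))
    have Fnn: "?F y \<ge> 0" for y using Fpos[of y] Fzero[of y] by (cases "y \<in> {p<..<q}") auto
    have "integrable lborel ?F" using regular_dist_integrable[OF f, of \<phi>] by simp
    moreover have "(LINT y|lborel. ?F y) = 0" using int0 by simp
    ultimately have "AE y in lborel. ?F y = 0"
      using integral_nonneg_eq_0_iff_AE[of lborel ?F] Fnn by simp
    then have "AE y in lborel. y \<notin> {p<..<q}"
      by eventually_elim (use Fpos in force)
    then have "emeasure lborel {p<..<q} = 0"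
      by (subst (asm) AE_iff_measurable[where N = "{p<..<q}"]) auto
    then show False using pq by simp
  qed
  then show "f x = 0" .
  have "f = (\<lambda>_. 0)" using f0 by blast
  then have reg: "regular_dist f \<phi> = 0" for \<phi> by (simp add: regular_dist_def)
  show "impulse_at T \<Delta> t = (\<lambda>_. 0)"
  proof (cases "t \<in> T")
    case True
    then have \<Delta>: "\<Delta> t \<in> point_impulses t" using data by (simp add: pw_data_def)
    obtain e where e: "e > 0" "T \<inter> {t - e..t + e} \<subseteq> {t}" using locally_finite_isolated[OF T] .
    have "\<Delta> t \<phi> = 0" if "tf_support \<phi> \<subseteq> {t - e..t + e}" for \<phi>
    proof (cases "t \<in> tf_support \<phi>")
      case t: True
      then have "T \<inter> tf_support \<phi> = {t}" using that e(2) True by auto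
      then show ?thesis using zero[of \<phi>] reg by (simp add: pw_dist_def)
    qed (use point_impulse_outside_support[OF \<Delta>] in blast)
    then have "\<Delta> t = (\<lambda>_. 0)" by (rule point_impulse_eq_zeroI[OF \<Delta> e(1)])
    then show ?thesis by (simp add: impulse_at_def)
  qed (simp add: impulse_at_def)
qed

text \<open>Apply the case of the zero distribution to the difference of the two representations.\<close>

lemma pw_dist_unique:
  assumes f: "pw_data f T \<Delta>" and g: "pw_data g U \<Gamma>" and eq: "pw_dist f T \<Delta> = pw_dist g U \<Gamma>"
  shows "f = g" and "impulse_at T \<Delta> = impulse_at U \<Gamma>"
proof -
  note l = pw_lincomb[OF f g, of 1 "-1"]
  have z: "f x - g x = 0" "impulse_at (T \<union> U) (\<lambda>t \<phi>. impulse_at T \<Delta> t \<phi> - impulse_at U \<Gamma> t \<phi>) t = (\<lambda>_. 0)" for x t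
    using pw_dist_eq_zeroD[OF l(1)] unfolding l(2) eq by simp_all
  show "f = g" using z(1) by (simp add: fun_eq_iff)
  show "impulse_at T \<Delta> = impulse_at U \<Gamma>"
  proof
    fix t
    show "impulse_at T \<Delta> t = impulse_at U \<Gamma> t"
    proof (cases "t \<in> T \<union> U")
      case True
      then have "(\<lambda>\<phi>. impulse_at T \<Delta> t \<phi> - impulse_at U \<Gamma> t \<phi>) = (\<lambda>_. 0)"
        using z(2)[of t] unfolding impulse_at_def[of "T \<union> U"] by (simp only: if_True)
      then show ?thesis by (simp add: fun_eq_iff)
    qed (simp add: impulse_at_def)
  qed
qed

lemma pw_dist_cong:
  assumes f: "pw_data f T \<Delta>" and g: "pw_data f U \<Gamma>" and eq: "impulse_at T \<Delta> = impulse_at U \<Gamma>"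
  shows "pw_dist f T \<Delta> = pw_dist f U \<Gamma>"
proof
  fix \<phi>
  have lf: "locally_finite (T \<union> U)" using f g by (auto simp: pw_data_def locally_finite_Un)
  show "pw_dist f T \<Delta> \<phi> = pw_dist f U \<Gamma> \<phi>"
    unfolding pw_dist_enlarge[OF lf Un_upper1] pw_dist_enlarge[OF lf Un_upper2] eq ..
qed

lemma impulsive_part_pw_dist:
  assumes "pw_data f T \<Delta>"
  shows "impulsive_part (pw_dist f T \<Delta>) t = impulse_at T \<Delta> t"
  unfolding impulsive_part_def
proof (rule the_equality)
  show "\<exists>f' T' \<Delta>'. pw_data f' T' \<Delta>' \<and> pw_dist f T \<Delta> = pw_dist f' T' \<Delta>' \<and>
      impulse_at T \<Delta> t = (if t \<in> T' then \<Delta>' t else (\<lambda>_. 0))"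
    using assms unfolding impulse_at_def by blast
  fix I assume "\<exists>f' T' \<Delta>'. pw_data f' T' \<Delta>' \<and> pw_dist f T \<Delta> = pw_dist f' T' \<Delta>' \<and>
      I = (if t \<in> T' then \<Delta>' t else (\<lambda>_. 0))"
  then obtain f' T' \<Delta>' where "pw_data f' T' \<Delta>'" "pw_dist f T \<Delta> = pw_dist f' T' \<Delta>'"
    "I = impulse_at T' \<Delta>' t" unfolding impulse_at_def by blast
  then show "I = impulse_at T \<Delta> t" using pw_dist_unique(2)[OF assms] by metis
qed

lemma pw_data_restrict:
  assumes "pw_data f T \<Delta>"
  shows "pw_data (\<lambda>x. indicator {c..} x * f x) (T \<inter> {c..}) \<Delta>"
  using assms piecewise_smooth_restrict locally_finite_subset[of T "T \<inter> {c..}"]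
  by (auto simp: pw_data_def)

lemma dist_restrict_pw_dist:
  assumes "pw_data f T \<Delta>"
  shows "dist_restrict {c..} (pw_dist f T \<Delta>) = pw_dist (\<lambda>x. indicator {c..} x * f x) (T \<inter> {c..}) \<Delta>"
  unfolding dist_restrict_def
proof (rule the_equality)
  fix R assume "\<exists>f' T' \<Delta>'. pw_data f' T' \<Delta>' \<and> pw_dist f T \<Delta> = pw_dist f' T' \<Delta>' \<and>
      R = pw_dist (\<lambda>x. indicator {c..} x * f' x) (T' \<inter> {c..}) \<Delta>'"
  then obtain f' T' \<Delta>' where *: "pw_data f' T' \<Delta>'" "pw_dist f T \<Delta> = pw_dist f' T' \<Delta>'"
    and R: "R = pw_dist (\<lambda>x. indicator {c..} x * f' x) (T' \<inter> {c..}) \<Delta>'" by blast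
  have "f = f'" and "impulse_at T \<Delta> = impulse_at T' \<Delta>'"
    using pw_dist_unique[OF assms *] by auto
  then have "impulse_at (T \<inter> {c..}) \<Delta> = impulse_at (T' \<inter> {c..}) \<Delta>'"
    unfolding impulse_at_def fun_eq_iff by auto metis+
  then show "R = pw_dist (\<lambda>x. indicator {c..} x * f x) (T \<inter> {c..}) \<Delta>"
    using pw_dist_cong[OF pw_data_restrict[OF assms] pw_data_restrict[OF *(1), folded \<open>f = f'\<close>]]
    unfolding R \<open>f = f'\<close> by simp
qed (use assms in blast)

section \<open>The derivative of a piecewise-smooth distribution\<close>

text \<open>Together with \<open>right_deriv_zero\<close>, this transfers information on one side of a point, where only
one piece is active, to the point itself.\<close>

lemma left_value:
  fixes G :: "real \<Rightarrow> real"
  assumes "isCont G s" "a < s" "\<And>y. y \<in> {a<..<s} \<Longrightarrow> G y = v"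
  shows "G s = v"
proof -
  have "(G \<longlongrightarrow> G s) (at_left s)"
    using assms(1) by (simp add: continuous_at_imp_continuous_at_within flip: continuous_within)
  moreover have "(G \<longlongrightarrow> v) (at_left s)"
    by (rule Lim_transform_eventually[OF tendsto_const])
      (use assms(2,3) in \<open>auto intro!: eventually_at_leftI[of a]\<close>)
  ultimately show ?thesis by (intro tendsto_unique[of "at_left s"]) auto
qed

lemma right_deriv_zero:
  fixes G :: "real \<Rightarrow> real"
  assumes D: "(G has_field_derivative D) (at x)" and "x < b" "\<And>y. y \<in> {x..<b} \<Longrightarrow> G y = 0"
  shows "D = 0"
proof -
  have "((\<lambda>y. (G y - G x) / (y - x)) \<longlongrightarrow> D) (at_right x)"
    using DERIV_subset[OF D, of "{x<..}"] by (simp add: has_field_derivative_iff)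
  moreover have "((\<lambda>y. (G y - G x) / (y - x)) \<longlongrightarrow> 0) (at_right x)"
    by (rule Lim_transform_eventually[OF tendsto_const])
      (use assms(2,3) in \<open>auto intro!: eventually_at_rightI[of _ b]\<close>)
  ultimately show ?thesis by (intro tendsto_unique[of "at_right x"]) auto
qed

context breakpoints begin

lemma regular_dist_pieces:
  assumes g: "\<And>i. smooth (g i)" and fg: "\<And>i x. x \<in> {t i..<t (i + 1)} \<Longrightarrow> f x = g i x"
    and supp: "tf_support \<phi> \<subseteq> {t i<..<t (i + int n)}"
  shows "regular_dist f \<phi> =
    (\<Sum>k<n. LINT x|lborel. (g (i + int k) x * tf_apply \<phi> x) * indicator {t (i + int k)..t (i + int k + 1)} x)"
proof -
  have "indicator {t i..<t (i + int n)} x * (f x * tf_apply \<phi> x) = f x * tf_apply \<phi> x" for x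
    using supp outside_fun_support[of x "tf_apply \<phi>"] by (cases "x \<in> tf_support \<phi>") auto
  then have eq: "(\<lambda>x. indicator {t i..<t (i + int n)} x * (f x * tf_apply \<phi> x)) = (\<lambda>x. f x * tf_apply \<phi> x)"
    by blast
  show ?thesis
    using has_integral_pieces[where g = g and f = f and h = "tf_apply \<phi>" and i = i and n = n, OF g fg tf_isCont]
    unfolding eq has_bochner_integral_iff regular_dist_def by blast
qed

text \<open>Summation by parts: the boundary terms at the ends of the pieces are regrouped into the jumps at
the breakpoints.\<close>

lemma sum_jumps:
  fixes G :: "int \<Rightarrow> real \<Rightarrow> real"
  shows "(\<Sum>k<n. G (i + int k) (t (i + int k + 1)) - G (i + int k) (t (i + int k))) =
    G (i + int n - 1) (t (i + int n)) - G (i - 1) (t i) -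
    (\<Sum>k<n. G (i + int k) (t (i + int k)) - G (i + int k - 1) (t (i + int k)))"
proof (induction n)
  case (Suc n)
  have "i + int (Suc n) = i + int n + 1" by simp
  then show ?case using Suc by (simp add: algebra_simps)
qed simp

definition jump :: "(int \<Rightarrow> real \<Rightarrow> real) \<Rightarrow> real \<Rightarrow> real" where
  "jump g s = (if s \<in> range t then g (piece s) s - g (piece s - 1) s else 0)"

text \<open>Integration by parts on each piece. The boundary terms at the outer ends vanish with the test
function, those in between combine to jumps.\<close>

lemma regular_dist_deriv:
  assumes g: "\<And>i. smooth (g i)" and fg: "\<And>i x. x \<in> {t i..<t (i + 1)} \<Longrightarrow> f x = g i x"
  shows "- regular_dist f (tf_deriv \<phi>) =
    regular_dist (\<lambda>x. deriv (g (piece x)) x) \<phi> + (\<Sum>s\<in>range t \<inter> tf_support \<phi>. jump g s * tf_apply \<phi> s)"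
proof -
  let ?f' = "\<lambda>x. deriv (g (piece x)) x"
  obtain a b where ab: "a \<le> b" "tf_support \<phi> \<subseteq> {a..b}" by (rule tf_support_bounds)
  obtain i n where inn: "t i < a" "b < t (i + int n)" using cover_interval[OF ab(1)] .
  have supp: "tf_support \<phi> \<subseteq> {t i<..<t (i + int n)}" using ab(2) inn by auto
  then have supp': "tf_support (tf_deriv \<phi>) \<subseteq> {t i<..<t (i + int n)}" using tf_deriv_support by blast
  \<comment> \<open>The two outer ends of the covering lie outside the support.\<close>
  have ends: "tf_apply \<phi> (t i) = 0" "tf_apply \<phi> (t (i + int n)) = 0"
    by (rule outside_fun_support, use supp in auto)+
  have f'g: "?f' x = deriv (g j) x" if "x \<in> {t j..<t (j + 1)}" for j x
    using piece_eq[OF that] by simp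
  let ?G = "\<lambda>j s. g j s * tf_apply \<phi> s"
  let ?I = "\<lambda>k. LINT x|lborel. (deriv (g (i + int k)) x * tf_apply \<phi> x) * indicator {t (i + int k)..t (i + int k + 1)} x"
  have parts: "(LINT x|lborel. (g (i + int k) x * tf_apply (tf_deriv \<phi>) x) * indicator {t (i + int k)..t (i + int k + 1)} x)
      = (?G (i + int k) (t (i + int k + 1)) - ?G (i + int k) (t (i + int k))) - ?I k" for k
    using strict_mono_less_eq[OF mono] smooth_DERIV[OF g] smooth_DERIV[OF tf_smooth]
    by (subst integral_by_parts) (auto intro!: smooth_continuous smooth_deriv g tf_smooth simp: tf_deriv.rep_eq)
  have reg': "regular_dist ?f' \<phi> = (\<Sum>k<n. ?I k)"
    by (rule regular_dist_pieces[where g = "\<lambda>j. deriv (g j)", OF smooth_deriv[OF g] f'g supp])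
  have reg: "regular_dist f (tf_deriv \<phi>) =
      (\<Sum>k<n. (?G (i + int k) (t (i + int k + 1)) - ?G (i + int k) (t (i + int k))) - ?I k)"
    using regular_dist_pieces[where g = g and f = f, OF g fg supp'] unfolding parts .
  have "(\<Sum>s\<in>range t \<inter> tf_support \<phi>. jump g s * tf_apply \<phi> s) =
      (\<Sum>s\<in>(\<lambda>k. t (i + int k)) ` {..<n}. jump g s * tf_apply \<phi> s)"
  proof (rule sum.mono_neutral_left)
    show "range t \<inter> tf_support \<phi> \<subseteq> (\<lambda>k. t (i + int k)) ` {..<n}"
    proof
      fix s assume s: "s \<in> range t \<inter> tf_support \<phi>"
      then obtain j where j: "s = t j" by blast
      then have "t i < t j" "t j < t (i + int n)" using s supp by auto
      then have "i < j" "j < i + int n" using strict_mono_less[OF mono] by blast+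
      then have "j = i + int (nat (j - i))" "nat (j - i) < n" by auto
      then show "s \<in> (\<lambda>k. t (i + int k)) ` {..<n}" using j by (metis image_eqI lessThan_iff)
    qed
    show "\<forall>s\<in>(\<lambda>k. t (i + int k)) ` {..<n} - range t \<inter> tf_support \<phi>. jump g s * tf_apply \<phi> s = 0"
      using outside_fun_support[of _ "tf_apply \<phi>"] by auto
  qed simp
  also have "\<dots> = (\<Sum>k<n. jump g (t (i + int k)) * tf_apply \<phi> (t (i + int k)))"
    by (rule sum.reindex[unfolded o_def])
      (simp add: inj_on_def strict_mono_eq[OF mono])
  also have "\<dots> = (\<Sum>k<n. ?G (i + int k) (t (i + int k)) - ?G (i + int k - 1) (t (i + int k)))"
    by (simp add: jump_def piece_breakpoint left_diff_distrib)
  finally have jumps: "(\<Sum>s\<in>range t \<inter> tf_support \<phi>. jump g s * tf_apply \<phi> s) = \<dots>" .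
  show ?thesis
    unfolding reg reg' jumps sum_subtractf[of _ ?I] sum_jumps[of ?G i n] ends by simp
qed

end

section \<open>Calculus of regular and impulsive parts\<close>

text \<open>Fixing only the regular part is enough, since the impulses can be recovered by \<open>impulsive_part\<close>
and no representation has to be carried along.\<close>

definition has_regular_part :: "functional \<Rightarrow> (real \<Rightarrow> real) \<Rightarrow> bool" where
  "has_regular_part D f \<longleftrightarrow> (\<exists>T \<Delta>. pw_data f T \<Delta> \<and> D = pw_dist f T \<Delta>)"

lemma impulsive_part_point_impulse: "has_regular_part D f \<Longrightarrow> impulsive_part D t \<in> point_impulses t"
  unfolding has_regular_part_def using impulsive_part_pw_dist impulse_at_point_impulse by metis

lemma regular_part_lincomb:
  assumes "has_regular_part D f" "has_regular_part D' g"
  shows "has_regular_part (\<lambda>\<phi>. a * D \<phi> + b * D' \<phi>) (\<lambda>x. a * f x + b * g x)"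
    and "impulsive_part (\<lambda>\<phi>. a * D \<phi> + b * D' \<phi>) t =
      (\<lambda>\<phi>. a * impulsive_part D t \<phi> + b * impulsive_part D' t \<phi>)"
proof -
  from assms obtain T \<Delta> U \<Gamma> where D: "pw_data f T \<Delta>" "D = pw_dist f T \<Delta>"
    and D': "pw_data g U \<Gamma>" "D' = pw_dist g U \<Gamma>" by (auto simp: has_regular_part_def)
  note l = pw_lincomb[OF D(1) D'(1), of a b, folded D(2) D'(2)]
  show "has_regular_part (\<lambda>\<phi>. a * D \<phi> + b * D' \<phi>) (\<lambda>x. a * f x + b * g x)"
    using l(1) l(2)[symmetric] unfolding has_regular_part_def by blast
  show "impulsive_part (\<lambda>\<phi>. a * D \<phi> + b * D' \<phi>) t =
      (\<lambda>\<phi>. a * impulsive_part D t \<phi> + b * impulsive_part D' t \<phi>)"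
    unfolding l(2)[symmetric] impulsive_part_pw_dist[OF l(1)]
    unfolding D(2) D'(2) impulsive_part_pw_dist[OF D(1)] impulsive_part_pw_dist[OF D'(1)]
    by (auto simp: impulse_at_def)
qed

lemma regular_part_zero:
  shows "has_regular_part (\<lambda>_. 0) (\<lambda>_. 0)" and "impulsive_part (\<lambda>_. 0) t = (\<lambda>_. 0)"
proof -
  have d: "pw_data (\<lambda>_. 0) {} (\<lambda>_ _. 0)"
    by (simp add: pw_data_def finite_imp_locally_finite smooth_imp_piecewise_smooth smooth_zero)
  have e: "pw_dist (\<lambda>_. 0) {} (\<lambda>_ _. 0) = (\<lambda>_. 0)"
    by (simp add: pw_dist_def regular_dist_def fun_eq_iff)
  show "has_regular_part (\<lambda>_. 0) (\<lambda>_. 0)"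
    unfolding has_regular_part_def using d e by metis
  show "impulsive_part (\<lambda>_. 0) t = (\<lambda>_. 0)"
    using impulsive_part_pw_dist[OF d, of t] unfolding e by (simp add: impulse_at_def)
qed

lemma regular_part_sum:
  assumes "finite J" "\<And>j. j \<in> J \<Longrightarrow> has_regular_part (D j) (f j)"
  shows "has_regular_part (\<lambda>\<phi>. \<Sum>j\<in>J. c j * D j \<phi>) (\<lambda>x. \<Sum>j\<in>J. c j * f j x) \<and>
    (\<forall>t. impulsive_part (\<lambda>\<phi>. \<Sum>j\<in>J. c j * D j \<phi>) t = (\<lambda>\<phi>. \<Sum>j\<in>J. c j * impulsive_part (D j) t \<phi>))"
  using assms
proof (induction J rule: finite_induct)
  case empty
  then show ?case by (simp add: regular_part_zero)
next
  case (insert j J)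
  have j: "has_regular_part (D j) (f j)"
    and IH: "has_regular_part (\<lambda>\<phi>. \<Sum>j\<in>J. c j * D j \<phi>) (\<lambda>x. \<Sum>j\<in>J. c j * f j x)"
      "\<forall>t. impulsive_part (\<lambda>\<phi>. \<Sum>j\<in>J. c j * D j \<phi>) t = (\<lambda>\<phi>. \<Sum>j\<in>J. c j * impulsive_part (D j) t \<phi>)"
    using insert by auto
  show ?case
    using regular_part_lincomb[OF j IH(1), of "c j" 1] IH(2) insert.hyps by simp
qed

lemma dist_restrict_eq_iff:
  assumes "has_regular_part D f" "has_regular_part D' g"
  shows "dist_restrict {0..} D = dist_restrict {0..} D' \<longleftrightarrow>
    (\<forall>x\<ge>0. f x = g x) \<and> (\<forall>t\<ge>0. impulsive_part D t = impulsive_part D' t)"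
proof -
  from assms obtain T \<Delta> U \<Gamma> where D: "pw_data f T \<Delta>" "D = pw_dist f T \<Delta>"
    and D': "pw_data g U \<Gamma>" "D' = pw_dist g U \<Gamma>" by (auto simp: has_regular_part_def)
  note r = pw_data_restrict[OF D(1), of 0] and r' = pw_data_restrict[OF D'(1), of 0]
  have imp: "impulse_at (V \<inter> {0..}) \<Theta> t = (if t \<ge> 0 then impulse_at V \<Theta> t else (\<lambda>_. 0))" for V \<Theta> t
    by (auto simp: impulse_at_def)
  have "dist_restrict {0..} D = dist_restrict {0..} D' \<longleftrightarrow>
      (\<lambda>x. indicator {0..} x * f x) = (\<lambda>x. indicator {0..} x * g x) \<and>
      impulse_at (T \<inter> {0..}) \<Delta> = impulse_at (U \<inter> {0..}) \<Gamma>"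
    unfolding D(2) D'(2) dist_restrict_pw_dist[OF D(1)] dist_restrict_pw_dist[OF D'(1)]
  proof (intro iffI conjI)
    assume *: "(\<lambda>x. indicator {0..} x * f x) = (\<lambda>x. indicator {0..} x * g x) \<and>
      impulse_at (T \<inter> {0..}) \<Delta> = impulse_at (U \<inter> {0..}) \<Gamma>"
    show "pw_dist (\<lambda>x. indicator {0..} x * f x) (T \<inter> {0..}) \<Delta> =
      pw_dist (\<lambda>x. indicator {0..} x * g x) (U \<inter> {0..}) \<Gamma>"
      using pw_dist_cong[OF r r'[folded conjunct1[OF *]] conjunct2[OF *]] conjunct1[OF *] by simp
  qed (use pw_dist_unique[OF r r'] in blast)+
  also have "(\<lambda>x. indicator {0..} x * f x) = (\<lambda>x. indicator {0..} x * g x) \<longleftrightarrow> (\<forall>x\<ge>0. f x = g x)"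
    by (auto simp: fun_eq_iff indicator_def)
  also have "impulse_at (T \<inter> {0..}) \<Delta> = impulse_at (U \<inter> {0..}) \<Gamma> \<longleftrightarrow>
      (\<forall>t\<ge>0. impulsive_part D t = impulsive_part D' t)"
    unfolding D(2) D'(2) impulsive_part_pw_dist[OF D(1)] impulsive_part_pw_dist[OF D'(1)]
    unfolding fun_eq_iff[of "impulse_at (T \<inter> {0..}) \<Delta>"] imp by auto
  finally show ?thesis .
qed

text \<open>The number \<open>c s\<close> is the jump of the regular part at \<open>s\<close>. It is arbitrary when a descent sequence
is extracted from a trajectory; its value and the regular part of the derivative are needed for
the trajectory constructed from a descent sequence, whose regular part is constant on both sides
of the origin.\<close>

lemma regular_part_dist_deriv:
  assumes "has_regular_part D f"
  obtains f' c where "has_regular_part (dist_deriv D) f'"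
    and "\<And>x b. x < b \<Longrightarrow> (\<And>y. y \<in> {x..<b} \<Longrightarrow> f y = 0) \<Longrightarrow> f' x = 0"
    and "\<And>s. impulsive_part (dist_deriv D) s = (\<lambda>\<phi>. c s * dirac s \<phi> + dist_deriv (impulsive_part D s) \<phi>)"
    and "\<And>s a v. a < s \<Longrightarrow> (\<And>y. y \<in> {a<..<s} \<Longrightarrow> f y = v) \<Longrightarrow> c s = f s - v"
proof -
  from assms obtain T \<Delta> where D: "pw_data f T \<Delta>" "D = pw_dist f T \<Delta>"
    by (auto simp: has_regular_part_def)
  then have f: "piecewise_smooth f" and T: "locally_finite T" by (auto simp: pw_data_def)
  obtain t g where t: "breakpoints t" and g: "\<And>i. smooth (g i)"
    and fg: "\<And>i x. x \<in> {t i..<t (i + 1)} \<Longrightarrow> f x = g i x"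
    using f unfolding piecewise_smooth_iff_breakpoints by blast
  interpret breakpoints t by (rule t)
  define f' where "f' x = deriv (g (piece x)) x" for x
  define U where "U = range t \<union> T"
  define \<Gamma> where "\<Gamma> s \<phi> = jump g s * dirac s \<phi> + 1 * dist_deriv (impulse_at T \<Delta> s) \<phi>" for s \<phi>
  have lfU: "locally_finite U" unfolding U_def using lf T by (rule locally_finite_Un)
  have "piecewise_smooth f'"
    unfolding piecewise_smooth_iff_breakpoints
    by (intro exI[of _ t] exI[of _ "\<lambda>i. deriv (g i)"] conjI t allI ballI smooth_deriv g)
      (use piece_eq in \<open>simp add: f'_def\<close>)
  moreover have "\<Gamma> s \<in> point_impulses s" for s
    unfolding \<Gamma>_def[abs_def]
    by (intro point_impulses_lincomb dirac_in_point_impulses point_impulses_dist_deriv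
        impulse_at_point_impulse[OF D(1)])
  ultimately have data: "pw_data f' U \<Gamma>" using lfU by (simp add: pw_data_def)
  have eq: "dist_deriv D = pw_dist f' U \<Gamma>"
  proof
    fix \<phi>
    have "(\<Sum>s\<in>U \<inter> tf_support (tf_deriv \<phi>). impulse_at T \<Delta> s (tf_deriv \<phi>)) =
        (\<Sum>s\<in>U \<inter> tf_support \<phi>. impulse_at T \<Delta> s (tf_deriv \<phi>))"
      using tf_deriv_support[of \<phi>] point_impulse_outside_support[OF impulse_at_point_impulse[OF D(1)]]
      by (intro sum.mono_neutral_left finite_Int_support lfU) auto
    moreover have "T \<subseteq> U" by (simp add: U_def)
    moreover have "dist_deriv D \<phi> = - pw_dist f T \<Delta> (tf_deriv \<phi>)"
      by (simp add: dist_deriv_def D(2))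
    ultimately have *: "dist_deriv D \<phi> =
        - regular_dist f (tf_deriv \<phi>) - (\<Sum>s\<in>U \<inter> tf_support \<phi>. impulse_at T \<Delta> s (tf_deriv \<phi>))"
      using pw_dist_enlarge[OF lfU, of T f \<Delta> "tf_deriv \<phi>"] by simp
    have "(\<Sum>s\<in>range t \<inter> tf_support \<phi>. jump g s * tf_apply \<phi> s) =
        (\<Sum>s\<in>U \<inter> tf_support \<phi>. jump g s * tf_apply \<phi> s)"
      by (intro sum.mono_neutral_left finite_Int_support lfU) (auto simp: U_def jump_def)
    note ** = regular_dist_deriv[where g = g and f = f, OF g fg, of \<phi>, unfolded this]
    show "dist_deriv D \<phi> = pw_dist f' U \<Gamma> \<phi>"
      using ** unfolding * pw_dist_def f'_def[abs_def] \<Gamma>_def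
      by (simp add: dirac_def dist_deriv_def[of "impulse_at T \<Delta> _"] sum_subtractf)
  qed
  show thesis
  proof (rule that[of f' "jump g"])
    show "has_regular_part (dist_deriv D) f'"
      using data eq unfolding has_regular_part_def by blast
    show "impulsive_part (dist_deriv D) s =
        (\<lambda>\<phi>. jump g s * dirac s \<phi> + dist_deriv (impulsive_part D s) \<phi>)" for s
    proof -
      have "impulsive_part (dist_deriv D) s = impulse_at U \<Gamma> s"
        unfolding eq by (rule impulsive_part_pw_dist[OF data])
      moreover have "impulsive_part D s = impulse_at T \<Delta> s"
        unfolding D(2) by (rule impulsive_part_pw_dist[OF D(1)])
      ultimately show ?thesis
        by (auto simp: \<Gamma>_def U_def jump_def impulse_at_def dist_deriv_def fun_eq_iff)
    qed
    show "f' x = 0" if xb: "x < b" and zero: "\<And>y. y \<in> {x..<b} \<Longrightarrow> f y = 0" for x b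
    proof -
      let ?j = "piece x"
      have x: "t ?j \<le> x" "x < t (?j + 1)" using in_piece[of x] by auto
      have "g ?j y = 0" if "y \<in> {x..<min b (t (?j + 1))}" for y
        using fg[of y ?j] zero[of y] that x by auto
      then show ?thesis
        unfolding f'_def using x xb
        by (intro right_deriv_zero[OF smooth_DERIV[OF g], of x "min b (t (?j + 1))"]) auto
    qed
    show "jump g s = f s - v" if as: "a < s" and v: "\<And>y. y \<in> {a<..<s} \<Longrightarrow> f y = v" for s a v
    proof -
      let ?j = "piece s"
      have s: "t ?j \<le> s" "s < t (?j + 1)" using in_piece[of s] by auto
      have fs: "f s = g ?j s" using fg[OF in_piece] .
      have left: "g i s = v" if "t i < s" "s \<le> t (i + 1)" for i
      proof (rule left_value[OF smooth_continuous[OF g]])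
        show "max a (t i) < s" using that as by simp
        show "g i y = v" if "y \<in> {max a (t i)<..<s}" for y
          using v[of y] fg[of y i] that \<open>s \<le> t (i + 1)\<close> by auto
      qed
      show ?thesis
      proof (cases "s \<in> range t")
        case True
        then have "s = t ?j" using piece_breakpoint by auto
        then have "g (?j - 1) s = v"
          using strict_mono_less[OF mono, of "?j - 1" ?j] by (intro left) auto
        then show ?thesis using True fs by (simp add: jump_def)
      next
        case False
        then have "t ?j < s" using s(1) by (metis order_le_less rangeI)
        then have "g ?j s = v" using s by (intro left) auto
        then show ?thesis using False fs by (simp add: jump_def)
      qed
    qed
  qed
qed

section \<open>Continuity of piecewise-smooth distributions\<close>

lemma pw_dist_on_interval:
  assumes data: "pw_data f T \<Delta>" and supp: "tf_support \<phi> \<subseteq> {a..b}"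
  shows "pw_dist f T \<Delta> \<phi> = regular_dist f \<phi> + (\<Sum>s\<in>T \<inter> {a..b}. \<Delta> s \<phi>)"
proof -
  have "finite (T \<inter> {a..b})" using data by (auto simp: pw_data_def locally_finite_def)
  then have "(\<Sum>s\<in>T \<inter> tf_support \<phi>. \<Delta> s \<phi>) = (\<Sum>s\<in>T \<inter> {a..b}. \<Delta> s \<phi>)"
    using supp data point_impulse_outside_support[of "\<Delta> _" _ \<phi>]
    by (intro sum.mono_neutral_left) (auto simp: pw_data_def)
  then show ?thesis by (simp add: pw_dist_def)
qed

lemma point_impulse_lincomb_arg:
  assumes "D \<in> point_impulses t"
  shows "D (a *\<^sub>R \<phi> + b *\<^sub>R \<psi>) = a * D \<phi> + b * D \<psi>"
proof -
  have "(deriv ^^ i) (tf_apply (a *\<^sub>R \<phi> + b *\<^sub>R \<psi>)) t =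
      a * (deriv ^^ i) (tf_apply \<phi>) t + b * (deriv ^^ i) (tf_apply \<psi>) t" for i
    using higher_deriv_lincomb[OF tf_smooth[of \<phi>] tf_smooth[of \<psi>], of i a b]
    by (simp add: plus_test_fun.rep_eq scaleR_test_fun.rep_eq)
  then show ?thesis
    using assms
    by (auto simp: point_impulses_def dirac_higher_deriv sum_distrib_left sum.distrib algebra_simps)
qed

lemma regular_dist_lincomb_arg:
  assumes "piecewise_smooth f"
  shows "regular_dist f (a *\<^sub>R \<phi> + b *\<^sub>R \<psi>) = a * regular_dist f \<phi> + b * regular_dist f \<psi>"
proof -
  have "regular_dist f (a *\<^sub>R \<phi> + b *\<^sub>R \<psi>) =
      (LINT x|lborel. a * (f x * tf_apply \<phi> x) + b * (f x * tf_apply \<psi> x))"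
    by (simp add: regular_dist_def plus_test_fun.rep_eq scaleR_test_fun.rep_eq algebra_simps)
  also have "\<dots> = a * regular_dist f \<phi> + b * regular_dist f \<psi>"
    using regular_dist_integrable[OF assms] by (simp add: regular_dist_def)
  finally show ?thesis .
qed

lemma pw_dist_lincomb_arg:
  assumes data: "pw_data f T \<Delta>"
  shows "pw_dist f T \<Delta> (a *\<^sub>R \<phi> + b *\<^sub>R \<psi>) = a * pw_dist f T \<Delta> \<phi> + b * pw_dist f T \<Delta> \<psi>"
proof -
  let ?\<chi> = "a *\<^sub>R \<phi> + b *\<^sub>R \<psi>"
  have "compact (tf_support \<phi> \<union> tf_support \<psi> \<union> tf_support ?\<chi>)"
    using tf_compact by (intro compact_Un)
  then obtain c where "tf_support \<phi> \<union> tf_support \<psi> \<union> tf_support ?\<chi> \<subseteq> cbox (- c) c"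
    using bounded_subset_cbox_symmetric[OF compact_imp_bounded] by blast
  then have "tf_support \<phi> \<subseteq> {- c..c}" "tf_support \<psi> \<subseteq> {- c..c}" "tf_support ?\<chi> \<subseteq> {- c..c}"
    by auto
  note on = this[THEN pw_dist_on_interval[OF data]]
  have "(\<Sum>s\<in>T \<inter> {- c..c}. \<Delta> s ?\<chi>) = (\<Sum>s\<in>T \<inter> {- c..c}. a * \<Delta> s \<phi> + b * \<Delta> s \<psi>)"
    using data by (intro sum.cong refl point_impulse_lincomb_arg) (auto simp: pw_data_def)
  moreover have "piecewise_smooth f" using data by (simp add: pw_data_def)
  ultimately show ?thesis
    unfolding on by (simp add: regular_dist_lincomb_arg sum.distrib sum_distrib_left distrib_left)
qed

text \<open>On the common support the values are bounded by the supremum of the test functions times the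
integral of \<open>\<bar>f\<bar>\<close>.\<close>

lemma regular_dist_null_sequence:
  assumes f: "piecewise_smooth f" and supp: "\<And>j. tf_support (\<phi> j) \<subseteq> {a..b}"
    and lim: "uniform_limit UNIV (\<lambda>j. tf_apply (\<phi> j)) (\<lambda>_. 0) sequentially"
  shows "(\<lambda>j. regular_dist f (\<phi> j)) \<longlonglongrightarrow> 0"
proof (rule tendstoI)
  fix e :: real assume "e > 0"
  define I where "I = (LINT x|lborel. \<bar>f x * indicator {a..b} x\<bar>)"
  have int: "integrable lborel (\<lambda>x. \<bar>f x * indicator {a..b} x\<bar>)"
    using piecewise_smooth_local_integrable[OF f] by (rule integrable_abs)
  have "I \<ge> 0" unfolding I_def by simp
  define \<delta> where "\<delta> = e / (I + 1)"
  have "\<delta> > 0" using \<open>e > 0\<close> \<open>I \<ge> 0\<close> by (simp add: \<delta>_def)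
  have "\<delta> * I < e" using \<open>e > 0\<close> \<open>I \<ge> 0\<close> by (simp add: \<delta>_def field_simps)
  have "\<forall>\<^sub>F j in sequentially. \<forall>x\<in>UNIV. dist (tf_apply (\<phi> j) x) 0 < \<delta>"
    using uniform_limitD[OF lim \<open>\<delta> > 0\<close>] .
  then show "\<forall>\<^sub>F j in sequentially. dist (regular_dist f (\<phi> j)) 0 < e"
  proof eventually_elim
    case (elim j)
    have "norm (regular_dist f (\<phi> j)) \<le> (LINT x|lborel. norm (f x * tf_apply (\<phi> j) x))"
      unfolding regular_dist_def by (rule integral_norm_bound)
    also have "\<dots> \<le> (LINT x|lborel. \<delta> * \<bar>f x * indicator {a..b} x\<bar>)"
    proof (rule integral_mono)
      show "integrable lborel (\<lambda>x. norm (f x * tf_apply (\<phi> j) x))"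
        using regular_dist_integrable[OF f] by (rule integrable_norm)
      show "integrable lborel (\<lambda>x. \<delta> * \<bar>f x * indicator {a..b} x\<bar>)" using int by simp
      show "norm (f x * tf_apply (\<phi> j) x) \<le> \<delta> * \<bar>f x * indicator {a..b} x\<bar>" for x
      proof (cases "x \<in> {a..b}")
        case True
        have "\<bar>tf_apply (\<phi> j) x\<bar> \<le> \<delta>" using elim by (simp add: less_imp_le)
        then show ?thesis
          using True mult_left_mono[of "\<bar>tf_apply (\<phi> j) x\<bar>" \<delta> "\<bar>f x\<bar>"] by (simp add: abs_mult mult.commute)
      next
        case False
        then have "x \<notin> tf_support (\<phi> j)" using supp by blast
        then show ?thesis using outside_fun_support[of x "tf_apply (\<phi> j)"] \<open>\<delta> > 0\<close> by simp
      qed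
    qed
    also have "\<dots> = \<delta> * I" by (simp add: I_def)
    also have "\<dots> < e" by fact
    finally show ?case by simp
  qed
qed

text \<open>Membership in \<open>pw_distributions\<close> thereby reduces to having a representation, which makes it
obvious for linear combinations.\<close>

lemma pw_dist_in_distributions:
  assumes data: "pw_data f T \<Delta>"
  shows "pw_dist f T \<Delta> \<in> distributions"
  unfolding distributions_def
proof (intro CollectI conjI allI impI)
  show "linear (pw_dist f T \<Delta>)"
  proof (rule linearI)
    show "pw_dist f T \<Delta> (\<phi> + \<psi>) = pw_dist f T \<Delta> \<phi> + pw_dist f T \<Delta> \<psi>" for \<phi> \<psi>
      using pw_dist_lincomb_arg[OF data, of 1 \<phi> 1 \<psi>] by simp
    show "pw_dist f T \<Delta> (r *\<^sub>R \<phi>) = r *\<^sub>R pw_dist f T \<Delta> \<phi>" for r \<phi>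
      using pw_dist_lincomb_arg[OF data, of r \<phi> 0 \<phi>] by simp
  qed
  fix \<phi> assume "tf_null_sequence \<phi>"
  then obtain K where K: "compact K" "\<And>j. tf_support (\<phi> j) \<subseteq> K"
    and lim: "\<And>k. uniform_limit UNIV (\<lambda>j. (deriv ^^ k) (tf_apply (\<phi> j))) (\<lambda>_. 0) sequentially"
    by (auto simp: tf_null_sequence_def)
  obtain c where "K \<subseteq> cbox (- c) c"
    using bounded_subset_cbox_symmetric[OF compact_imp_bounded[OF K(1)]] by blast
  then have supp: "tf_support (\<phi> j) \<subseteq> {- c..c}" for j using K(2)[of j] by auto
  have "(\<lambda>j. \<Delta> s (\<phi> j)) \<longlonglongrightarrow> 0" if "s \<in> T \<inter> {- c..c}" for s
  proof -
    have "\<Delta> s \<in> point_impulses s" using data that by (simp add: pw_data_def)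
    then obtain N b where \<Delta>: "\<Delta> s = (\<lambda>\<phi>. \<Sum>i\<le>N. b i * (dist_deriv ^^ i) (dirac s) \<phi>)"
      by (auto simp: point_impulses_def)
    have "(\<lambda>j. (deriv ^^ k) (tf_apply (\<phi> j)) s) \<longlonglongrightarrow> 0" for k
      using tendsto_uniform_limitI[OF lim] by blast
    then show ?thesis
      unfolding \<Delta> dirac_higher_deriv by (intro tendsto_null_sum tendsto_mult_right_zero)
  qed
  moreover have "(\<lambda>j. regular_dist f (\<phi> j)) \<longlonglongrightarrow> 0"
    using data lim[of 0] supp by (intro regular_dist_null_sequence[of f \<phi> "- c" c]) (auto simp: pw_data_def)
  ultimately have "(\<lambda>j. regular_dist f (\<phi> j) + (\<Sum>s\<in>T \<inter> {- c..c}. \<Delta> s (\<phi> j))) \<longlonglongrightarrow> 0 + 0"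
    by (intro tendsto_add tendsto_null_sum)
  then show "(\<lambda>j. pw_dist f T \<Delta> (\<phi> j)) \<longlonglongrightarrow> 0"
    unfolding pw_dist_on_interval[OF data supp] by simp
qed

lemma pw_distributions_iff: "D \<in> pw_distributions \<longleftrightarrow> (\<exists>f. has_regular_part D f)"
  using pw_dist_in_distributions unfolding pw_distributions_def has_regular_part_def by blast

section \<open>Coefficients of impulses\<close>

definition dirac_comb :: "real \<Rightarrow> nat \<Rightarrow> (nat \<Rightarrow> real) \<Rightarrow> functional" where
  "dirac_comb t N c = (\<lambda>\<phi>. \<Sum>i\<le>N. c i * (dist_deriv ^^ i) (dirac t) \<phi>)"

lemma dirac_comb_eq_iff:
  "dirac_comb t N c = dirac_comb t N d \<longleftrightarrow> (\<forall>i\<le>N. c i = d i)"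
proof (intro iffI allI impI)
  fix k assume eq: "dirac_comb t N c = dirac_comb t N d" and k: "k \<le> N"
  have "(\<Sum>i\<le>N. (c i - d i) * (dist_deriv ^^ i) (dirac t) \<phi>) = 0" for \<phi>
    using fun_cong[OF eq, of \<phi>] by (simp add: dirac_comb_def left_diff_distrib sum_subtractf)
  from dirac_derivs_independent[where e = 1 and c = "\<lambda>i. c i - d i", OF _ this k]
  show "c k = d k" by simp
qed (simp add: dirac_comb_def)

lemma dirac_comb_eq_zero_iff: "dirac_comb t N c = (\<lambda>_. 0) \<longleftrightarrow> (\<forall>i\<le>N. c i = 0)"
  using dirac_comb_eq_iff[of t N c "\<lambda>_. 0"] by (simp add: dirac_comb_def)

lemma sum_dirac_comb:
  fixes n :: nat
  assumes "\<And>j. j < n \<Longrightarrow> D j = dirac_comb t N (c j)"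
  shows "(\<lambda>\<phi>. \<Sum>j<n. w j * D j \<phi>) = dirac_comb t N (\<lambda>i. \<Sum>j<n. w j * c j i)"
proof
  fix \<phi>
  have "(\<Sum>j<n. w j * D j \<phi>) = (\<Sum>j<n. \<Sum>i\<le>N. w j * c j i * (dist_deriv ^^ i) (dirac t) \<phi>)"
    by (intro sum.cong refl) (simp add: assms dirac_comb_def sum_distrib_left mult.assoc)
  also have "\<dots> = (\<Sum>i\<le>N. \<Sum>j<n. w j * c j i * (dist_deriv ^^ i) (dirac t) \<phi>)"
    by (rule sum.swap)
  finally show "(\<Sum>j<n. w j * D j \<phi>) = dirac_comb t N (\<lambda>i. \<Sum>j<n. w j * c j i) \<phi>"
    by (simp add: dirac_comb_def sum_distrib_right)
qed

text \<open>Differentiation shifts the coefficients by one, and the jump \<open>d\<close> takes the place that becomes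
free. This shift is the source of the index shift in \<open>descent\<close>.\<close>

lemma dirac_plus_deriv_dirac_comb:
  "(\<lambda>\<phi>. d * dirac t \<phi> + dist_deriv (dirac_comb t N c) \<phi>) = dirac_comb t (Suc N) (case_nat d c)"
  unfolding dirac_comb_def dist_deriv_sum by (subst sum.atMost_Suc_shift) simp

lemma dirac_comb_Suc: "c (Suc N) = 0 \<Longrightarrow> dirac_comb t (Suc N) c = dirac_comb t N c"
  by (simp add: dirac_comb_def)

lemma impulsive_parts_coefficients:
  fixes n :: nat
  assumes "\<And>j. j < n \<Longrightarrow> has_regular_part (D j) (f j)"
  obtains N c where "\<And>j i. j < n \<Longrightarrow> i > N \<Longrightarrow> c j i = 0"
    "\<And>j. j < n \<Longrightarrow> impulsive_part (D j) t = dirac_comb t N (c j)"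
proof -
  have "\<exists>N c. (\<forall>i>N. c i = 0) \<and> (\<forall>M\<ge>N. impulsive_part (D j) t = dirac_comb t M c)" if j: "j < n" for j
  proof -
    obtain N c where "\<And>i. i > N \<Longrightarrow> c i = 0"
      "\<And>M. M \<ge> N \<Longrightarrow> impulsive_part (D j) t = (\<lambda>\<phi>. \<Sum>i\<le>M. c i * (dist_deriv ^^ i) (dirac t) \<phi>)"
      using point_impulsesE[OF impulsive_part_point_impulse[OF assms[OF j], of t]] by blast
    then show ?thesis unfolding dirac_comb_def by blast
  qed
  then obtain N c where Nc: "\<And>j i. j < n \<Longrightarrow> i > N j \<Longrightarrow> c j i = 0"
    "\<And>j M. j < n \<Longrightarrow> M \<ge> N j \<Longrightarrow> impulsive_part (D j) t = dirac_comb t M (c j)"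
    by metis
  have le: "N j \<le> (\<Sum>j<n. N j)" if "j < n" for j
    using that by (intro member_le_sum) auto
  show thesis
  proof (rule that[of "\<Sum>j<n. N j" c])
    show "c j i = 0" if "j < n" "(\<Sum>j<n. N j) < i" for j i
      using Nc(1)[OF that(1)] le[OF that(1)] that(2) by simp
    show "impulsive_part (D j) t = dirac_comb t (\<Sum>j<n. N j) (c j)" if "j < n" for j
      using Nc(2)[OF that le[OF that]] .
  qed
qed

section \<open>Impulses in the behavior\<close>

lemma mult_mat_vec_index_sum:
  fixes M :: "real mat"
  assumes "M \<in> carrier_mat k n" "v \<in> carrier_vec n" "i < k"
  shows "(M *\<^sub>v v) $ i = (\<Sum>j<n. M $$ (i, j) * v $ j)"
  using assms by (simp add: scalar_prod_def lessThan_atLeast0)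

lemma mat_mult_dist_index:
  assumes "M \<in> carrier_mat k n" "i < k"
  shows "mat_mult_dist M x $ i = (\<lambda>\<phi>. \<Sum>j<n. M $$ (i, j) * (x $ j) \<phi>)"
  using assms by (simp add: mat_mult_dist_def)

lemma mat_mult_dist_parts:
  assumes "M \<in> carrier_mat k n" "i < k" "\<And>j. j < n \<Longrightarrow> has_regular_part (x $ j) (f j)"
  shows "has_regular_part (mat_mult_dist M x $ i) (\<lambda>s. \<Sum>j<n. M $$ (i, j) * f j s)"
    and "impulsive_part (mat_mult_dist M x $ i) t = (\<lambda>\<phi>. \<Sum>j<n. M $$ (i, j) * impulsive_part (x $ j) t \<phi>)"
proof -
  have parts: "has_regular_part (x $ j) (f j)" if "j \<in> {..<n}" for j
    using assms(3) that by simp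
  have sum: "has_regular_part (mat_mult_dist M x $ i) (\<lambda>s. \<Sum>j<n. M $$ (i, j) * f j s) \<and>
      (\<forall>t. impulsive_part (mat_mult_dist M x $ i) t =
        (\<lambda>\<phi>. \<Sum>j<n. M $$ (i, j) * impulsive_part (x $ j) t \<phi>))"
    unfolding mat_mult_dist_index[OF assms(1,2)]
    by (rule regular_part_sum[where D = "\<lambda>j. x $ j" and c = "\<lambda>j. M $$ (i, j)", OF finite_lessThan parts])
  then show "has_regular_part (mat_mult_dist M x $ i) (\<lambda>s. \<Sum>j<n. M $$ (i, j) * f j s)"
    by (rule conjunct1)
  show "impulsive_part (mat_mult_dist M x $ i) t =
      (\<lambda>\<phi>. \<Sum>j<n. M $$ (i, j) * impulsive_part (x $ j) t \<phi>)"
    by (rule conjunct2[OF sum, THEN spec])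
qed

lemma mat_mult_dist_impulse:
  assumes M: "M \<in> carrier_mat k n" and i: "i < k"
    and f: "\<And>j. j < n \<Longrightarrow> has_regular_part (x $ j) (f j)"
    and comb: "\<And>j. j < n \<Longrightarrow> impulsive_part (x $ j) t = dirac_comb t N (\<lambda>l. u l $ j)"
    and u: "\<And>l. u l \<in> carrier_vec n"
  shows "impulsive_part (mat_mult_dist M x $ i) t = dirac_comb t N (\<lambda>l. (M *\<^sub>v u l) $ i)"
proof -
  have "impulsive_part (mat_mult_dist M x $ i) t = (\<lambda>\<phi>. \<Sum>j<n. M $$ (i, j) * impulsive_part (x $ j) t \<phi>)"
    by (rule mat_mult_dist_parts(2)[where f = f, OF M i f])
  also have "\<dots> = dirac_comb t N (\<lambda>l. \<Sum>j<n. M $$ (i, j) * u l $ j)"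
    by (rule sum_dirac_comb) (rule comb)
  finally show ?thesis unfolding mult_mat_vec_index_sum[OF M u i] .
qed

lemma impulsive_part_eq_if_restrict_eq:
  assumes "has_regular_part D f" "has_regular_part D' g" "dist_restrict {0..} D = dist_restrict {0..} D'" "t \<ge> 0"
  shows "impulsive_part D t = impulsive_part D' t"
  using assms(3,4) unfolding dist_restrict_eq_iff[OF assms(1,2)] by blast

lemma mat_mult_dist_pw_dist_vecs:
  assumes "M \<in> carrier_mat k n" "\<And>j. j < n \<Longrightarrow> has_regular_part (x $ j) (f j)"
  shows "mat_mult_dist M x \<in> pw_dist_vecs k"
proof -
  have "dim_vec (mat_mult_dist M x) = k" using assms(1) by (simp add: mat_mult_dist_def)
  moreover have "mat_mult_dist M x $ i \<in> pw_distributions" if "i < k" for i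
    unfolding pw_distributions_iff
    by (rule exI, rule mat_mult_dist_parts(1)[where f = f, OF assms(1) that assms(2)])
  ultimately show ?thesis
    unfolding pw_dist_vecs_def carrier_vec_def by simp
qed

lemma map_vec_eqD: "map_vec f v = map_vec f w \<Longrightarrow> i < dim_vec v \<Longrightarrow> f (v $ i) = f (w $ i)"
  by (metis index_map_vec)

text \<open>At a fixed time \<open>t\<close>, the vector \<open>u 0\<close> collects the jumps of the components of \<open>x\<close>, and
\<open>u (k + 1)\<close> the coefficients of the \<open>k\<close>-th derivative of the Dirac distribution at \<open>t\<close>.\<close>

lemma observable_if_descents_vanish:
  assumes E: "E \<in> carrier_mat m n" and A: "A \<in> carrier_mat m n"
    and C: "C \<in> carrier_mat p n" and L: "L \<in> carrier_mat r n"
    and vanish: "\<And>l u. descent E A l u \<Longrightarrow> (\<And>i. C *\<^sub>v u (Suc i) = 0\<^sub>v p) \<Longrightarrow> (\<And>i. L *\<^sub>v u (Suc i) = 0\<^sub>v r)"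
  shows "partially_impulse_observable E A C L"
  unfolding partially_impulse_observable_def
proof (intro ballI, clarify)
  fix x y z and t :: real
  assume beh: "(x, y, z) \<in> behavior E A C L" and free: "\<forall>t\<ge>0. impulse_free_at y t" and t: "0 \<le> t"
  have x: "x \<in> pw_dist_vecs n" and y: "y \<in> pw_dist_vecs p" and z: "z \<in> pw_dist_vecs r"
    and Ex: "map_vec (dist_restrict {0..}) (mat_mult_dist E (map_vec dist_deriv x)) =
      map_vec (dist_restrict {0..}) (mat_mult_dist A x)"
    and Cx: "map_vec (dist_restrict {0..}) y = map_vec (dist_restrict {0..}) (mat_mult_dist C x)"
    and Lx: "map_vec (dist_restrict {0..}) z = map_vec (dist_restrict {0..}) (mat_mult_dist L x)"
    using beh E C L by (simp_all add: behavior_def)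
  have dimx: "dim_vec x = n" and dimy: "dim_vec y = p" and dimz: "dim_vec z = r"
    using x y z by (auto simp: pw_dist_vecs_def)
  obtain f where f: "\<And>j. j < n \<Longrightarrow> has_regular_part (x $ j) (f j)"
    using x unfolding pw_dist_vecs_def pw_distributions_iff by (auto, metis)
  have "\<exists>g d. has_regular_part (dist_deriv (x $ j)) g \<and> impulsive_part (dist_deriv (x $ j)) t =
      (\<lambda>\<phi>. d * dirac t \<phi> + dist_deriv (impulsive_part (x $ j) t) \<phi>)" if "j < n" for j
    by (rule regular_part_dist_deriv[OF f[OF that]]) blast
  then obtain g d where g: "\<And>j. j < n \<Longrightarrow> has_regular_part (dist_deriv (x $ j)) (g j)"
    and d: "\<And>j. j < n \<Longrightarrow> impulsive_part (dist_deriv (x $ j)) t =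
      (\<lambda>\<phi>. d j * dirac t \<phi> + dist_deriv (impulsive_part (x $ j) t) \<phi>)"
    by metis
  obtain N c where c0: "\<And>j i. j < n \<Longrightarrow> i > N \<Longrightarrow> c j i = 0"
    and c: "\<And>j. j < n \<Longrightarrow> impulsive_part (x $ j) t = dirac_comb t N (c j)"
    using impulsive_parts_coefficients[where D = "\<lambda>j. x $ j" and f = f and n = n and t = t] f by blast
  \<comment> \<open>The derivative of \<open>x\<close> has impulses of one order more than \<open>x\<close>.\<close>
  let ?K = "Suc N"
  have impx: "impulsive_part (x $ j) t = dirac_comb t ?K (c j)" if "j < n" for j
    using c[OF that] c0[OF that, of "Suc N"] by (simp add: dirac_comb_Suc)
  have impx': "impulsive_part (dist_deriv (x $ j)) t = dirac_comb t ?K (case_nat (d j) (c j))" if "j < n" for j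
    unfolding d[OF that] c[OF that] by (rule dirac_plus_deriv_dirac_comb)
  define u where "u k = Matrix.vec n (\<lambda>j. case_nat (d j) (c j) k)" for k
  have uc: "u k \<in> carrier_vec n" for k by (simp add: u_def)
  have row: "has_regular_part (mat_mult_dist M x $ i) (\<lambda>s. \<Sum>j<n. M $$ (i, j) * f j s)"
    if "M \<in> carrier_mat q n" "i < q" for M q i
    by (rule mat_mult_dist_parts(1)[where f = f, OF that f])
  have impM: "impulsive_part (mat_mult_dist M x $ i) t = dirac_comb t ?K (\<lambda>k. (M *\<^sub>v u (Suc k)) $ i)"
    if M: "M \<in> carrier_mat q n" and i: "i < q" for M q i
    by (rule mat_mult_dist_impulse[where f = f and u = "\<lambda>k. u (Suc k)", OF M i f])
      (simp_all add: impx u_def)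
  have u0: "u k = 0\<^sub>v n" if "k > ?K" for k
    using that c0 by (cases k) (auto simp: u_def)
  have zero: "M *\<^sub>v u (Suc k) = 0\<^sub>v q" if M: "M \<in> carrier_mat q n" and k: "k > N" for M :: "real mat" and q k
    using u0[of "Suc k"] k mat_mult_zero_vec[of M] M by simp
  have g': "has_regular_part (map_vec dist_deriv x $ j) (g j)" if "j < n" for j
    using g[OF that] that dimx by simp
  have rowE: "has_regular_part (mat_mult_dist E (map_vec dist_deriv x) $ i) (\<lambda>s. \<Sum>j<n. E $$ (i, j) * g j s)"
    if "i < m" for i
    by (rule mat_mult_dist_parts(1)[where f = g, OF E that g'])
  have "descent E A (Suc ?K) u"
    unfolding descent_def
  proof (intro conjI allI impI)
    show "u k \<in> carrier_vec (dim_col E)" for k using uc E by simp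
    show "u k = 0\<^sub>v (dim_col E)" if "Suc ?K \<le> k" for k using u0[of k] that E by simp
    show "E *\<^sub>v u k = A *\<^sub>v u (Suc k)" for k
    proof (cases "k \<le> ?K")
      case True
      show ?thesis
      proof (rule eq_vecI)
        fix i assume "i < dim_vec (A *\<^sub>v u (Suc k))"
        then have i: "i < m" using A by simp
        have "dist_restrict {0..} (mat_mult_dist E (map_vec dist_deriv x) $ i) =
            dist_restrict {0..} (mat_mult_dist A x $ i)"
          using map_vec_eqD[OF Ex] i E by (simp add: mat_mult_dist_def)
        then have "impulsive_part (mat_mult_dist E (map_vec dist_deriv x) $ i) t =
            impulsive_part (mat_mult_dist A x $ i) t"
          using t by (rule impulsive_part_eq_if_restrict_eq
              [OF rowE[OF i] row[OF A i]])
        moreover have "impulsive_part (mat_mult_dist E (map_vec dist_deriv x) $ i) t =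
            dirac_comb t ?K (\<lambda>k. (E *\<^sub>v u k) $ i)"
          by (rule mat_mult_dist_impulse[where f = g, OF E i g'])
            (simp_all add: impx' u_def dimx)
        ultimately show "(E *\<^sub>v u k) $ i = (A *\<^sub>v u (Suc k)) $ i"
          using True by (simp add: impM[OF A i] dirac_comb_eq_iff)
      qed (use E A in simp)
    next
      case False
      then have "u k = 0\<^sub>v n" using u0 by simp
      then show ?thesis using zero[OF A, of k] False mat_mult_zero_vec[of E] E by simp
    qed
  qed
  moreover have "C *\<^sub>v u (Suc k) = 0\<^sub>v p" for k
  proof (cases "k \<le> ?K")
    case True
    show ?thesis
    proof (rule eq_vecI)
      fix i assume "i < dim_vec (0\<^sub>v p)"
      then have i: "i < p" by simp
      obtain h where h: "has_regular_part (y $ i) h"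
        using y i unfolding pw_dist_vecs_def pw_distributions_iff by auto
      have "dist_restrict {0..} (y $ i) = dist_restrict {0..} (mat_mult_dist C x $ i)"
        using map_vec_eqD[OF Cx] i dimy by simp
      then have "impulsive_part (y $ i) t = impulsive_part (mat_mult_dist C x $ i) t"
        using t by (rule impulsive_part_eq_if_restrict_eq[OF h row[OF C i]])
      moreover have "impulsive_part (y $ i) t = (\<lambda>_. 0)"
        using free t i dimy by (simp add: impulse_free_at_def)
      ultimately have "impulsive_part (mat_mult_dist C x $ i) t = (\<lambda>_. 0)"
        by (rule trans[OF sym])
      then show "(C *\<^sub>v u (Suc k)) $ i = 0\<^sub>v p $ i"
        using True i unfolding impM[OF C i] dirac_comb_eq_zero_iff by simp
    qed (use C in simp)
  qed (use zero[OF C] in simp)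
  ultimately have Lu: "L *\<^sub>v u (Suc k) = 0\<^sub>v r" for k by (rule vanish)
  show "impulse_free_at z t"
    unfolding impulse_free_at_def
  proof (intro allI impI)
    fix i assume "i < dim_vec z"
    then have i: "i < r" using dimz by simp
    obtain h where h: "has_regular_part (z $ i) h"
      using z i unfolding pw_dist_vecs_def pw_distributions_iff by auto
    have "dist_restrict {0..} (z $ i) = dist_restrict {0..} (mat_mult_dist L x $ i)"
      using map_vec_eqD[OF Lx] i dimz by simp
    then have "impulsive_part (z $ i) t = impulsive_part (mat_mult_dist L x $ i) t"
      using t by (rule impulsive_part_eq_if_restrict_eq[OF h row[OF L i]])
    also have "\<dots> = (\<lambda>_. 0)" unfolding impM[OF L i] dirac_comb_eq_zero_iff Lu using i by simp
    finally show "impulsive_part (z $ i) t = (\<lambda>_. 0)" .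
  qed
qed

text \<open>The component \<open>j\<close> of the trajectory has the regular part \<open>f j\<close>, which is \<open>- u 0 $ j\<close> to the left
of the origin and \<open>0\<close> to the right, so that its jump at \<open>0\<close> is \<open>u 0 $ j\<close>. The impulses at \<open>0\<close>
have the coefficients \<open>u 1, u 2, \<dots>\<close>.\<close>

lemma descents_vanish_if_observable:
  assumes E: "E \<in> carrier_mat m n" and A: "A \<in> carrier_mat m n"
    and C: "C \<in> carrier_mat p n" and L: "L \<in> carrier_mat r n"
    and obs: "partially_impulse_observable E A C L"
    and u: "descent E A l u" and Cu: "\<And>i. C *\<^sub>v u (Suc i) = 0\<^sub>v p"
  shows "L *\<^sub>v u (Suc i) = 0\<^sub>v r"
proof -
  have uc: "u k \<in> carrier_vec n" and EA: "E *\<^sub>v u k = A *\<^sub>v u (Suc k)" for k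
    using u E by (auto simp: descent_def)
  have u0: "u k = 0\<^sub>v n" if "k \<ge> l" for k using u E that by (auto simp: descent_def)
  \<comment> \<open>The step function is written as a linear combination of a constant and a restricted
    constant, so that its piecewise smoothness follows from the closure properties.\<close>
  define f where "f j s = - (u 0 $ j) * 1 + u 0 $ j * (indicator {0..} s * 1)" for j and s :: real
  define X where "X j = pw_dist (f j) {0} (\<lambda>t. dirac_comb t l (\<lambda>k. u (Suc k) $ j))" for j
  define x where "x = Matrix.vec n X"
  have data: "pw_data (f j) {0} (\<lambda>t. dirac_comb t l (\<lambda>k. u (Suc k) $ j))" for j
    unfolding pw_data_def f_def
    by (intro conjI piecewise_smooth_lincomb piecewise_smooth_restrict smooth_imp_piecewise_smooth smooth_const)
      (auto simp: finite_imp_locally_finite dirac_comb_def point_impulses_def)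
  have fX: "has_regular_part (X j) (f j)" for j
    using data unfolding has_regular_part_def X_def by blast
  have f: "has_regular_part (x $ j) (f j)" if "j < n" for j using fX that by (simp add: x_def)
  have f_pos: "f j s = 0" if "s \<ge> 0" for j s using that by (simp add: f_def)
  have impX: "impulsive_part (X j) t =
      (if t = 0 then dirac_comb t l (\<lambda>k. u (Suc k) $ j) else (\<lambda>_. 0))" for j t
    unfolding X_def impulsive_part_pw_dist[OF data] by (simp add: impulse_at_def)
  have imp0: "dirac_comb t l (\<lambda>k. 0) = (\<lambda>_. 0)" for t
    by (simp add: dirac_comb_def)
  define deriv_data where "deriv_data j g c \<longleftrightarrow> has_regular_part (dist_deriv (X j)) g \<and> (\<forall>s\<ge>0. g s = 0) \<and>
      (\<forall>s. impulsive_part (dist_deriv (X j)) s = (\<lambda>\<phi>. c s * dirac s \<phi> + dist_deriv (impulsive_part (X j) s) \<phi>)) \<and>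
      c 0 = u 0 $ j \<and> (\<forall>s>0. c s = 0)" for j g c
  have "\<exists>g c. deriv_data j g c" for j
  proof (rule regular_part_dist_deriv[OF fX[of j]])
    fix g c assume g: "has_regular_part (dist_deriv (X j)) g"
      and g0: "\<And>x b. x < b \<Longrightarrow> (\<And>y. y \<in> {x..<b} \<Longrightarrow> f j y = 0) \<Longrightarrow> g x = 0"
      and c: "\<And>s. impulsive_part (dist_deriv (X j)) s = (\<lambda>\<phi>. c s * dirac s \<phi> + dist_deriv (impulsive_part (X j) s) \<phi>)"
      and cv: "\<And>s a v. a < s \<Longrightarrow> (\<And>y. y \<in> {a<..<s} \<Longrightarrow> f j y = v) \<Longrightarrow> c s = f j s - v"
    have gp: "g s = 0" if "s \<ge> 0" for s
      by (rule g0[of s "s + 1"]) (use that in \<open>auto intro: f_pos\<close>)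
    have "c 0 = f j 0 - (- (u 0 $ j))"
      by (rule cv[of "-1"]) (auto simp: f_def)
    then have c0: "c 0 = u 0 $ j" by (simp add: f_pos)
    have cp: "c s = 0" if "s > 0" for s
      using cv[of 0 s 0] that f_pos by simp
    have "deriv_data j g c"
      unfolding deriv_data_def by (intro conjI allI impI g gp c c0 cp)
    then show ?thesis by (intro exI)
  qed
  then obtain g c where gc: "\<And>j. deriv_data j (g j) (c j)" by metis
  have g: "has_regular_part (dist_deriv (X j)) (g j)"
    and g_pos: "s \<ge> 0 \<Longrightarrow> g j s = 0"
    and c: "impulsive_part (dist_deriv (X j)) s = (\<lambda>\<phi>. c j s * dirac s \<phi> + dist_deriv (impulsive_part (X j) s) \<phi>)"
    and c0: "c j 0 = u 0 $ j" and c_pos: "s > 0 \<Longrightarrow> c j s = 0" for j s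
    using gc[of j, unfolded deriv_data_def] by blast+
  have g': "has_regular_part (map_vec dist_deriv x $ j) (g j)" if "j < n" for j
    using g that by (simp add: x_def)
  have impX': "impulsive_part (dist_deriv (X j)) t =
      (if t = 0 then dirac_comb t l (\<lambda>k. u k $ j) else (\<lambda>_. 0))" if j: "j < n" and t: "t \<ge> 0" for j t
  proof (cases "t = 0")
    case True
    have "case_nat (u 0 $ j) (\<lambda>k. u (Suc k) $ j) = (\<lambda>k. u k $ j)"
      by (auto simp: fun_eq_iff split: nat.split)
    then have "impulsive_part (dist_deriv (X j)) t = dirac_comb t (Suc l) (\<lambda>k. u k $ j)"
      unfolding c impX using True c0 dirac_plus_deriv_dirac_comb[of "u 0 $ j" 0 l "\<lambda>k. u (Suc k) $ j"] by simp
    \<comment> \<open>The top coefficient belongs to \<open>u (Suc l) = 0\<close>.\<close>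
    also have "\<dots> = dirac_comb t l (\<lambda>k. u k $ j)"
      using u0[of "Suc l"] j by (intro dirac_comb_Suc) simp
    finally show ?thesis using True by simp
  next
    case False
    then show ?thesis
      unfolding c impX using c_pos[of t j] t by (simp add: dist_deriv_def)
  qed
  \<comment> \<open>Treating the impulses at the other times as a descent sequence as well, namely the zero
    sequence, avoids repeating the following computations.\<close>
  let ?u = "\<lambda>t k. if t = (0::real) then u k else 0\<^sub>v n"
  have impM: "impulsive_part (mat_mult_dist M x $ i) t = dirac_comb t l (\<lambda>k. (M *\<^sub>v ?u t (Suc k)) $ i)"
    if M: "M \<in> carrier_mat q n" and i: "i < q" for M q i t
    by (rule mat_mult_dist_impulse[where f = f and u = "\<lambda>k. ?u t (Suc k)", OF M i f])
      (auto simp: x_def impX uc imp0)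
  have row: "has_regular_part (mat_mult_dist M x $ i) (\<lambda>s. \<Sum>j<n. M $$ (i, j) * f j s)"
    if "M \<in> carrier_mat q n" "i < q" for M q i
    by (rule mat_mult_dist_parts(1)[where f = f, OF that f])
  have rowE: "has_regular_part (mat_mult_dist E (map_vec dist_deriv x) $ i) (\<lambda>s. \<Sum>j<n. E $$ (i, j) * g j s)"
    if "i < m" for i
    by (rule mat_mult_dist_parts(1)[where f = g, OF E that g'])
  have M0: "M *\<^sub>v 0\<^sub>v n = 0\<^sub>v q" if "M \<in> carrier_mat q n" for M :: "real mat" and q
    using mat_mult_zero_vec[of M] that by simp
  have EAu: "E *\<^sub>v ?u t k = A *\<^sub>v ?u t (Suc k)" for t k
    using EA[of k] M0[OF E] M0[OF A] by (cases "t = 0") simp_all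
  have "dist_restrict {0..} (mat_mult_dist E (map_vec dist_deriv x) $ i) =
      dist_restrict {0..} (mat_mult_dist A x $ i)" if i: "i < m" for i
    unfolding dist_restrict_eq_iff[OF rowE[OF i] row[OF A i]]
  proof (intro conjI allI impI)
    fix t :: real assume t: "t \<ge> 0"
    have "impulsive_part (mat_mult_dist E (map_vec dist_deriv x) $ i) t = dirac_comb t l (\<lambda>k. (E *\<^sub>v ?u t k) $ i)"
      by (rule mat_mult_dist_impulse[where f = g and u = "?u t", OF E i g'])
        (use t in \<open>auto simp: x_def impX' uc imp0\<close>)
    also have "\<dots> = impulsive_part (mat_mult_dist A x $ i) t"
      unfolding impM[OF A i] EAu ..
    finally show "impulsive_part (mat_mult_dist E (map_vec dist_deriv x) $ i) t =
        impulsive_part (mat_mult_dist A x $ i) t" .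
  qed (simp add: f_pos g_pos)
  then have Ex: "map_vec (dist_restrict {0..}) (mat_mult_dist E (map_vec dist_deriv x)) =
      map_vec (dist_restrict {0..}) (mat_mult_dist A x)"
    using E A by (intro eq_vecI) (simp_all add: mat_mult_dist_def)
  have vecs: "mat_mult_dist M x \<in> pw_dist_vecs q" if "M \<in> carrier_mat q n" for M q
    by (rule mat_mult_dist_pw_dist_vecs[where f = f, OF that f])
  have "x \<in> pw_dist_vecs n"
    unfolding pw_dist_vecs_def pw_distributions_iff using f by (auto simp: x_def)
  then have beh: "(x, mat_mult_dist C x, mat_mult_dist L x) \<in> behavior E A C L"
    using Ex vecs[OF C] vecs[OF L] E C L by (simp add: behavior_def)
  have "impulse_free_at (mat_mult_dist C x) t" for t
    unfolding impulse_free_at_def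
  proof (intro allI impI)
    fix i assume "i < dim_vec (mat_mult_dist C x)"
    then have i: "i < p" using C by (simp add: mat_mult_dist_def)
    show "impulsive_part (mat_mult_dist C x $ i) t = (\<lambda>_. 0)"
      unfolding impM[OF C i] dirac_comb_eq_zero_iff using Cu M0[OF C] i by simp
  qed
  then have "impulse_free_at (mat_mult_dist L x) 0"
    using bspec[OF obs[unfolded partially_impulse_observable_def] beh] by simp
  then have free: "impulsive_part (mat_mult_dist L x $ i) 0 = (\<lambda>_. 0)" if "i < r" for i
    using that L by (simp add: impulse_free_at_def mat_mult_dist_def)
  show ?thesis
  proof (cases "i \<le> l")
    case True
    show ?thesis
    proof (rule eq_vecI)
      fix a assume "a < dim_vec (0\<^sub>v r)"
      then have a: "a < r" by simp
      show "(L *\<^sub>v u (Suc i)) $ a = 0\<^sub>v r $ a"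
        using free[OF a] True a unfolding impM[OF L a] dirac_comb_eq_zero_iff by simp
    qed (use L in simp)
  next
    case False
    then show ?thesis using u0[of "Suc i"] M0[OF L] by simp
  qed
qed

section \<open>The equivalence\<close>

lemma observable_iff_descents_vanish:
  assumes E: "E \<in> carrier_mat m n" and A: "A \<in> carrier_mat m n"
    and C: "C \<in> carrier_mat p n" and L: "L \<in> carrier_mat r n"
  shows "partially_impulse_observable E A C L \<longleftrightarrow>
    (\<forall>l u. descent (E_bar E C) (A_bar A C) l u \<longrightarrow> (\<forall>i. L *\<^sub>v u (Suc i) = 0\<^sub>v r))"
proof -
  have "E_bar E C = E @\<^sub>r 0\<^sub>m p n" using E C by (simp add: E_bar_def)
  then have "descent (E_bar E C) (A_bar A C) l u \<longleftrightarrow>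
      descent E A l u \<and> (\<forall>i. C *\<^sub>v u (Suc i) = 0\<^sub>v p)" for l u
    unfolding A_bar_def by (simp only: descent_append_rows[OF E A C])
  then show ?thesis
    using observable_if_descents_vanish[OF E A C L] descents_vanish_if_observable[OF E A C L]
    by metis
qed

theorem theorem3:
  fixes E A C L :: "real mat" and m n p r :: nat
  assumes "E \<in> carrier_mat m n"
    and "A \<in> carrier_mat m n"
    and "C \<in> carrier_mat p n"
    and "L \<in> carrier_mat r n"
  shows
    "(partially_impulse_observable E A C L
        \<longleftrightarrow> (\<forall>l\<ge>n + 1. mat_rank (F_mat l E A C) = mat_rank (F_mat_L l E A C L))) \<and>
     ((\<forall>l\<ge>n + 1. mat_rank (F_mat l E A C) = mat_rank (F_mat_L l E A C L))
        \<longleftrightarrow> mat_rank (F_mat (n + 1) E A C) = mat_rank (F_mat_L (n + 1) E A C L)) \<and>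
     (mat_rank (F_mat (n + 1) E A C) = mat_rank (F_mat_L (n + 1) E A C L)
        \<longleftrightarrow> wong_limit (E_bar E C) (A_bar A C)
              \<inter> mat_preimage (A_bar A C) (mat_image (E_bar E C) (carrier_vec n))
            \<subseteq> mat_kernel L)"
proof -
  note E = assms(1) and A = assms(2) and C = assms(3) and L = assms(4)
  let ?M = "E_bar E C" and ?N = "A_bar A C"
  let ?V = "mat_preimage ?N (mat_image ?M (carrier_vec n))"
  have M: "?M \<in> carrier_mat (m + p) n"
    unfolding E_bar_def by (rule carrier_append_rows[OF E]) (use E C in simp)
  have N: "?N \<in> carrier_mat (m + p) n"
    unfolding A_bar_def by (rule carrier_append_rows[OF A C])
  define vanish where
    "vanish l \<longleftrightarrow> (\<forall>u. descent ?M ?N l u \<longrightarrow> (\<forall>i. L *\<^sub>v u (Suc i) = 0\<^sub>v r))" for l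
  have rank: "mat_rank (F_mat l E A C) = mat_rank (F_mat_L l E A C L) \<longleftrightarrow> vanish l" for l
  proof -
    have "E_bar1 E C L = ?M @\<^sub>r 0\<^sub>m r n" using E L by (simp add: E_bar1_def)
    then show ?thesis
      using rank_block_bidiagonal_eq_iff[OF M N L, of l]
      unfolding F_mat_def F_mat_L_def A_bar1_def vanish_def by (simp only:)
  qed
  have obs: "partially_impulse_observable E A C L \<longleftrightarrow> (\<forall>l. vanish l)"
    unfolding vanish_def by (rule observable_iff_descents_vanish[OF E A C L])
  have wong: "vanish (Suc l) \<longleftrightarrow> wong ?M ?N l \<inter> ?V \<subseteq> mat_kernel L" for l
    unfolding vanish_def by (rule descent_kills_iff_wong[OF M N L])
  have limit: "vanish (n + 1) \<longleftrightarrow> wong_limit ?M ?N \<inter> ?V \<subseteq> mat_kernel L"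
    using wong[of n] by (simp add: wong_stabilizes[OF M N])
  have all: "vanish l" if "wong_limit ?M ?N \<inter> ?V \<subseteq> mat_kernel L" for l
  proof -
    have "wong ?M ?N l \<subseteq> wong_limit ?M ?N" by (auto simp: wong_limit_def)
    then have "vanish (Suc l)" unfolding wong using that by blast
    moreover have "descent ?M ?N (Suc l) u" if "descent ?M ?N l u" for u
      using that by (auto simp: descent_def)
    ultimately show ?thesis unfolding vanish_def by blast
  qed
  have "(\<forall>l\<ge>n + 1. vanish l) \<longleftrightarrow> vanish (n + 1)" "(\<forall>l. vanish l) \<longleftrightarrow> (\<forall>l\<ge>n + 1. vanish l)"
    using limit all by blast+
  then show ?thesis unfolding rank obs limit[symmetric] by blast
qed

end
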